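(* Let $h$ be a dimension function. (1) If $$\limsup_{\varepsilon\to 0}\frac{\log h(\varepsilon)}{\log\varepsilon}=0,$$ then the set $k^{-1}(3)$ does not have $\sigma$-finite $\mathcal{H}^h$ measure. (2) If $$\limsup_{\varepsilon\to 0}\frac{\log h(\varepsilon)}{\log\varepsilon}>0,$$ then $\mathcal{H}^h(k^{-1}(3))=0$. Moreover, if $A_3$ denotes the set of those $x\in k^{-1}(3)$ which are attainable, then $\mathcal{H}^h(A_3)=\mathcal{H}^h(k^{-1}(3))$ for every dimension function $h$.
   Context: A dimension function is a nondecreasing, right continuous function $h:(0,\infty)\to(0,\infty)$ with $h(r)\to 0$ as $r\to 0$; we set $h(0)=0$. The associated Hausdorff measure on subsets $E\subset\mathbb{R}$ is $$\mathcal{H}^h(E)=\lim_{\delta\to 0}\inf\Big\{\sum_i h(\operatorname{diam}(U_i)) : E\subset\bigcup_i U_i,\ \operatorname{diam}(U_i)<\delta\Big\},$$ the infimum being over countable covers. For $x\in\mathbb{R}\setminus\mathbb{Q}$, the best constant of Diophantine approximation is $$k(x)=\sup\Big\{c>0 : \Big|x-\frac pq\Big|<\frac{1}{cq^2}\text{ has infinitely many solutions }\frac pq\in\mathbb{Q}\Big\}\in(0,\infty],$$ and $k^{-1}(3)=\{x\in\mathbb{R}\setminus\mathbb{Q}: k(x)=3\}$. A number $x\in k^{-1}(3)$ is called attainable if $\left|x-\frac pq\right|\le\frac{1}{3q^2}$ has infinitely many rational solutions $\frac pq$. A set $E$ has $\sigma$-finite $\mathcal{H}^h$ measure if it is a countable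 union of sets of finite $\mathcal{H}^h$ measure. *)

theory Defs
  imports "HOL-Analysis.Analysis"
begin

text \<open>Dimension functions are total functions on the reals; only the values on \<open>[0, \<infinity>)\<close>
  are constrained, and only these are ever used.\<close>

definition dimension_function :: "(real \<Rightarrow> real) \<Rightarrow> bool" where
  "dimension_function h \<longleftrightarrow>
     h 0 = 0 \<and> (\<forall>r>0. h r > 0) \<and> mono_on {0<..} h \<and>
     (\<forall>r>0. continuous (at_right r) h) \<and> (h \<longlongrightarrow> 0) (at_right 0)"

text \<open>The library's \<^const>\<open>diameter\<close> is unspecified for unbounded sets, so boundedness is
  required explicitly (the true diameter of an unbounded set is \<open>\<infinity>\<close>, never below \<open>\<delta>\<close>). Finite
  covers are included by padding with empty sets, since \<open>diameter {} = 0\<close> and \<open>h 0 = 0\<close>.\<close>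

definition delta_covers :: "real \<Rightarrow> real set \<Rightarrow> (nat \<Rightarrow> real set) set" where
  "delta_covers \<delta> E =
     {U. E \<subseteq> (\<Union>i. U i) \<and> (\<forall>i. bounded (U i) \<and> diameter (U i) < \<delta>)}"

definition hausdorff_premeasure :: "(real \<Rightarrow> real) \<Rightarrow> real \<Rightarrow> real set \<Rightarrow> ennreal" where
  "hausdorff_premeasure h \<delta> E =
     (INF U \<in> delta_covers \<delta> E. \<Sum>i. ennreal (h (diameter (U i))))"

definition hausdorff_measure :: "(real \<Rightarrow> real) \<Rightarrow> real set \<Rightarrow> ennreal" where
  "hausdorff_measure h E = Lim (at_right 0) (\<lambda>\<delta>. hausdorff_premeasure h \<delta> E)"

lemma hausdorff_premeasure_antimono:
  assumes "\<delta> \<le> \<delta>'"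
  shows "hausdorff_premeasure h \<delta>' E \<le> hausdorff_premeasure h \<delta> E"
  unfolding hausdorff_premeasure_def
proof (rule INF_superset_mono)
  show "delta_covers \<delta> E \<subseteq> delta_covers \<delta>' E"
    using assms unfolding delta_covers_def by (blast intro: less_le_trans)
qed simp

text \<open>The defining limit always exists in \<open>[0, \<infinity>]\<close>.\<close>

lemma hausdorff_premeasure_tendsto_SUP:
  "((\<lambda>\<delta>. hausdorff_premeasure h \<delta> E) \<longlongrightarrow> (SUP \<delta>\<in>{0<..}. hausdorff_premeasure h \<delta> E)) (at_right 0)"
proof (rule order_tendstoI)
  fix a assume "a < (SUP \<delta>\<in>{0<..}. hausdorff_premeasure h \<delta> E)"
  then obtain d where d: "d > 0" "a < hausdorff_premeasure h d E"
    by (auto simp: less_SUP_iff)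
  have "a < hausdorff_premeasure h \<delta> E" if "\<delta> < d" for \<delta>
    using hausdorff_premeasure_antimono[of \<delta> d h E] d(2) that by simp
  then show "eventually (\<lambda>\<delta>. a < hausdorff_premeasure h \<delta> E) (at_right 0)"
    using d(1) by (auto simp: eventually_at_right_field)
next
  fix a assume a: "(SUP \<delta>\<in>{0<..}. hausdorff_premeasure h \<delta> E) < a"
  have "hausdorff_premeasure h \<delta> E < a" if "\<delta> > 0" for \<delta>
    using SUP_upper[of \<delta> "{0<..}" "\<lambda>\<delta>. hausdorff_premeasure h \<delta> E"] a that by simp
  then show "eventually (\<lambda>\<delta>. hausdorff_premeasure h \<delta> E < a) (at_right 0)"
    by (auto simp: eventually_at_right_field intro: exI[of _ 1])
qed

lemma hausdorff_measure_eq_SUP: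
  "hausdorff_measure h E = (SUP \<delta>\<in>{0<..}. hausdorff_premeasure h \<delta> E)"
  unfolding hausdorff_measure_def
  by (rule tendsto_Lim[OF _ hausdorff_premeasure_tendsto_SUP]) simp

definition sigma_finite_hausdorff :: "(real \<Rightarrow> real) \<Rightarrow> real set \<Rightarrow> bool" where
  "sigma_finite_hausdorff h E \<longleftrightarrow>
     (\<exists>A :: nat \<Rightarrow> real set. E = (\<Union>i. A i) \<and> (\<forall>i. hausdorff_measure h (A i) < \<infinity>))"

text \<open>Solutions are counted as rational numbers, not as pairs of integers. Lowest terms need not
  be imposed: if some representation of a rational satisfies either inequality below, then so
  does the reduced one.\<close>

definition approx_constant :: "real \<Rightarrow> ereal" where
  "approx_constant x =
     (SUP c \<in> {c :: real. c > 0 \<and>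
        infinite {r. \<exists>p q :: int. q > 0 \<and> r = of_int p / of_int q \<and>
                       \<bar>x - r\<bar> < 1 / (c * (of_int q)\<^sup>2)}}. ereal c)"

definition k_level_3 :: "real set" where
  "k_level_3 = {x. x \<notin> \<rat> \<and> approx_constant x = 3}"

definition attainable_3 :: "real set" where
  "attainable_3 = {x \<in> k_level_3.
     infinite {r. \<exists>p q :: int. q > 0 \<and> r = of_int p / of_int q \<and>
                    \<bar>x - r\<bar> \<le> 1 / (3 * (of_int q)\<^sup>2)}}"

end

theory Submission
  imports Defs "HOL-Library.Sublist"
begin

text \<open>Write \<open>x\<close> as a continued fraction. By Legendre's theorem \<open>k(x)\<close> is the limsup of the sums
  \<open>\<lambda>\<^sub>n = a\<^sub>n + [0; a\<^sub>n\<^sub>+\<^sub>1, \<dots>] + [0; a\<^sub>n\<^sub>-\<^sub>1, \<dots>, a\<^sub>1]\<close>. The key identity is that at a factor \<open>u\<^sup>R 2 2 1 1 v\<close>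
  the second 2 gives \<open>\<lambda> = 3 + 1/(2 + [0; u]) - 1/(2 + [0; v])\<close>, so \<open>\<lambda> \<le> 3\<close> compares the past
  with the future.

  Upper bound. If \<open>\<lambda>\<^sub>n \<le> 3 + \<epsilon>\<close> eventually, then all factors of bounded length avoid the words violating
  this comparison. A word with arbitrarily long two-sided extensions avoiding them is a word over
  \<open>a = 22\<close>, \<open>b = 11\<close> satisfying Markoff's condition, it cannot contain both \<open>aa\<close> and \<open>bb\<close>, and it is
  therefore the image under \<open>a \<mapsto> a, b \<mapsto> ab\<close> or \<open>a \<mapsto> ba, b \<mapsto> b\<close> of a word of the same kind. Iterating, it
  becomes a concatenation of two words one of which is long, so such words have zero entropy. Hence
  \<open>k\<^sup>-\<^sup>1(3)\<close> is a countable union of sets of arbitrarily small upper box dimension.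

  Lower bound. If all partial quotients 2 come in pairs separated by even blocks of 1s whose
  lengths tend to infinity, then \<open>k(x) = 3\<close>, and \<open>x\<close> is attainable if infinitely often a block is much
  longer than its predecessor. The lengths may grow arbitrarily slowly, and moving each pair by two
  places or not yields a Cantor set whose natural measure is \<open>o(h)\<close> on small intervals.\<close>

section \<open>Two-sided extendable words\<close>

text \<open>Markoff's condition alone does not separate the two squares: \<open>aababb\<close> has
  no forbidden factor, yet it contains \<open>aa\<close> and \<open>bb\<close>. The contradiction
  appears only among its continuations, so the combinatorics is about words that extend on both
  sides. The digits of an actual number certify only finite contexts; compactness links the two.

  A positive limsup bounds \<open>h\<close> by a power along some scales only, so the upper bound
  needs covers at every scale, and Hausdorff dimension zero would not suffice. For the lower bound
  the Cantor set is parametrised by the binary digits of \<open>y\<close> in \<open>[0,1)\<close>,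
  with Lebesgue measure as mass. Being \<open>o(h)\<close>, this mass makes the preimage of every
  set of finite measure null, which gives non-sigma-finiteness and infinite measure of the
  attainable set together. The limsup is never negative, so the two measures in the last claim are
  both infinite or both zero.

  Two rates recur: prefixing a digit 1 or 2 divides the distance of two tails in
  \<open>[0,1]\<close> by at most \<open>9 = 3^2\<close>, and that of tails above \<open>1/3\<close>
  by at least \<open>16/9 = (4/3)^2\<close>.\<close>

definition factor_closed :: "('a list \<Rightarrow> bool) \<Rightarrow> bool" where
  "factor_closed Q \<longleftrightarrow> (\<forall>u v. Q v \<longrightarrow> sublist u v \<longrightarrow> Q u)"

text \<open>Contexts for different \<open>n\<close> need not fit together. This is the information
  that windows of a digit sequence supply, and no limit word has to be chosen.\<close>

definition margin :: "('a list \<Rightarrow> bool) \<Rightarrow> nat \<Rightarrow> 'a list \<Rightarrow> bool" where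
  "margin Q n w \<longleftrightarrow> (\<exists>u v. n \<le> length u \<and> n \<le> length v \<and> Q (u @ w @ v))"

definition extendable :: "('a list \<Rightarrow> bool) \<Rightarrow> 'a list \<Rightarrow> bool" where
  "extendable Q w \<longleftrightarrow> (\<forall>n. margin Q n w)"

lemma factor_closedD: "factor_closed Q \<Longrightarrow> Q v \<Longrightarrow> sublist u v \<Longrightarrow> Q u"
  unfolding factor_closed_def by blast

lemma margin_antimono: "margin Q n w \<Longrightarrow> m \<le> n \<Longrightarrow> margin Q m w"
  unfolding margin_def by (meson order_trans)

text \<open>A finite replacement for Koenig's lemma: if every candidate failed somewhere, all would
  fail at the largest of these finitely many indices.\<close>

lemma antitone_pigeonhole:
  fixes P :: "nat \<Rightarrow> 'a \<Rightarrow> bool"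
  assumes fin: "finite F" and ex: "\<And>n. \<exists>w\<in>F. P n w"
    and anti: "\<And>m n w. m \<le> n \<Longrightarrow> P n w \<Longrightarrow> P m w"
  shows "\<exists>w\<in>F. \<forall>n. P n w"
proof (rule ccontr)
  assume "\<not> ?thesis"
  then have "\<forall>w\<in>F. \<exists>n. \<not> P n w" by blast
  then obtain f where f: "\<And>w. w \<in> F \<Longrightarrow> \<not> P (f w) w" by metis
  obtain w where w: "w \<in> F" "P (Max (f ` F)) w" using ex by blast
  then have "P (f w) w" using anti[of "f w" "Max (f ` F)" w] fin by simp
  then show False using f w by blast
qed

lemma extendable_pigeonhole:
  assumes "finite F" "\<And>n. \<exists>w\<in>F. margin Q n w"
  shows "\<exists>w\<in>F. extendable Q w"
  unfolding extendable_def
  by (rule antitone_pigeonhole[OF assms]) (auto intro: margin_antimono)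

text \<open>Taking the next letter from a context of size \<open>n + 1\<close> leaves margin
  \<open>n\<close>, and one of the finitely many letters serves all \<open>n\<close>.\<close>

lemma extendable_snoc:
  fixes w :: "'a::finite list"
  assumes "extendable Q w"
  shows "\<exists>c. extendable Q (w @ [c])"
proof -
  have "\<exists>w'\<in>range (\<lambda>c. w @ [c]). margin Q n w'" for n
  proof -
    have "margin Q (Suc n) w" using assms by (simp add: extendable_def)
    then obtain u v where uv: "Suc n \<le> length u" "Suc n \<le> length v" "Q (u @ w @ v)"
      by (auto simp: margin_def)
    then obtain c v' where "v = c # v'" by (cases v) auto
    then have "margin Q n (w @ [c])"
      using uv unfolding margin_def by (intro exI[of _ u] exI[of _ v']) auto
    then show ?thesis by blast
  qed
  from extendable_pigeonhole[OF _ this] show ?thesis by auto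
qed

lemma extendable_Cons:
  fixes w :: "'a::finite list"
  assumes "extendable Q w"
  shows "\<exists>c. extendable Q (c # w)"
proof -
  have "\<exists>w'\<in>range (\<lambda>c. c # w). margin Q n w'" for n
  proof -
    have "margin Q (Suc n) w" using assms by (simp add: extendable_def)
    then obtain u v where uv: "Suc n \<le> length u" "Suc n \<le> length v" "Q (u @ w @ v)"
      by (auto simp: margin_def)
    then obtain c u' where "u = u' @ [c]" by (cases u rule: rev_cases) auto
    then have "margin Q n (c # w)"
      using uv unfolding margin_def by (intro exI[of _ u'] exI[of _ v]) auto
    then show ?thesis by blast
  qed
  from extendable_pigeonhole[OF _ this] show ?thesis by auto
qed

lemma extendable_append_right:
  fixes w :: "'a::finite list"
  assumes "extendable Q w"
  shows "\<exists>v. length v = n \<and> extendable Q (w @ v)"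
proof (induction n)
  case 0
  show ?case using assms by simp
next
  case (Suc n)
  then obtain v where v: "length v = n" "extendable Q (w @ v)" by blast
  then obtain c where "extendable Q ((w @ v) @ [c])" using extendable_snoc by blast
  then show ?case using v by (intro exI[of _ "v @ [c]"]) simp
qed

lemma extendable_append_left:
  fixes w :: "'a::finite list"
  assumes "extendable Q w"
  shows "\<exists>u. length u = n \<and> extendable Q (u @ w)"
proof (induction n)
  case 0
  show ?case using assms by simp
next
  case (Suc n)
  then obtain u where u: "length u = n" "extendable Q (u @ w)" by blast
  then obtain c where "extendable Q (c # (u @ w))" using extendable_Cons by blast
  then show ?case using u by (intro exI[of _ "c # u"]) simp
qed

lemma extendable_sublist:
  assumes "factor_closed Q" "extendable Q w" "sublist w' w"
  shows "extendable Q w'"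
  unfolding extendable_def
proof
  fix n
  obtain a b where ab: "w = a @ w' @ b" using assms(3) by (auto simp: sublist_def)
  obtain u v where "n \<le> length u" "n \<le> length v" "Q (u @ w @ v)"
    using assms(2) unfolding extendable_def margin_def by blast
  then show "margin Q n w'"
    unfolding margin_def by (intro exI[of _ "u @ a"] exI[of _ "b @ v"]) (auto simp: ab)
qed

lemma extendable_suffix: "factor_closed Q \<Longrightarrow> extendable Q (p @ w) \<Longrightarrow> extendable Q w"
  by (rule extendable_sublist) auto

lemma extendable_prefix: "factor_closed Q \<Longrightarrow> extendable Q (w @ p) \<Longrightarrow> extendable Q w"
  by (rule extendable_sublist) auto

lemma extendableD: "factor_closed Q \<Longrightarrow> extendable Q w \<Longrightarrow> Q w"
  unfolding extendable_def margin_def by (metis factor_closedD sublist_appendI)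

text \<open>Proof rule for extendability: an invariant that can always be prolonged on either side.
  It serves to show that a desubstituted word is extendable, its context being read off that of its
  image.\<close>

lemma extendable_coinduct:
  assumes "X w" and sub: "\<And>w. X w \<Longrightarrow> Q w"
    and right: "\<And>w. X w \<Longrightarrow> \<exists>c. X (w @ [c])" and left: "\<And>w. X w \<Longrightarrow> \<exists>c. X (c # w)"
  shows "extendable Q w"
  unfolding extendable_def
proof
  fix n
  have "\<exists>u v. length u = n \<and> length v = n \<and> X (u @ w @ v)"
  proof (induction n)
    case 0
    then show ?case using assms(1) by simp
  next
    case (Suc n)
    then obtain u v where uv: "length u = n" "length v = n" "X (u @ w @ v)" by blast
    obtain c where "X ((u @ w @ v) @ [c])" using right uv(3) by blast
    moreover obtain c' where "X (c' # (u @ w @ v) @ [c])" using left calculation by blast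
    ultimately show ?case using uv by (intro exI[of _ "c' # u"] exI[of _ "v @ [c]"]) simp
  qed
  then show "margin Q n w" unfolding margin_def using sub by (metis order_refl)
qed

text \<open>There are finitely many words of length \<open>l\<close>, so a single margin exposes all
  the non-extendable ones. Thus a count of extendable words bounds the windows of an actual digit
  sequence.\<close>

lemma extendable_compactness:
  fixes Q :: "'a::finite list \<Rightarrow> bool"
  shows "\<exists>n. \<forall>w. length w = l \<longrightarrow> margin Q n w \<longrightarrow> extendable Q w"
proof (rule ccontr)
  assume neg: "\<not> ?thesis"
  let ?F = "{w :: 'a list. length w = l \<and> \<not> extendable Q w}"
  have "?F \<subseteq> {w. set w \<subseteq> UNIV \<and> length w = l}" by auto
  then have "finite ?F" using finite_lists_length_eq[of "UNIV :: 'a set" l] finite_subset by fastforce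
  moreover have "\<exists>w\<in>?F. margin Q n w" for n using neg by auto
  ultimately show False using extendable_pigeonhole[of ?F Q] by blast
qed

text \<open>\<open>False\<close> and \<open>True\<close> stand for the letters \<open>a = 22\<close> and \<open>b = 11\<close>.\<close>

definition markoff_word :: "bool list \<Rightarrow> bool" where
  "markoff_word w \<longleftrightarrow> (\<forall>x m. \<not> sublist ([x] @ rev m @ [x, \<not> x] @ m @ [\<not> x]) w)"

lemma factor_closed_markoff: "factor_closed markoff_word"
  unfolding factor_closed_def markoff_word_def using sublist_order.order_trans by blast

lemma markoff_extendableD:
  assumes "extendable markoff_word (p @ [x] @ rev m @ [x, \<not> x] @ m @ [\<not> x] @ q)"
  shows False
proof -
  have "markoff_word (p @ ([x] @ rev m @ [x, \<not> x] @ m @ [\<not> x]) @ q)"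
    using extendableD[OF factor_closed_markoff] assms by simp
  then show False unfolding markoff_word_def using sublist_appendI by blast
qed

section \<open>Incompatibility of the two squares\<close>

abbreviation alt :: "bool \<Rightarrow> nat \<Rightarrow> bool list" where
  "alt x k \<equiv> concat (replicate k [\<not> x, x])"

lemma alt_snoc: "alt x k @ [\<not> x, x] = [\<not> x, x] @ alt x k"
  by (induction k) auto

lemma alt_shift: "[x] @ alt x k = alt (\<not> x) k @ [x]"
  by (induction k) auto

lemma alt_add: "alt x (i + j) = alt x i @ alt x j"
  by (simp add: replicate_add)

lemma rev_alt: "rev (alt x k) = alt (\<not> x) k"
proof (induction k)
  case (Suc k)
  then show ?case using alt_snoc[of k "\<not> x"] by simp
qed simp

text \<open>The continuation to the right is forced to alternate: repeating \<open>\<not> x\<close>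
  completes a forbidden factor, and repeating \<open>x\<close> gives a shorter instance with the
  letters exchanged. Once it is as long as the alternating stretch on the left, it mirrors that
  stretch and is itself forbidden.\<close>

lemma no_square_pair:
  "\<not> extendable markoff_word ([x, x] @ alt x k @ [\<not> x, \<not> x])"
proof (induction k arbitrary: x rule: less_induct)
  case (less k)
  let ?E = "extendable markoff_word"
  show ?case
  proof
    assume asm: "?E ([x, x] @ alt x k @ [\<not> x, \<not> x])"
    have W0: "[x, x] @ alt x k @ [\<not> x, \<not> x] = [x] @ alt (\<not> x) k @ [x, \<not> x] @ [\<not> x]"
      using alt_shift[of x k] by simp
    let ?W = "[x] @ alt (\<not> x) k @ [x, \<not> x]"
    have down: "\<not> ?E (?W @ alt x (Suc j) @ [x])" if "j < k" for j
    proof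
      assume E: "?E (?W @ alt x (Suc j) @ [x])"
      have eq: "?W @ alt x (Suc j) @ [x] = ([x] @ alt (\<not> x) k @ [x]) @ ([\<not> x, \<not> x] @ alt (\<not> x) j @ [x, x])"
        using alt_shift[of x j] by simp
      have "?E ([\<not> x, \<not> x] @ alt (\<not> x) j @ [x, x])"
        by (rule extendable_suffix[OF factor_closed_markoff E[unfolded eq]])
      then show False using less[OF that, of "\<not> x"] by simp
    qed
    have step: "?E (?W @ alt x j @ [\<not> x])" if "j \<le> k" for j
      using that
    proof (induction j)
      case 0
      show ?case using asm[unfolded W0] by simp
    next
      case (Suc j)
      then have E: "?E (?W @ alt x j @ [\<not> x])" by simp
      then obtain c where c: "?E ((?W @ alt x j @ [\<not> x]) @ [c])" using extendable_snoc by blast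
      have "c = x"
      proof (rule ccontr)
        assume "c \<noteq> x"
        then have cx: "c = (\<not> x)" by auto
        \<comment> \<open>The mirror centre is the last \<open>[x, \<not> x]\<close> of
          \<open>?W\<close>; only the nearest \<open>j + 1\<close> of the \<open>k\<close>
          alternations to its left are matched.\<close>
        obtain i where k: "k = Suc (j + i)" using Suc.prems by (metis less_eq_Suc_le less_imp_Suc_add)
        have split: "alt (\<not> x) k = alt (\<not> x) i @ [x, \<not> x] @ alt (\<not> x) j"
          using alt_add[of i "Suc j" "\<not> x"] unfolding k by (simp add: add.commute)
        have eq: "(?W @ alt x j @ [\<not> x]) @ [c] =
            ([x] @ alt (\<not> x) i) @ [x] @ rev (alt x j @ [\<not> x]) @ [x, \<not> x] @ (alt x j @ [\<not> x]) @ [\<not> x] @ []"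
          unfolding split cx by (simp add: rev_alt)
        show False by (rule markoff_extendableD[OF c[unfolded eq]])
      qed
      then have E2: "?E (?W @ alt x (Suc j))" using c by (simp add: alt_snoc[simplified])
      then obtain c' where c': "?E ((?W @ alt x (Suc j)) @ [c'])" using extendable_snoc by blast
      have "c' \<noteq> x"
      proof
        assume "c' = x"
        then have "?E (?W @ alt x (Suc j) @ [x])" using c' by (simp only: append_assoc)
        then show False using down[of j] Suc.prems by simp
      qed
      then have "c' = (\<not> x)" by auto
      then show ?case using c' by simp
    qed
    have E: "?E (?W @ alt x k @ [\<not> x])" by (rule step) simp
    have eq: "?W @ alt x k @ [\<not> x] = [] @ [x] @ rev (alt x k) @ [x, \<not> x] @ alt x k @ [\<not> x] @ []"
      by (simp add: rev_alt)
    show False by (rule markoff_extendableD[OF E[unfolded eq]])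
  qed
qed


text \<open>Reading \<open>v\<close> from the left, everything since the last \<open>xx\<close>
  alternates. Another \<open>xx\<close> restarts the argument, and the first doubled
  \<open>\<not> x\<close> would complete the word excluded by \<open>no_square_pair\<close>.\<close>

lemma no_square_after_square:
  "extendable markoff_word ([x, x] @ alt x k @ v) \<Longrightarrow> \<not> sublist [\<not> x, \<not> x] v"
proof (induction v arbitrary: k rule: length_induct)
  case (1 v)
  let ?E = "extendable markoff_word"
  show ?case
  proof (cases v)
    case (Cons c v')
    show ?thesis
    proof (cases "c = x")
      case True
      have "[x, x] @ alt x k @ v = ([x] @ alt (\<not> x) k) @ ([x, x] @ alt x 0 @ v')"
        using alt_shift[of x k] True Cons by simp
      then have "?E ([x, x] @ alt x 0 @ v')"
        using extendable_suffix[OF factor_closed_markoff] 1(2) by metis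
      then have "\<not> sublist [\<not> x, \<not> x] v'" using 1(1)[rule_format, of v' 0] Cons by simp
      then show ?thesis using Cons True by (simp add: sublist_Cons_right)
    next
      case c: False
      show ?thesis
      proof (cases v')
        case Nil
        then show ?thesis using Cons by (simp add: sublist_Cons_right)
      next
        case v': (Cons c' v'')
        have "c' = x"
        proof (rule ccontr)
          assume "c' \<noteq> x"
          then have "[x, x] @ alt x k @ v = ([x, x] @ alt x k @ [\<not> x, \<not> x]) @ v''"
            using c Cons v' by auto
          then have "?E ([x, x] @ alt x k @ [\<not> x, \<not> x])"
            using extendable_prefix[OF factor_closed_markoff] 1(2) by metis
          then show False using no_square_pair by blast
        qed
        then have "v = [\<not> x, x] @ v''" using c Cons v' by auto
        then have "[x, x] @ alt x k @ v = [x, x] @ alt x (Suc k) @ v''"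
          using arg_cong[OF alt_snoc[of k x], of "\<lambda>l. [x, x] @ l @ v''"] by simp
        then have "extendable markoff_word ([x, x] @ alt x (Suc k) @ v'')" using 1(2) by (simp only:)
        then have "\<not> sublist [\<not> x, \<not> x] v''"
          by (intro 1(1)[rule_format, of v'' "Suc k"] exI) (simp_all add: Cons v')
        then show ?thesis using Cons v' c \<open>c' = x\<close> by (simp add: sublist_Cons_right)
      qed
    qed
  qed simp
qed

text \<open>The squares cannot overlap, so one lies to the left of the other, and
  \<open>no_square_after_square\<close> applies to the one that comes first.\<close>

lemma not_both_squares:
  assumes E: "extendable markoff_word w" and s: "sublist [x, x] w"
  shows "\<not> sublist [\<not> x, \<not> x] w"
proof
  assume t: "sublist [\<not> x, \<not> x] w"
  obtain p q where w: "w = p @ [x, x] @ q" using s by (auto simp: sublist_def)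
  note C = no_square_after_square[where k = 0, simplified]
  have "extendable markoff_word ([x, x] @ q)"
    using extendable_suffix[OF factor_closed_markoff] E w by blast
  then have "\<not> sublist [\<not> x, \<not> x] q" using C[of x q] by simp
  then have "sublist [\<not> x, \<not> x] p"
    using t unfolding w
    by (auto simp: sublist_append sublist_Cons_right Cons_eq_append_conv suffix_def append_eq_Cons_conv prefix_Cons)
  then obtain p1 p2 where p: "p = p1 @ [\<not> x, \<not> x] @ p2" by (auto simp: sublist_def)
  have "w = p1 @ ([\<not> x, \<not> x] @ (p2 @ [x, x] @ q))" using w p by simp
  then have "extendable markoff_word ([\<not> x, \<not> x] @ (p2 @ [x, x] @ q))"
    using extendable_suffix[OF factor_closed_markoff] E by metis
  then have "\<not> sublist [x, x] (p2 @ [x, x] @ q)" using C[of "\<not> x" "p2 @ [x, x] @ q"] by simp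
  then show False using sublist_appendI by blast
qed

section \<open>Substitutions and their inversion on Markoff words\<close>

definition subst :: "'a list \<Rightarrow> 'a list \<Rightarrow> bool list \<Rightarrow> 'a list" where
  "subst A B z = concat (map (\<lambda>c. if c then B else A) z)"

lemma subst_simps [simp]:
  "subst A B [] = []" "subst A B (c # z) = (if c then B else A) @ subst A B z"
  "subst A B (y @ z) = subst A B y @ subst A B z"
  by (simp_all add: subst_def)

definition block :: "bool \<Rightarrow> bool list \<Rightarrow> bool list" where
  "block x z = concat (map (\<lambda>c. if c = x then [x] else [x, \<not> x]) z)"

lemma block_simps [simp]:
  "block x [] = []" "block x (c # z) = (if c = x then [x] else [x, \<not> x]) @ block x z"
  "block x (y @ z) = block x y @ block x z"
  by (simp_all add: block_def)

text \<open>The substitution commutes with reversal only up to conjugation by \<open>x\<close>. This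
  is one reason for the trailing \<open>x\<close> in the statements below.\<close>

lemma block_Cons_snoc: "block x z @ [x] = [x] @ rev (block x (rev z))"
  by (induction z) auto

lemma hd_block: "\<exists>r. block x z @ [x] = x # r"
  by (cases z) auto

text \<open>A forbidden factor with middle word \<open>m\<close> is mapped onto one with middle word
  \<open>block x m @ [x]\<close>. For \<open>y = (\<not> x)\<close> its last letter is the first
  letter of the next block, or the trailing \<open>x\<close>.\<close>

lemma markoff_word_block:
  assumes "markoff_word (block x z @ [x])"
  shows "markoff_word z"
  unfolding markoff_word_def
proof (intro allI notI)
  fix y m
  assume "sublist ([y] @ rev m @ [y, \<not> y] @ m @ [\<not> y]) z"
  then obtain p q where z: "z = p @ [y] @ rev m @ [y, \<not> y] @ m @ [\<not> y] @ q"
    by (auto simp: sublist_def)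
  define n where "n = block x m @ [x]"
  have rn: "rev n = block x (rev m) @ [x]"
    unfolding n_def using block_Cons_snoc[of x "rev m"] by simp
  have "sublist ([y] @ rev n @ [y, \<not> y] @ n @ [\<not> y]) (block x z @ [x])"
  proof (cases "y = x")
    case True
    have "block x z @ [x] = block x p @ ([y] @ rev n @ [y, \<not> y] @ n @ [\<not> y]) @ block x q @ [x]"
      unfolding z rn unfolding n_def using True by simp
    then show ?thesis by (metis sublist_appendI)
  next
    case False
    obtain r where r: "block x q @ [x] = x # r" using hd_block by blast
    have "block x z @ [x] = (block x p @ [x]) @ ([y] @ rev n @ [y, \<not> y] @ n @ [\<not> y]) @ r"
      unfolding z rn unfolding n_def using False r by auto
    then show ?thesis by (metis sublist_appendI)
  qed
  then show False using assms unfolding markoff_word_def by blast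
qed

lemma block_decode:
  assumes "\<not> sublist [\<not> x, \<not> x] w" "w = [] \<or> hd w = x"
  shows "\<exists>z. w = block x z"
  using assms
proof (induction w rule: length_induct)
  case (1 w)
  show ?case
  proof (cases w)
    case Nil
    then show ?thesis by (metis block_simps(1))
  next
    case (Cons c v)
    then have c: "c = x" using 1 by simp
    show ?thesis
    proof (cases "v = [] \<or> hd v = x")
      case True
      moreover have "\<not> sublist [\<not> x, \<not> x] v" using 1 Cons by (simp add: sublist_Cons_right)
      ultimately obtain z where "v = block x z" using 1(1)[rule_format, of v] Cons by auto
      then have "w = block x (x # z)" using Cons c by simp
      then show ?thesis by blast
    next
      case False
      then obtain v' where v: "v = (\<not> x) # v'" by (cases v) auto
      have "\<not> sublist [\<not> x, \<not> x] v'" "v' = [] \<or> hd v' = x"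
        using 1 Cons v by (auto simp: sublist_Cons_right prefix_Cons neq_Nil_conv)
      then obtain z where "v' = block x z" using 1(1)[rule_format, of v'] Cons v by auto
      then have "w = block x ((\<not> x) # z)" using Cons c v by simp
      then show ?thesis by blast
    qed
  qed
qed

definition markoff_avoiding :: "bool \<Rightarrow> bool list \<Rightarrow> bool" where
  "markoff_avoiding y w \<longleftrightarrow> markoff_word w \<and> \<not> sublist [y, y] w"

lemma factor_closed_avoiding: "factor_closed (markoff_avoiding y)"
  unfolding factor_closed_def markoff_avoiding_def
  using factor_closedD[OF factor_closed_markoff] sublist_order.order_trans by blast

text \<open>Each context misses the square of one of the letters, but which one may vary with its
  size. The pigeonhole over the two letters fixes it, so that one substitution can be inverted on
  all contexts.\<close>

lemma extendable_avoiding_cases: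
  assumes "extendable markoff_word w"
  shows "\<exists>y. extendable (markoff_avoiding y) w"
proof -
  have "\<exists>y\<in>UNIV. margin (markoff_avoiding y) n w" for n
  proof -
    obtain u where u: "length u = n" "extendable markoff_word (u @ w)"
      using extendable_append_left[OF assms] by blast
    obtain v where v: "length v = n" "extendable markoff_word ((u @ w) @ v)"
      using extendable_append_right[OF u(2)] by blast
    obtain y where "\<not> sublist [y, y] (u @ w @ v)"
      using not_both_squares[OF v(2), of True] by auto
    moreover have "markoff_word (u @ w @ v)"
      using extendableD[OF factor_closed_markoff v(2)] by simp
    ultimately show ?thesis
      using u(1) v(1) unfolding margin_def markoff_avoiding_def
      by (intro bexI[of _ y] exI[of _ u] exI[of _ v]) auto
  qed
  then show ?thesis
    unfolding extendable_def
    using antitone_pigeonhole[of UNIV "\<lambda>n y. margin (markoff_avoiding y) n w"] margin_antimono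
    by (metis finite)
qed

lemma extendable_markoff_desubstitute:
  assumes "extendable markoff_word w"
  shows "\<exists>x z. extendable markoff_word z \<and> sublist w (block x z)"
proof -
  obtain y where y: "extendable (markoff_avoiding y) w"
    using extendable_avoiding_cases[OF assms] by blast
  define x where "x = (\<not> y)"
  let ?E = "extendable (markoff_avoiding y)"
  note fc = factor_closed_avoiding[of y]
  have avoid: "\<not> sublist [\<not> x, \<not> x] v" if "?E v" for v
    using extendableD[OF fc that] by (simp add: markoff_avoiding_def x_def)
  \<comment> \<open>Contexts of the image are parsed outwards: two letters \<open>\<not> x\<close>
    are never adjacent, so at most two letters of context supply the next block.\<close>
  have lift: "extendable markoff_word z" if "?E (block x z @ [x])" for z
  proof (rule extendable_coinduct[where X = "\<lambda>z. ?E (block x z @ [x])"])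
    fix z assume z: "?E (block x z @ [x])"
    show "markoff_word z"
      using extendableD[OF fc z] by (auto simp: markoff_avoiding_def intro: markoff_word_block)
    obtain c where c: "?E ((block x z @ [x]) @ [c])" using extendable_snoc[OF z] by blast
    obtain c2 where c2: "?E (((block x z @ [x]) @ [c]) @ [c2])" using extendable_snoc[OF c] by blast
    show "\<exists>c. ?E (block x (z @ [c]) @ [x])"
    proof (cases "c = x")
      case True
      then show ?thesis using c by (intro exI[of _ x]) simp
    next
      case False
      then have "c2 = x"
        using avoid[OF c2] by (auto simp: sublist_append suffix_def)
      then show ?thesis using c2 False by (intro exI[of _ c]) auto
    qed
    obtain c where c: "?E (c # (block x z @ [x]))" using extendable_Cons[OF z] by blast
    obtain c2 where c2: "?E (c2 # (c # (block x z @ [x])))" using extendable_Cons[OF c] by blast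
    show "\<exists>c. ?E (block x (c # z) @ [x])"
    proof (cases "c = x")
      case True
      then show ?thesis using c by (intro exI[of _ x]) simp
    next
      case False
      then have "c2 = x"
        using avoid[OF c2] by (auto simp: sublist_Cons_right)
      then show ?thesis using c2 False by (intro exI[of _ c]) auto
    qed
  qed (rule that)
  \<comment> \<open>If \<open>w\<close> begins with \<open>\<not> x\<close>, it starts inside a
    block; the missing \<open>x\<close> is found to its left.\<close>
  obtain u where u: "?E (u @ w)" "u @ w = [] \<or> hd (u @ w) = x"
  proof (cases "w = [] \<or> hd w = x")
    case True
    then show ?thesis using that[of "[]"] y by simp
  next
    case False
    then obtain w' where w': "w = (\<not> x) # w'" by (cases w) auto
    obtain c where c: "?E (c # w)" using extendable_Cons[OF y] by blast
    then have "c = x" using avoid[OF c] w' by (auto simp: sublist_Cons_right)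
    then show ?thesis using that[of "[c]"] c by simp
  qed
  \<comment> \<open>The last block, of at most two letters, may be cut off and is given up; its
    first letter is the trailing \<open>x\<close>. Two extra letters keep \<open>w\<close> inside
    the remaining blocks.\<close>
  obtain v where v: "length v = 2" "?E ((u @ w) @ v)" using extendable_append_right[OF u(1)] by blast
  show ?thesis
  proof (cases "u @ w = []")
    case True
    then show ?thesis using assms by auto
  next
    case False
    have "\<exists>z. (u @ w) @ v = block x z"
    proof (rule block_decode[OF avoid[OF v(2)]])
      show "(u @ w) @ v = [] \<or> hd ((u @ w) @ v) = x"
        using hd_append2[OF False, of v] False u(2) by (intro disjI2) blast
    qed
    then obtain z where z: "(u @ w) @ v = block x z" by blast
    have "z \<noteq> []" using z False by auto
    then obtain z' c' where z': "z = z' @ [c']" by (metis rev_exhaust)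
    obtain r where r: "block x [c'] = x # r" "length r \<le> 1" by (cases "c' = x") auto
    have eq: "(u @ w) @ v = block x z' @ x # r" using z z' r by simp
    then have "?E (block x z' @ [x])"
      using v(2) extendable_prefix[OF fc, of "block x z' @ [x]" r] by simp
    moreover have "prefix (u @ w) (block x z')"
    proof (rule prefix_length_prefix)
      show "prefix (u @ w) ((u @ w) @ v)" by simp
      show "prefix (block x z') ((u @ w) @ v)" unfolding eq by simp
      show "length (u @ w) \<le> length (block x z')"
        using arg_cong[OF eq, of length] r(2) v(1) by simp
    qed
    then have "sublist w (block x z')"
      by (auto simp: prefix_def sublist_def) 
    ultimately show ?thesis using lift by blast
  qed
qed

text \<open>The images of the two letters under a composition of \<open>r\<close> substitutions. By
  \<open>subst_block\<close>, one more substitution applied first changes the pair as in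
  \<open>right\<close> or \<open>left\<close>.\<close>

inductive markoff_pair :: "nat \<Rightarrow> bool list \<Rightarrow> bool list \<Rightarrow> bool" where
  base: "markoff_pair 0 [False] [True]"
| right: "markoff_pair r A B \<Longrightarrow> markoff_pair (Suc r) A (A @ B)"
| left: "markoff_pair r A B \<Longrightarrow> markoff_pair (Suc r) (B @ A) B"

lemma subst_block:
  "subst A B (block x z) = (if x then subst (B @ A) B z else subst A (A @ B) z)"
  by (induction z) auto

lemma subst_sublist: "sublist u v \<Longrightarrow> sublist (subst A B u) (subst A B v)"
  by (auto simp: sublist_def) blast

lemma extendable_markoff_desubstitute_iter:
  assumes "extendable markoff_word w"
  shows "\<exists>A B z. markoff_pair r A B \<and> extendable markoff_word z \<and> sublist w (subst A B z)"
proof (induction r)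
  case 0
  have "subst [False] [True] w = w" by (induction w) auto
  then show ?case using assms markoff_pair.base by (metis sublist_order.order_refl)
next
  case (Suc r)
  then obtain A B z where IH: "markoff_pair r A B" "extendable markoff_word z" "sublist w (subst A B z)"
    by blast
  obtain x z' where z': "extendable markoff_word z'" "sublist z (block x z')"
    using extendable_markoff_desubstitute[OF IH(2)] by blast
  have "sublist w (subst A B (block x z'))"
    using IH(3) subst_sublist[OF z'(2)] sublist_order.order_trans by blast
  then show ?case
    unfolding subst_block using IH(1) z'(1) markoff_pair.right markoff_pair.left
    by (cases x) (fastforce, fastforce)
qed

text \<open>Only the sum of the lengths is sure to grow: repeated \<open>right\<close> steps never
  change \<open>A\<close>.\<close>

lemma markoff_pair_length:
  "markoff_pair r A B \<Longrightarrow> A \<noteq> [] \<and> B \<noteq> [] \<and> r + 2 \<le> length A + length B"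
proof (induction rule: markoff_pair.induct)
  case (right r A B)
  then show ?case by (cases A) auto
next
  case (left r A B)
  then show ?case by (cases B) auto
qed simp

lemma finite_markoff_pairs: "finite {(A, B). markoff_pair r A B}"
proof (induction r)
  case 0
  have "{(A, B). markoff_pair 0 A B} \<subseteq> {([False], [True])}" by (auto elim: markoff_pair.cases)
  then show ?case using finite_subset by blast
next
  case (Suc r)
  have "{(A, B). markoff_pair (Suc r) A B} \<subseteq>
    (\<lambda>(A, B). (A, A @ B)) ` {(A, B). markoff_pair r A B} \<union> (\<lambda>(A, B). (B @ A, B)) ` {(A, B). markoff_pair r A B}"
    by (auto elim!: markoff_pair.cases[of "Suc r"] simp: image_iff)
  then show ?case using Suc finite_subset by blast
qed

section \<open>Counting factors of concatenations\<close>

text \<open>Splitting off the first block gives \<open>N(l) <= N(l - |A|) + N(l - |B|)\<close>, and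
  the hypothesis on \<open>\<beta>\<close> makes \<open>\<beta> ^ l\<close> a supersolution of this
  recursion. The factor \<open>2 ^ M\<close> covers the lengths below \<open>M\<close>.\<close>

lemma card_prefixes_subst:
  fixes \<beta> :: real
  assumes \<beta>: "\<beta> \<ge> 1" "1 / \<beta> ^ length A + 1 / \<beta> ^ length B \<le> 1"
    and ne: "A \<noteq> []" "B \<noteq> []" and M: "M = max (length A) (length B)"
  shows "real (card {w :: bool list. length w = l \<and> (\<exists>z. prefix w (subst A B z))}) \<le> 2 ^ M * \<beta> ^ l"
proof (induction l rule: less_induct)
  case (less l)
  let ?P = "\<lambda>l. {w :: bool list. length w = l \<and> (\<exists>z. prefix w (subst A B z))}"
  have fin: "finite {w :: bool list. length w = l}" for l
    using finite_lists_length_eq[of "UNIV :: bool set" l] by simp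
  have finP: "finite (?P l)" for l by (rule finite_subset[OF _ fin[of l]]) auto
  show ?case
  proof (cases "l < M")
    case True
    have "card (?P l) \<le> card {w :: bool list. length w = l}" by (rule card_mono[OF fin]) auto
    also have "\<dots> = 2 ^ l"
      using card_lists_length_eq[of "UNIV :: bool set" l] by (simp add: card_UNIV_bool)
    finally have "real (card (?P l)) \<le> real (2 ^ l)" by (rule of_nat_mono)
    also have "\<dots> = 2 ^ l" by simp
    also have "\<dots> \<le> 2 ^ M" using True by simp
    also have "\<dots> \<le> 2 ^ M * \<beta> ^ l" using \<beta>(1) by (simp add: one_le_power)
    finally show ?thesis .
  next
    case False
    have sub: "?P l \<subseteq> (\<lambda>w. A @ w) ` ?P (l - length A) \<union> (\<lambda>w. B @ w) ` ?P (l - length B)"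
    proof
      fix w assume "w \<in> ?P l"
      then obtain z where w: "length w = l" "prefix w (subst A B z)" by blast
      have "z \<noteq> []" using w False ne M by auto
      then obtain c z' where z: "z = c # z'" by (cases z) auto
      let ?D = "if c then B else A"
      have "prefix ?D w"
        by (rule prefix_length_prefix[of _ "subst A B z"]) (use w False M z in auto)
      then obtain w' where w': "w = ?D @ w'" by (auto simp: prefix_def)
      then have "prefix w' (subst A B z')" using w z by auto
      moreover have "length w' = l - length ?D" using w w' by auto
      ultimately show "w \<in> (\<lambda>w. A @ w) ` ?P (l - length A) \<union> (\<lambda>w. B @ w) ` ?P (l - length B)"
        using w' by (cases c) auto
    qed
    have "card (?P l) \<le> card ((\<lambda>w. A @ w) ` ?P (l - length A) \<union> (\<lambda>w. B @ w) ` ?P (l - length B))"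
      by (rule card_mono[OF _ sub]) (use finP in auto)
    also have "\<dots> \<le> card (?P (l - length A)) + card (?P (l - length B))"
      by (rule order_trans[OF card_Un_le add_mono[OF card_image_le[OF finP] card_image_le[OF finP]]])
    finally have "real (card (?P l)) \<le> real (card (?P (l - length A)) + card (?P (l - length B)))"
      by (rule of_nat_mono)
    also have "\<dots> = real (card (?P (l - length A))) + real (card (?P (l - length B)))"
      by (rule of_nat_add)
    also have "\<dots> \<le> 2 ^ M * \<beta> ^ (l - length A) + 2 ^ M * \<beta> ^ (l - length B)"
    proof (intro add_mono less)
      have "0 < length A" "0 < length B" using ne by auto
      moreover from this have "0 < l"
        using False M max.cobounded1[of "length A" "length B"] by linarith
      ultimately show "l - length A < l" "l - length B < l" by simp_all
    qed
    also have "\<dots> = 2 ^ M * \<beta> ^ l * (1 / \<beta> ^ length A + 1 / \<beta> ^ length B)"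
      using False M \<beta>(1) by (simp add: power_diff field_simps)
    also have "\<dots> \<le> 2 ^ M * \<beta> ^ l * 1"
      by (rule mult_left_mono[OF \<beta>(2)]) (use \<beta>(1) in simp)
    finally show ?thesis by simp
  qed
qed

text \<open>Dropping the blocks that end before \<open>w\<close> starts leaves an offset below
  \<open>M\<close>, so passing from prefixes to factors costs only boundedly many offsets.\<close>

lemma sublist_subst_prefix:
  assumes ne: "A \<noteq> []" "B \<noteq> []" and M: "M = max (length A) (length B)"
  shows "subst A B z = p @ w @ q \<Longrightarrow>
    \<exists>n<M. \<exists>v z'. length v = n + length w \<and> prefix v (subst A B z') \<and> w = drop n v"
proof (induction z arbitrary: p)
  case Nil
  then show ?case using ne M by (intro exI[of _ 0] conjI exI[of _ "[]"]) (auto simp: less_max_iff_disj)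
next
  case (Cons c z)
  let ?D = "if c then B else A"
  show ?case
  proof (cases "length p < length ?D")
    case True
    then have "length p < M" using M by (auto split: if_splits)
    moreover have "prefix (p @ w) (subst A B (c # z))" unfolding Cons.prems by (simp add: prefix_def)
    ultimately show ?thesis by (intro exI[of _ "length p"] conjI exI[of _ "p @ w"] exI[of _ "c # z"]) auto
  next
    case False
    have "prefix ?D p"
    proof (rule prefix_length_prefix[of _ "subst A B (c # z)"])
      show "prefix p (subst A B (c # z))" unfolding Cons.prems by simp
    qed (use False in auto)
    then obtain p' where "p = ?D @ p'" by (auto simp: prefix_def)
    then have "subst A B z = p' @ w @ q" using Cons.prems by auto
    then show ?thesis by (rule Cons.IH)
  qed
qed

lemma card_factors_subst:
  fixes \<beta> :: real
  assumes \<beta>: "\<beta> \<ge> 1" "1 / \<beta> ^ length A + 1 / \<beta> ^ length B \<le> 1"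
    and ne: "A \<noteq> []" "B \<noteq> []"
  shows "\<exists>C. \<forall>l. real (card {w :: bool list. length w = l \<and> (\<exists>z. sublist w (subst A B z))}) \<le> C * \<beta> ^ l"
proof -
  define M where "M = max (length A) (length B)"
  let ?P = "\<lambda>l. {w :: bool list. length w = l \<and> (\<exists>z. prefix w (subst A B z))}"
  have fin: "finite {w :: bool list. length w = l}" for l
    using finite_lists_length_eq[of "UNIV :: bool set" l] by simp
  have finP: "finite (?P l)" for l by (rule finite_subset[OF _ fin[of l]]) auto
  have "real (card {w :: bool list. length w = l \<and> (\<exists>z. sublist w (subst A B z))}) \<le> (M * 2 ^ M * \<beta> ^ M) * \<beta> ^ l" for l
  proof -
    have "{w :: bool list. length w = l \<and> (\<exists>z. sublist w (subst A B z))} \<subseteq> (\<Union>n\<in>{..<M}. drop n ` ?P (n + l))"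
    proof
      fix w :: "bool list" assume "w \<in> {w. length w = l \<and> (\<exists>z. sublist w (subst A B z))}"
      then obtain z p q where w: "length w = l" "subst A B z = p @ w @ q" by (auto simp: sublist_def)
      from sublist_subst_prefix[OF ne M_def w(2)] w(1)
      show "w \<in> (\<Union>n\<in>{..<M}. drop n ` ?P (n + l))" by blast
    qed
    then have "card {w :: bool list. length w = l \<and> (\<exists>z. sublist w (subst A B z))} \<le> card (\<Union>n\<in>{..<M}. drop n ` ?P (n + l))"
      by (intro card_mono) (use finP in auto)
    also have "\<dots> \<le> (\<Sum>n<M. card (drop n ` ?P (n + l)))" by (rule card_UN_le) simp
    also have "\<dots> \<le> (\<Sum>n<M. card (?P (n + l)))" by (intro sum_mono card_image_le finP)
    finally have "real (card {w :: bool list. length w = l \<and> (\<exists>z. sublist w (subst A B z))}) \<le> real (\<Sum>n<M. card (?P (n + l)))"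
      by (rule of_nat_mono)
    also have "\<dots> = (\<Sum>n<M. real (card (?P (n + l))))" by (rule of_nat_sum)
    also have "\<dots> \<le> (\<Sum>n<M. 2 ^ M * \<beta> ^ (M + l))"
    proof (rule sum_mono)
      fix n assume "n \<in> {..<M}"
      then have "\<beta> ^ (n + l) \<le> \<beta> ^ (M + l)" using \<beta>(1) by (intro power_increasing) auto
      then show "real (card (?P (n + l))) \<le> 2 ^ M * \<beta> ^ (M + l)"
        using card_prefixes_subst[OF \<beta> ne M_def, of "n + l"]
        by (meson mult_left_mono order_trans zero_le_numeral zero_le_power)
    qed
    finally show ?thesis by (simp add: power_add mult_ac)
  qed
  then show ?thesis by blast
qed

section \<open>Words of partial quotients\<close>

text \<open>\<open>True\<close> and \<open>False\<close> stand for the partial quotients 1 and 2; each forbidden factor forces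
  \<open>\<lambda> > 3\<close> at one of its letters. The letter \<open>e\<close> depends on the parity of \<open>m\<close> because continued fractions
  are ordered by the alternating lexicographic order.\<close>

definition digit_word :: "bool list \<Rightarrow> bool" where
  "digit_word w \<longleftrightarrow> (\<forall>x. \<not> sublist [x, \<not> x, x] w) \<and>
     (\<forall>x m e. e = (x \<longleftrightarrow> even (length m)) \<longrightarrow>
       \<not> sublist ([e] @ rev m @ [x, x, \<not> x, \<not> x] @ m @ [\<not> e]) w)"

lemma factor_closed_digit: "factor_closed digit_word"
  unfolding factor_closed_def digit_word_def using sublist_order.order_trans by blast

lemma extendable_digit_no_single:
  assumes "extendable digit_word (p @ [x, \<not> x, x] @ q)" shows False
  using extendableD[OF factor_closed_digit assms] unfolding digit_word_def
  using sublist_appendI by blast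

lemma extendable_digit_forbidden:
  assumes "extendable digit_word (p @ ([e] @ rev m @ [x, x, \<not> x, \<not> x] @ m @ [\<not> e]) @ q)"
    and "e = (x \<longleftrightarrow> even (length m))" shows False
  using extendableD[OF factor_closed_digit assms(1)] assms(2) unfolding digit_word_def
  using sublist_appendI by blast

text \<open>Let \<open>y\<close> be the other letter. For \<open>j = i + 1\<close> the left
  neighbour \<open>x\<close> is itself preceded by \<open>x\<close>, so the word becomes
  \<open>xxyy\<close> followed by \<open>2i + 1\<close> more \<open>y\<close>. Compare these with
  the \<open>k\<close> letters \<open>y\<close> just before \<open>xx\<close>: for even
  \<open>k\<close>, and for \<open>k\<close> beyond \<open>2i + 1\<close>, a forbidden factor
  appears; an odd \<open>k\<close> up to \<open>2i + 1\<close> is a shorter odd run.\<close>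

lemma no_odd_run:
  "\<not> extendable digit_word ([x] @ replicate (2 * j + 1) (\<not> x) @ [x])"
proof (induction j rule: less_induct)
  case (less j)
  let ?E = "extendable digit_word"
  define y where "y = (\<not> x)"
  note fc = factor_closed_digit
  show ?case
  proof (cases j)
    case 0
    then show ?thesis using extendable_digit_no_single[of "[]" x "[]"] by auto
  next
    case (Suc i)
    show ?thesis
    proof
      assume "?E ([x] @ replicate (2 * j + 1) (\<not> x) @ [x])"
      then obtain c where c: "?E (c # [x] @ replicate (2 * j + 1) (\<not> x) @ [x])"
        using extendable_Cons by blast
      have rep: "replicate (2 * j + 1) (\<not> x) = [y, y] @ replicate (2 * i + 1) y"
        using Suc by (simp add: y_def)
      have "c = x"
      proof (rule ccontr)
        assume "c \<noteq> x"
        then have eq: "c # [x] @ replicate (2 * j + 1) (\<not> x) @ [x] =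
            [] @ [y, \<not> y, y] @ (y # replicate (2 * i + 1) y @ [x])"
          unfolding rep by (auto simp: y_def)
        show False by (rule extendable_digit_no_single[OF c[unfolded eq]])
      qed
      then have "?E ([x, x, y, y] @ replicate (2 * i + 1) y @ [x])" using c unfolding rep by simp
      then obtain u where u: "length u = 2 * i + 2"
          "?E (u @ [x, x, y, y] @ replicate (2 * i + 1) y @ [x])"
        using extendable_append_left by blast
      define k where "k = length (takeWhile (\<lambda>c. c = y) (rev u))"
      have tw: "takeWhile (\<lambda>c. c = y) (rev u) = replicate k y"
        unfolding k_def by (rule replicate_length_same[symmetric]) (auto dest: set_takeWhileD)
      define R where "R = dropWhile (\<lambda>c. c = y) (rev u)"
      have ru: "rev u = replicate k y @ R"
        unfolding R_def tw[symmetric] by (rule takeWhile_dropWhile_id[symmetric])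
      show False
      proof (cases R)
        case Nil
        then have "rev u = replicate k y" using ru by simp
        then have "u = replicate k y" by (metis rev_replicate rev_rev_ident)
        then have "u = [y] @ replicate (2 * i + 1) y" using u(1) by simp
        then have eq: "u @ [x, x, y, y] @ replicate (2 * i + 1) y @ [x] =
            [] @ ([y] @ rev (replicate (2 * i + 1) y) @ [x, x, \<not> x, \<not> x] @ replicate (2 * i + 1) y @ [\<not> y]) @ []"
          by (simp add: y_def replicate_append_same)
        show False
          by (rule extendable_digit_forbidden[OF u(2)[unfolded eq]]) (simp add: y_def)
      next
        case (Cons c r)
        then have "c \<noteq> y" using hd_dropWhile[of "\<lambda>c. c = y" "rev u"] unfolding R_def by simp
        then have "c = x" by (auto simp: y_def)
        then have "rev u = replicate k y @ [x] @ r" using ru Cons by simp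
        then have "rev (rev u) = rev r @ [x] @ replicate k y" by simp
        then have ueq: "u = rev r @ [x] @ replicate k y" by simp
        then have k: "k < 2 * i + 2" using u(1) by simp
        show False
        proof (cases "even k")
          case True
          then have "k \<le> 2 * i" using k by (elim evenE) auto
          then have "2 * i + 1 = k + (1 + (2 * i - k))" by simp
          then have "replicate (2 * i + 1) y = replicate k y @ [y] @ replicate (2 * i - k) y"
            by (metis replicate_add replicate_0 One_nat_def replicate_Suc)
          then have eq: "u @ [x, x, y, y] @ replicate (2 * i + 1) y @ [x] =
              rev r @ ([x] @ rev (replicate k y) @ [x, x, \<not> x, \<not> x] @ replicate k y @ [\<not> x]) @ (replicate (2 * i - k) y @ [x])"
            unfolding ueq by (simp add: y_def)
          show False
            by (rule extendable_digit_forbidden[OF u(2)[unfolded eq]]) (simp add: True)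
        next
          case False
          then obtain a where a: "k = 2 * a + 1" using oddE by blast
          have eq: "u @ [x, x, y, y] @ replicate (2 * i + 1) y @ [x] =
              rev r @ ([x] @ replicate (2 * a + 1) (\<not> x) @ [x]) @ ([x, y, y] @ replicate (2 * i + 1) y @ [x])"
            unfolding ueq a by (simp add: y_def)
          have "?E ([x] @ replicate (2 * a + 1) (\<not> x) @ [x])"
            by (rule extendable_sublist[OF fc u(2)[unfolded eq] sublist_appendI])
          then show False using less[of a] k a Suc by simp
        qed
      qed
    qed
  qed
qed

text \<open>Two consecutive changes of letter enclose a full run with both neighbours, which is even
  by \<open>no_odd_run\<close>; longer distances add up.\<close>

lemma run_parity:
  assumes U: "extendable digit_word U"
  shows "i < j \<Longrightarrow> Suc j < length U \<Longrightarrow> U ! i \<noteq> U ! Suc i \<Longrightarrow> U ! j \<noteq> U ! Suc j \<Longrightarrow> even (j - i)"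
proof (induction "j - i" arbitrary: i j rule: less_induct)
  case less
  show ?case
  proof (cases "\<exists>k. i < k \<and> k < j \<and> U ! k \<noteq> U ! Suc k")
    case True
    then obtain k where k: "i < k" "k < j" "U ! k \<noteq> U ! Suc k" by blast
    have "even (k - i)" by (rule less(1)) (use k less in auto)
    moreover have "even (j - k)" by (rule less(1)) (use k less in auto)
    moreover have "j - i = (j - k) + (k - i)" using k by simp
    ultimately show ?thesis by simp
  next
    case False
    define y where "y = U ! Suc i"
    have const: "U ! (Suc i + n) = y" if "Suc i + n \<le> j" for n
      using that
    proof (induction n)
      case (Suc n)
      then have "U ! (Suc i + n) = y" by simp
      moreover have "U ! (Suc i + n) = U ! Suc (Suc i + n)" using False Suc.prems by auto
      ultimately show ?case by simp
    qed (simp add: y_def)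
    have j: "U ! j = y" using const[of "j - Suc i"] less by simp
    show ?thesis
    proof (rule ccontr)
      assume "odd (j - i)"
      then obtain a where a: "j - i = 2 * a + 1" using oddE by blast
      have "take (j - i + 2) (drop i U) = [\<not> y] @ replicate (2 * a + 1) (\<not> \<not> y) @ [\<not> y]"
      proof (rule nth_equalityI)
        show "length (take (j - i + 2) (drop i U)) = length ([\<not> y] @ replicate (2 * a + 1) (\<not> \<not> y) @ [\<not> y])"
          using less a by auto
        fix n assume "n < length (take (j - i + 2) (drop i U))"
        then have n: "n < j - i + 2" by simp
        have L: "take (j - i + 2) (drop i U) ! n = U ! (i + n)" using n less by simp
        consider "n = 0" | "n = j - i + 1" | k where "n = Suc k" "Suc k \<le> j - i"
          using n by (metis Suc_eq_plus1 add_2_eq_Suc' less_Suc_eq_le le_SucE not0_implies_Suc)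
        then show "take (j - i + 2) (drop i U) ! n = ([\<not> y] @ replicate (2 * a + 1) (\<not> \<not> y) @ [\<not> y]) ! n"
        proof cases
          case 1
          then show ?thesis unfolding L using less y_def by simp
        next
          case 2
          then have "U ! (i + n) = (\<not> y)" using less j by simp
          then show ?thesis unfolding L using 2 a by (simp add: nth_append)
        next
          case 3
          have "U ! (i + n) = y" using const[of k] 3 less by simp
          then show ?thesis unfolding L using 3 a by (simp add: nth_append nth_Cons split: nat.split)
        qed
      qed
      moreover have "sublist (take (j - i + 2) (drop i U)) U"
        using sublist_order.order_trans sublist_take sublist_drop by blast
      ultimately have "extendable digit_word ([\<not> y] @ replicate (2 * a + 1) (\<not> \<not> y) @ [\<not> y])"
        using extendable_sublist[OF factor_closed_digit U] by metis
      then show False using no_odd_run by blast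
    qed
  qed
qed

section \<open>From digit words to Markoff words by halving\<close>

abbreviation dbl :: "bool list \<Rightarrow> bool list" where
  "dbl \<equiv> subst [False, False] [True, True]"

lemma subst_subst: "subst A' B' (subst A B z) = subst (subst A' B' A) (subst A' B' B) z"
  by (induction z) auto

lemma dbl_Cons: "dbl (c # z) = [c, c] @ dbl z"
  by simp

lemma rev_dbl: "rev (dbl z) = dbl (rev z)"
  by (induction z) auto

lemma length_dbl: "length (dbl z) = 2 * length z"
  by (induction z) auto

text \<open>Doubling makes the length of the middle word even, so that the letter \<open>e\<close>
  of \<open>digit_word\<close> becomes \<open>x\<close>.\<close>

lemma markoff_word_dbl:
  assumes "digit_word (dbl z)" shows "markoff_word z"
  unfolding markoff_word_def
proof (intro allI notI)
  fix x m
  assume "sublist ([x] @ rev m @ [x, \<not> x] @ m @ [\<not> x]) z"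
  then obtain p q where z: "z = p @ [x] @ rev m @ [x, \<not> x] @ m @ [\<not> x] @ q"
    by (auto simp: sublist_def)
  have dx: "dbl [x] = [x, x]" for x by simp
  have "dbl z = (dbl p @ [x]) @ ([x] @ rev (dbl m) @ [x, x, \<not> x, \<not> x] @ dbl m @ [\<not> x]) @ ((\<not> x) # dbl q)"
    unfolding z rev_dbl by auto
  then have "sublist ([x] @ rev (dbl m) @ [x, x, \<not> x, \<not> x] @ dbl m @ [\<not> x]) (dbl z)"
    by (metis sublist_appendI)
  moreover have "x = (x \<longleftrightarrow> even (length (dbl m)))" by (simp add: length_dbl)
  ultimately show False using assms unfolding digit_word_def by blast
qed

lemma dbl_map_nth:
  assumes pairs: "\<And>i. s + 2 * i + 1 < length U \<Longrightarrow> U ! (s + 2 * i) = U ! (s + 2 * i + 1)"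
  shows "a \<le> b \<Longrightarrow> s + 2 * b \<le> length U \<Longrightarrow>
    dbl (map (\<lambda>i. U ! (s + 2 * i)) [a..<b]) = take (2 * (b - a)) (drop (s + 2 * a) U)"
proof (induction b)
  case (Suc b)
  show ?case
  proof (cases "a = Suc b")
    case False
    then have ab: "a \<le> b" using Suc by simp
    have sub: "2 * (Suc b - a) = Suc (Suc (2 * (b - a)))" using ab by simp
    have idx: "s + 2 * a + 2 * (b - a) = s + 2 * b" using ab by simp
    have "take (2 * (Suc b - a)) (drop (s + 2 * a) U) =
        take (2 * (b - a)) (drop (s + 2 * a) U) @ [U ! (s + 2 * b), U ! (s + 2 * b + 1)]"
    proof -
      have T: "take (Suc (Suc k)) xs = take k xs @ [xs ! k, xs ! (k + 1)]" if "k + 1 < length xs" for k and xs :: "bool list"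
        using that by (simp add: take_Suc_conv_app_nth)
      have le: "s + 2 * a \<le> length U" using Suc.prems ab by simp
      have n: "drop (s + 2 * a) U ! (2 * (b - a)) = U ! (s + 2 * b)"
        "drop (s + 2 * a) U ! (2 * (b - a) + 1) = U ! (s + 2 * b + 1)"
        unfolding nth_drop[OF le] add.assoc[symmetric] idx by (rule refl)+
      have len: "2 * (b - a) + 1 < length (drop (s + 2 * a) U)" using Suc.prems ab by simp
      show ?thesis unfolding sub T[OF len] n by (rule refl)
    qed
    moreover have "U ! (s + 2 * b) = U ! (s + 2 * b + 1)" using Suc.prems by (intro pairs) auto
    ultimately show ?thesis using Suc ab by (auto simp: dbl_Cons)
  qed simp
qed simp

lemma extendable_mono:
  "extendable Q w \<Longrightarrow> (\<And>w. Q w \<Longrightarrow> Q' w) \<Longrightarrow> extendable Q' w"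
  unfolding extendable_def margin_def by metis

lemma extendable_digit_halve:
  assumes w: "extendable digit_word w"
  shows "\<exists>z. extendable markoff_word z \<and> sublist w (dbl z)"
proof -
  \<comment> \<open>Enough pairs to cover \<open>w\<close> in either phase, and fixed in advance so
    that \<open>?F\<close> is finite.\<close>
  define k where "k = length w div 2 + 2"
  let ?Q = "\<lambda>z. digit_word (dbl z)"
  let ?F = "{z :: bool list. length z = k \<and> sublist w (dbl z)}"
  have fin: "finite ?F"
    by (rule finite_subset[OF _ finite_lists_length_eq[of "UNIV :: bool set" k]]) auto
  have "\<exists>z\<in>?F. margin ?Q n z" for n
  proof -
    obtain u where u: "length u = 2 * n + 2" "extendable digit_word (u @ w)"
      using extendable_append_left[OF w] by blast
    obtain v where v: "length v = 2 * n + 4" "extendable digit_word ((u @ w) @ v)"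
      using extendable_append_right[OF u(2)] by blast
    define U where "U = u @ w @ v"
    have U: "extendable digit_word U" using v by (simp add: U_def)
    have lU: "length U = 4 * n + 6 + length w" using u v by (simp add: U_def)
    \<comment> \<open>The phase of the pairing: all changes of letter have the same parity, so they
      can be put between the pairs. It may vary with \<open>n\<close>; the pigeonhole over
      \<open>?F\<close> takes care of that.\<close>
    obtain s :: nat where s: "s \<le> 1" and
      pairs: "\<And>i. s + 2 * i + 1 < length U \<Longrightarrow> U ! (s + 2 * i) = U ! (s + 2 * i + 1)"
    proof (cases "\<exists>b. Suc b < length U \<and> U ! b \<noteq> U ! Suc b")
      case False
      then show ?thesis using that[of 0] by auto
    next
      case True
      then obtain b where b: "Suc b < length U" "U ! b \<noteq> U ! Suc b" by blast
      have "U ! (Suc b mod 2 + 2 * i) = U ! (Suc b mod 2 + 2 * i + 1)"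
        if i: "Suc b mod 2 + 2 * i + 1 < length U" for i
      proof (rule ccontr)
        let ?j = "Suc b mod 2 + 2 * i"
        assume ne: "U ! ?j \<noteq> U ! (?j + 1)"
        have par: "even ?j \<noteq> even b" by (cases "even b") (auto simp: mod2_eq_if)
        then consider "?j < b" | "b < ?j" by (metis linorder_neqE_nat)
        then show False
        proof cases
          case 1
          then show False using run_parity[OF U 1] ne b par by simp
        next
          case 2
          then show False using run_parity[OF U 2] ne b par i by simp
        qed
      qed
      then show ?thesis using that[of "Suc b mod 2"] by simp
    qed
    let ?z = "\<lambda>a b. map (\<lambda>i. U ! (s + 2 * i)) [a..<b]"
    note D = dbl_map_nth[of s U, OF pairs]
    have k: "length w + 3 \<le> 2 * k" "2 * k \<le> length w + 4" unfolding k_def by simp_all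
    have fit: "s + 2 * (2 * n + k) \<le> length U" using lU k s by simp
    have "sublist w (dbl (?z n (n + k)))"
    proof -
      have d: "dbl (?z n (n + k)) = take (2 * k) (drop (s + 2 * n) U)"
        using D[of n "n + k"] fit by simp
      have "take (length w) (drop (2 - s) (take (2 * k) (drop (s + 2 * n) U))) =
          take (length w) (drop (2 * n + 2) U)"
        using s k by (simp add: drop_take min_def)
      also have "\<dots> = w" using u by (simp add: U_def)
      finally show ?thesis unfolding d
        by (metis sublist_order.order_trans sublist_take sublist_drop)
    qed
    moreover have "?Q (?z 0 n @ ?z n (n + k) @ ?z (n + k) (2 * n + k))"
    proof -
      have e: "?z 0 n @ ?z n (n + k) @ ?z (n + k) (2 * n + k) = ?z 0 (2 * n + k)"
        unfolding map_append[symmetric]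
        using upt_add_eq_append[of n "n + k" n] upt_add_eq_append[of 0 n "k + n"]
        by (simp add: add_ac mult_2)
      have "dbl (?z 0 (2 * n + k)) = take (2 * (2 * n + k)) (drop s U)"
        using D[of 0 "2 * n + k"] fit by simp
      moreover have "sublist (take (2 * (2 * n + k)) (drop s U)) U"
        using sublist_order.order_trans sublist_take sublist_drop by blast
      ultimately show ?thesis
        unfolding e using extendableD[OF factor_closed_digit U] factor_closedD[OF factor_closed_digit]
        by metis
    qed
    ultimately show ?thesis
      unfolding margin_def
      by (intro bexI[of _ "?z n (n + k)"] exI[of _ "?z 0 n"] exI[of _ "?z (n + k) (2 * n + k)"]) auto
  qed
  from extendable_pigeonhole[OF fin this] show ?thesis
    using extendable_mono[of ?Q _ markoff_word] markoff_word_dbl by blast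
qed

lemma digit_word_entropy:
  fixes \<beta> :: real
  assumes "\<beta> > 1"
  shows "\<exists>l n W. l > 0 \<and> finite W \<and> real (card W) \<le> \<beta> ^ l \<and>
    (\<forall>w. length w = l \<longrightarrow> margin digit_word n w \<longrightarrow> w \<in> W)"
proof -
  \<comment> \<open>The square root leaves room: half of the exponent absorbs the constant
    \<open>D\<close> below.\<close>
  define \<gamma> where "\<gamma> = sqrt \<beta>"
  have \<gamma>: "\<gamma> > 1" "\<gamma> ^ 2 = \<beta>" using assms by (auto simp: \<gamma>_def)
  have "(\<lambda>K. (1 / \<gamma>) ^ K) \<longlonglongrightarrow> 0" using \<gamma> by (intro LIMSEQ_power_zero) auto
  moreover have "0 < 1 - 1 / \<gamma>" using \<gamma> by simp
  ultimately have "eventually (\<lambda>K. (1 / \<gamma>) ^ K < 1 - 1 / \<gamma>) sequentially" by (rule order_tendstoD(2))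
  \<comment> \<open>If one word has length at least \<open>K\<close> and the other is nonempty,
    \<open>\<gamma>\<close> meets the condition of \<open>card_factors_subst\<close>. At level
    \<open>2 * K\<close> one of the words is that long.\<close>
  then obtain K where K: "(1 / \<gamma>) ^ K < 1 - 1 / \<gamma>" by (meson eventually_at_top_linorder order_refl)
  let ?pairs = "{(A, B). markoff_pair (2 * K) A B}"
  have bound: "\<exists>C. \<forall>l. real (card {w :: bool list. length w = l \<and> (\<exists>z. sublist w (subst (dbl A) (dbl B) z))}) \<le> C * \<gamma> ^ l"
    if "markoff_pair (2 * K) A B" for A B
  proof (rule card_factors_subst)
    note len = markoff_pair_length[OF that]
    have "dbl X \<noteq> []" if "X \<noteq> []" for X using that by (cases X) auto
    then show "dbl A \<noteq> []" "dbl B \<noteq> []" using len by blast+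
    show "\<gamma> \<ge> 1" using \<gamma> by simp
    have one: "1 / \<gamma> ^ length (dbl X) \<le> 1 / \<gamma>" if "X \<noteq> []" for X
    proof -
      have "\<gamma> ^ 1 \<le> \<gamma> ^ length (dbl X)"
        using that \<gamma> by (intro power_increasing) (cases X, auto)
      then show ?thesis using \<gamma> by (simp add: frac_le)
    qed
    have two: "1 / \<gamma> ^ length (dbl X) \<le> 1 - 1 / \<gamma>" if "K \<le> length X" for X
    proof -
      have "\<gamma> ^ K \<le> \<gamma> ^ length (dbl X)"
        using that \<gamma> by (intro power_increasing) (auto simp: length_dbl)
      then have "1 / \<gamma> ^ length (dbl X) \<le> 1 / \<gamma> ^ K" using \<gamma> by (simp add: frac_le)
      then show ?thesis using K by (simp add: power_one_over)
    qed
    have "K \<le> length A \<or> K \<le> length B" using len by linarith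
    then show "1 / \<gamma> ^ length (dbl A) + 1 / \<gamma> ^ length (dbl B) \<le> 1"
    proof
      assume "K \<le> length A"
      then show ?thesis using two[of A] one[of B] len by linarith
    next
      assume "K \<le> length B"
      then show ?thesis using two[of B] one[of A] len by linarith
    qed
  qed
  define C where "C A B = (SOME C. \<forall>l. real (card {w :: bool list. length w = l \<and> (\<exists>z. sublist w (subst (dbl A) (dbl B) z))}) \<le> C * \<gamma> ^ l)" for A B
  have C: "real (card {w :: bool list. length w = l \<and> (\<exists>z. sublist w (subst (dbl A) (dbl B) z))}) \<le> C A B * \<gamma> ^ l"
    if "markoff_pair (2 * K) A B" for A B l
    using someI_ex[OF bound[OF that]] unfolding C_def by blast
  define D where "D = (\<Sum>(A, B)\<in>?pairs. C A B)"
  let ?S = "\<lambda>l. {w. length w = l \<and> extendable digit_word w}"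
  have fin: "finite {w :: bool list. length w = l}" for l
    using finite_lists_length_eq[of "UNIV :: bool set" l] by simp
  have finS: "finite (?S l)" for l by (rule finite_subset[OF _ fin[of l]]) auto
  have S: "real (card (?S l)) \<le> D * \<gamma> ^ l" for l
  proof -
    let ?R = "\<lambda>(A, B). {w :: bool list. length w = l \<and> (\<exists>z. sublist w (subst (dbl A) (dbl B) z))}"
    have finR: "finite (?R p)" for p by (rule finite_subset[OF _ fin[of l]]) (auto split: prod.splits)
    have "?S l \<subseteq> (\<Union>p\<in>?pairs. ?R p)"
    proof
      fix w assume w: "w \<in> ?S l"
      then obtain z where z: "extendable markoff_word z" "sublist w (dbl z)"
        using extendable_digit_halve by blast
      obtain A B z' where AB: "markoff_pair (2 * K) A B" "sublist z (subst A B z')"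
        using extendable_markoff_desubstitute_iter[OF z(1)] by blast
      have "sublist w (subst (dbl A) (dbl B) z')"
        using z(2) subst_sublist[OF AB(2)] sublist_order.order_trans unfolding subst_subst[symmetric] by blast
      then show "w \<in> (\<Union>p\<in>?pairs. ?R p)" using w AB(1) by blast
    qed
    then have "card (?S l) \<le> card (\<Union>p\<in>?pairs. ?R p)"
      by (intro card_mono) (use finR finite_markoff_pairs in auto)
    also have "\<dots> \<le> (\<Sum>p\<in>?pairs. card (?R p))" by (rule card_UN_le[OF finite_markoff_pairs])
    finally have "real (card (?S l)) \<le> real (\<Sum>p\<in>?pairs. card (?R p))" by (rule of_nat_mono)
    also have "\<dots> = (\<Sum>p\<in>?pairs. real (card (?R p)))" by (rule of_nat_sum)
    also have "\<dots> \<le> (\<Sum>(A, B)\<in>?pairs. C A B * \<gamma> ^ l)"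
      by (rule sum_mono) (use C in auto)
    also have "\<dots> = D * \<gamma> ^ l" unfolding D_def sum_distrib_right by (simp add: case_prod_unfold)
    finally show ?thesis .
  qed
  obtain l0 where l0: "D < \<gamma> ^ l0" using real_arch_pow[OF \<gamma>(1)] by blast
  define l where "l = Suc l0"
  have "\<gamma> ^ l0 \<le> \<gamma> ^ l" unfolding l_def by (rule power_increasing) (use \<gamma> in auto)
  then have "D \<le> \<gamma> ^ l" using l0 by linarith
  then have "D * \<gamma> ^ l \<le> \<gamma> ^ l * \<gamma> ^ l" using \<gamma> by (intro mult_right_mono) auto
  also have "\<dots> = \<beta> ^ l" unfolding \<gamma>(2)[symmetric] by (simp add: power2_eq_square power_mult_distrib)
  finally have "real (card (?S l)) \<le> \<beta> ^ l" using S[of l] by linarith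
  moreover obtain n where "\<forall>w. length w = l \<longrightarrow> margin digit_word n w \<longrightarrow> extendable digit_word w"
    using extendable_compactness by blast
  ultimately show ?thesis using finS[of l] unfolding l_def by (intro exI[of _ l] exI[of _ n] exI[of _ "?S l"]) (auto simp: l_def)
qed

section \<open>Continued fractions\<close>

text \<open>\<open>t n\<close> is the tail \<open>[0; d n, d (n+1), ...]\<close>. Keeping the tails
  as data replaces limits of convergents by the recursion.\<close>

definition cf_expansion :: "(nat \<Rightarrow> nat) \<Rightarrow> (nat \<Rightarrow> real) \<Rightarrow> bool" where
  "cf_expansion d t \<longleftrightarrow>
     (\<forall>n. d n \<ge> 1 \<and> 0 < t n \<and> t n < 1 \<and> t n = 1 / (real (d n) + t (Suc n)))"

text \<open>Indices are shifted by one: \<open>cf_num d 0 / cf_den d 0\<close> is the formal convergent \<open>1/0\<close>.\<close>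

fun cf_num :: "(nat \<Rightarrow> nat) \<Rightarrow> nat \<Rightarrow> int" where
  "cf_num d 0 = 1"
| "cf_num d (Suc 0) = 0"
| "cf_num d (Suc (Suc n)) = int (d n) * cf_num d (Suc n) + cf_num d n"

fun cf_den :: "(nat \<Rightarrow> nat) \<Rightarrow> nat \<Rightarrow> int" where
  "cf_den d 0 = 0"
| "cf_den d (Suc 0) = 1"
| "cf_den d (Suc (Suc n)) = int (d n) * cf_den d (Suc n) + cf_den d n"

text \<open>The reversed past \<open>[0; d (n-1), ..., d 0]\<close>, as \<open>cf_past_Suc\<close>
  shows.\<close>

definition cf_past :: "(nat \<Rightarrow> nat) \<Rightarrow> nat \<Rightarrow> real" where
  "cf_past d n = cf_den d n / cf_den d (Suc n)"

definition cf_lambda :: "(nat \<Rightarrow> nat) \<Rightarrow> (nat \<Rightarrow> real) \<Rightarrow> nat \<Rightarrow> real" where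
  "cf_lambda d t n = d n + t (Suc n) + cf_past d n"

text \<open>The convergent that ends just before \<open>d n\<close>; its quality is
  \<open>cf_lambda d t n\<close>.\<close>

definition convergent_of :: "(nat \<Rightarrow> nat) \<Rightarrow> nat \<Rightarrow> real" where
  "convergent_of d n = cf_num d (Suc n) / cf_den d (Suc n)"

context
  fixes d :: "nat \<Rightarrow> nat" and t :: "nat \<Rightarrow> real"
  assumes cf: "cf_expansion d t"
begin

lemma cf_digit_pos: "d n \<ge> 1" and cf_tail_pos: "0 < t n" and cf_tail_less_1: "t n < 1"
  and cf_tail_rec: "t n = 1 / (real (d n) + t (Suc n))"
  using cf unfolding cf_expansion_def by blast+

lemma cf_tail_inverse: "1 / t n = real (d n) + t (Suc n)"
  using cf_tail_rec[of n] by simp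

lemma cf_den_pos: "cf_den d (Suc n) \<ge> 1 \<and> cf_den d n \<ge> 0"
proof (induction n)
  case (Suc n)
  have "int (d n) * cf_den d (Suc n) \<ge> 1 * 1"
    using Suc cf_digit_pos[of n] by (intro mult_mono) auto
  then show ?case using Suc by auto
qed simp

lemma cf_den_Suc_mono: "cf_den d (Suc n) \<le> cf_den d (Suc (Suc n))"
proof -
  have "1 * cf_den d (Suc n) \<le> int (d n) * cf_den d (Suc n)"
    using cf_den_pos[of n] cf_digit_pos[of n] by (intro mult_right_mono) auto
  then show ?thesis using cf_den_pos[of n] unfolding cf_den.simps(3) by linarith
qed

lemma cf_den_ge: "cf_den d (Suc n) \<ge> int n"
proof (induction n)
  case (Suc n)
  show ?case
  proof (cases n)
    case 0
    then show ?thesis using cf_den_pos[of 1] by simp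
  next
    case (Suc k)
    have "1 * cf_den d (Suc n) \<le> int (d n) * cf_den d (Suc n)"
      using cf_den_pos[of n] cf_digit_pos[of n] by (intro mult_right_mono) auto
    moreover have "cf_den d n \<ge> 1" using cf_den_pos[of k] Suc by simp
    ultimately show ?thesis using Suc.IH unfolding cf_den.simps(3) by linarith
  qed
qed simp

lemma cf_past_0: "cf_past d 0 = 0"
  by (simp add: cf_past_def)

lemma cf_past_Suc: "cf_past d (Suc n) = 1 / (real (d n) + cf_past d n)"
proof -
  have "real_of_int (cf_den d (Suc n)) > 0" using cf_den_pos[of n] by linarith
  then show ?thesis by (simp add: cf_past_def field_simps)
qed

lemma cf_past_bounds: "0 \<le> cf_past d n \<and> cf_past d n \<le> 1"
proof (induction n)
  case (Suc n)
  have "real (d n) \<ge> 1" using cf_digit_pos[of n] by simp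
  then show ?case using Suc by (simp add: cf_past_Suc)
qed (simp add: cf_past_0)

definition cf_err :: "nat \<Rightarrow> real" where
  "cf_err n = cf_den d n * t 0 - cf_num d n"

lemma cf_err_Suc: "cf_err (Suc n) = - t n * cf_err n"
proof (induction n)
  case 0
  then show ?case by (simp add: cf_err_def)
next
  case (Suc n)
  have "cf_err (Suc (Suc n)) = d n * cf_err (Suc n) + cf_err n"
    by (simp add: cf_err_def algebra_simps)
  also have "cf_err n = - cf_err (Suc n) * (1 / t n)"
    using Suc cf_tail_pos[of n] by (simp add: field_simps)
  finally show ?case unfolding cf_tail_inverse by (simp add: algebra_simps)
qed

lemma cf_err_nonzero: "cf_err n \<noteq> 0"
proof (induction n)
  case (Suc n)
  then show ?case using cf_err_Suc[of n] cf_tail_pos[of n] by simp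
qed (simp add: cf_err_def)

lemma cf_det: "\<bar>cf_num d (Suc n) * cf_den d n - cf_num d n * cf_den d (Suc n)\<bar> = 1"
proof (induction n)
  case (Suc n)
  have "cf_num d (Suc (Suc n)) * cf_den d (Suc n) - cf_num d (Suc n) * cf_den d (Suc (Suc n)) =
      - (cf_num d (Suc n) * cf_den d n - cf_num d n * cf_den d (Suc n))"
    by (simp add: algebra_simps)
  then show ?case using Suc by linarith
qed simp

text \<open>Insert \<open>cf_err_Suc\<close> into the determinant identity
  \<open>cf_det\<close>.\<close>

lemma abs_cf_err: "\<bar>cf_err n\<bar> = 1 / (cf_den d (Suc n) + t n * cf_den d n)"
proof -
  let ?D = "cf_den d (Suc n) + t n * cf_den d n"
  have "?D > 0" using cf_den_pos[of n] cf_tail_pos[of n]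
    by (intro add_pos_nonneg mult_nonneg_nonneg) auto
  have "cf_err (Suc n) * cf_den d n - cf_err n * cf_den d (Suc n) =
      - real_of_int (cf_num d (Suc n) * cf_den d n - cf_num d n * cf_den d (Suc n))"
    unfolding cf_err_def by (simp add: algebra_simps)
  then have "\<bar>cf_err (Suc n) * cf_den d n - cf_err n * cf_den d (Suc n)\<bar> = 1"
    using cf_det[of n] by (metis abs_minus_cancel of_int_1 of_int_abs)
  moreover have "cf_err (Suc n) * cf_den d n - cf_err n * cf_den d (Suc n) = - cf_err n * ?D"
    unfolding cf_err_Suc by (simp add: algebra_simps)
  ultimately have "\<bar>cf_err n\<bar> * ?D = 1" using \<open>?D > 0\<close> by (simp add: abs_mult)
  then show ?thesis using \<open>?D > 0\<close> by (simp add: field_simps)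
qed

lemma cf_lambda_pos: "cf_lambda d t n > 1"
  using cf_digit_pos[of n] cf_tail_pos[of "Suc n"] cf_past_bounds[of n] unfolding cf_lambda_def by linarith

text \<open>Perron's formula. Extracting the square of the denominator leaves
  \<open>1 / t n + Q' / Q\<close>, which is the future and the past in
  \<open>cf_lambda\<close>.\<close>

lemma convergent_error:
  "\<bar>t 0 - convergent_of d n\<bar> = 1 / (cf_lambda d t n * (cf_den d (Suc n))\<^sup>2)"
proof -
  define Q where "Q = real_of_int (cf_den d (Suc n))"
  define Q' where "Q' = real_of_int (cf_den d n)"
  have Q: "Q > 0" using cf_den_pos[of n] unfolding Q_def by linarith
  have Q': "Q' \<ge> 0" using cf_den_pos[of n] unfolding Q'_def by linarith
  have t: "t n > 0" by (rule cf_tail_pos)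
  have "t 0 - convergent_of d n = cf_err (Suc n) / Q"
    using Q unfolding cf_err_def convergent_of_def Q_def by (simp add: field_simps)
  then have "\<bar>t 0 - convergent_of d n\<bar> = t n * \<bar>cf_err n\<bar> / Q"
    using Q t by (simp add: cf_err_Suc abs_mult)
  also have "\<dots> = t n / (Q * (Q + t n * Q'))"
    unfolding abs_cf_err Q_def Q'_def by simp
  also have "\<dots> = 1 / (Q\<^sup>2 * (1 / t n + Q' / Q))"
  proof -
    have "Q\<^sup>2 * (1 / t n + Q' / Q) = Q * (Q + t n * Q') / t n"
      using Q t by (simp add: field_simps power2_eq_square)
    then show ?thesis by simp
  qed
  also have "1 / t n + Q' / Q = cf_lambda d t n"
    unfolding cf_tail_inverse cf_lambda_def cf_past_def Q_def Q'_def by simp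
  finally show ?thesis by (simp add: Q_def mult.commute)
qed

text \<open>Solutions are counted as rationals, so infinitely many indices have to give infinitely
  many convergents. The errors strictly decrease.\<close>

lemma convergents_inj: "inj (convergent_of d)"
proof -
  have less: "\<bar>t 0 - convergent_of d (Suc n)\<bar> < \<bar>t 0 - convergent_of d n\<bar>" for n
  proof -
    have e: "\<bar>t 0 - convergent_of d n\<bar> = \<bar>cf_err (Suc n)\<bar> / cf_den d (Suc n)" for n
    proof -
      have "real_of_int (cf_den d (Suc n)) > 0" using cf_den_pos[of n] by linarith
      then have "t 0 - convergent_of d n = cf_err (Suc n) / cf_den d (Suc n)"
        unfolding cf_err_def convergent_of_def by (simp add: field_simps)
      then show ?thesis using \<open>real_of_int (cf_den d (Suc n)) > 0\<close> by simp
    qed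
    have "\<bar>cf_err (Suc (Suc n))\<bar> < \<bar>cf_err (Suc n)\<bar>"
      using cf_err_nonzero[of "Suc n"] cf_tail_pos[of "Suc n"] cf_tail_less_1[of "Suc n"]
      by (simp add: cf_err_Suc[of "Suc n"] abs_mult)
    moreover have "0 < real_of_int (cf_den d (Suc n))" using cf_den_pos[of n] by linarith
    moreover have "real_of_int (cf_den d (Suc n)) \<le> cf_den d (Suc (Suc n))"
      using cf_den_Suc_mono[of n] by (rule of_int_le_iff[THEN iffD2])
    ultimately show ?thesis unfolding e by (intro frac_less) auto
  qed
  have "strict_mono (\<lambda>n. - \<bar>t 0 - convergent_of d n\<bar>)"
    unfolding strict_mono_Suc_iff using less by simp
  then have "inj (\<lambda>n. - \<bar>t 0 - convergent_of d n\<bar>)" by (rule strict_mono_imp_inj_on)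
  then show ?thesis by (auto simp: inj_def)
qed

text \<open>Write \<open>(p, q)\<close> in the unimodular basis given by the two convergents whose
  denominators enclose \<open>q\<close>. Unless it is a multiple of the first, its coordinates have
  opposite signs; so have the errors of the two convergents. Nothing cancels, the error of the first
  is at most \<open>|q t 0 - p|\<close>, and \<open>|p Q - P q| < 1\<close> follows. As
  \<open>p / q\<close> need not be reduced, the comparison of denominators is part of the
  claim.\<close>

lemma legendre:
  fixes p q :: int
  assumes q: "q > 0" and close: "\<bar>t 0 - p / q\<bar> < 1 / (2 * q\<^sup>2)"
  shows "\<exists>n. p / q = convergent_of d n \<and> cf_den d (Suc n) \<le> q"
proof -
  have "\<exists>n. q < cf_den d (Suc (Suc n))"
    using cf_den_ge[of "Suc (nat q)"] q by (intro exI[of _ "nat q"]) auto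
  define n where "n = (LEAST n. q < cf_den d (Suc (Suc n)))"
  have n: "q < cf_den d (Suc (Suc n))"
    unfolding n_def using \<open>\<exists>n. q < cf_den d (Suc (Suc n))\<close> by (rule LeastI_ex)
  have n': "cf_den d (Suc n) \<le> q"
  proof (cases n)
    case (Suc k)
    then show ?thesis using not_less_Least[of k "\<lambda>n. q < cf_den d (Suc (Suc n))"] n_def by auto
  qed (use q in simp)
  define P P' Q Q' where "P = cf_num d (Suc n)" "P' = cf_num d (Suc (Suc n))"
    "Q = cf_den d (Suc n)" "Q' = cf_den d (Suc (Suc n))"
  note defs = this
  have Q: "Q \<ge> 1" using cf_den_pos[of n] by (simp add: defs)
  define D where "D = P' * Q - P * Q'"
  have D: "D = 1 \<or> D = -1" using cf_det[of "Suc n"] unfolding D_def defs by linarith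
  then have DD: "D * D = 1" by auto
  define a b where "a = D * (P' * q - p * Q')" "b = D * (p * Q - P * q)"
  note ab = this
  have pa: "p = a * P + b * P'"
  proof -
    have "a * P + b * P' = D * (p * D)" unfolding ab D_def by (simp add: algebra_simps)
    then show ?thesis using DD by (simp add: algebra_simps)
  qed
  have qa: "q = a * Q + b * Q'"
  proof -
    have "a * Q + b * Q' = D * (q * D)" unfolding ab D_def by (simp add: algebra_simps)
    then show ?thesis using DD by (simp add: algebra_simps)
  qed
  show ?thesis
  proof (cases "b = 0")
    case True
    then have "a \<noteq> 0" using q qa by auto
    then have "real_of_int p / q = P / Q" using True pa qa by simp
    then show ?thesis using n' unfolding convergent_of_def defs by blast
  next
    case False
    have Q': "Q' > q" using n by (simp add: defs)
    have sgn: "a > 0 \<and> b < 0 \<or> a < 0 \<and> b > 0"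
    proof -
      have "\<not> (b \<ge> 1 \<and> a \<ge> 0)"
      proof
        assume "b \<ge> 1 \<and> a \<ge> 0"
        then have "b * Q' \<ge> 1 * Q'" "a * Q \<ge> 0" using Q Q' q by (intro mult_right_mono mult_nonneg_nonneg; simp)+
        then show False using qa Q' by linarith
      qed
      moreover have "\<not> (b \<le> 0 \<and> a \<le> 0)"
      proof
        assume "b \<le> 0 \<and> a \<le> 0"
        then have "b * Q' \<le> 0" "a * Q \<le> 0" using Q Q' q by (auto simp: mult_nonpos_nonneg)
        then show False using qa q by linarith
      qed
      ultimately show ?thesis using False by linarith
    qed
    let ?e = "cf_err (Suc n)" and ?f = "cf_err (Suc (Suc n))"
    have comb: "q * t 0 - p = a * ?e + b * ?f"
      unfolding pa qa cf_err_def defs by (simp add: algebra_simps)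
    have f: "?f = - t (Suc n) * ?e" by (rule cf_err_Suc)
    have comb': "q * t 0 - p = ?e * (a - b * t (Suc n))" unfolding comb f by (simp add: algebra_simps)
    have "\<bar>real_of_int a - b * t (Suc n)\<bar> \<ge> 1"
      using sgn
    proof
      assume "a > 0 \<and> b < 0"
      then have "real_of_int b * t (Suc n) \<le> 0" "real_of_int a \<ge> 1"
        using cf_tail_pos[of "Suc n"] by (auto simp: mult_nonpos_nonneg)
      then show ?thesis by linarith
    next
      assume "a < 0 \<and> b > 0"
      then have "real_of_int b * t (Suc n) \<ge> 0" "real_of_int a \<le> -1"
        using cf_tail_pos[of "Suc n"] by auto
      then show ?thesis by linarith
    qed
    then have e: "\<bar>?e\<bar> \<le> \<bar>q * t 0 - p\<bar>"
      unfolding comb' abs_mult using mult_left_mono[of 1 _ "\<bar>?e\<bar>"] by simp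
    have small: "\<bar>q * t 0 - p\<bar> < 1 / (2 * q)"
    proof -
      have "q * t 0 - p = q * (t 0 - p / q)" using q by (simp add: field_simps)
      then have "\<bar>q * t 0 - p\<bar> = q * \<bar>t 0 - p / q\<bar>" using q by (simp add: abs_mult)
      also have "\<dots> < q * (1 / (2 * q\<^sup>2))" using close q by (intro mult_strict_left_mono) auto
      also have "\<dots> = 1 / (2 * q)" using q by (simp add: power2_eq_square)
      finally show ?thesis .
    qed
    show ?thesis
    proof (cases "p * Q = P * q")
      case True
      then have "real_of_int p / q = P / Q" using q Q
        by (simp add: field_simps) (metis of_int_mult mult.commute)
      then show ?thesis using n' unfolding convergent_of_def defs by blast
    next
      case False
      then have "\<bar>p * Q - P * q\<bar> \<ge> 1" by linarith
      then have "1 \<le> \<bar>real_of_int (p * Q - P * q)\<bar>" by linarith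
      also have "real_of_int (p * Q - P * q) = q * ?e - Q * (q * t 0 - p)"
        unfolding cf_err_def defs by (simp add: algebra_simps)
      also have "\<bar>\<dots>\<bar> \<le> q * \<bar>?e\<bar> + Q * \<bar>q * t 0 - p\<bar>"
        using q Q by (intro order_trans[OF abs_triangle_ineq4]) (simp add: abs_mult)
      also have "\<dots> \<le> q * \<bar>q * t 0 - p\<bar> + q * \<bar>q * t 0 - p\<bar>"
        using e q n' by (intro add_mono mult_left_mono mult_right_mono) (auto simp: defs)
      also have "\<dots> < q * (1 / (2 * q)) + q * (1 / (2 * q))"
        using small q by (intro add_strict_mono mult_strict_left_mono) auto
      also have "\<dots> = 1" using q by simp
      finally show ?thesis by simp
    qed
  qed
qed

end

section \<open>Expansions and irrationality\<close>

lemma irrational_cf_expansion: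
  fixes x :: real
  assumes x: "x \<notin> \<rat>"
  shows "\<exists>d t. cf_expansion d t \<and> x = of_int \<lfloor>x\<rfloor> + t 0"
proof -
  define t where "t = rec_nat (frac x) (\<lambda>_ s. frac (1 / s))"
  have t0: "t 0 = frac x" and tS: "t (Suc n) = frac (1 / t n)" for n by (simp_all add: t_def)
  have frac_irr: "frac y \<notin> \<rat>" if "y \<notin> \<rat>" for y :: real
    using that unfolding frac_def by (metis Rats_add Rats_of_int diff_add_cancel)
  have irr: "t n \<notin> \<rat>" for n
  proof (induction n)
    case (Suc n)
    then have "1 / t n \<notin> \<rat>" by (metis Rats_divide Rats_1 div_by_1 divide_divide_eq_right mult_1)
    then show ?case unfolding tS by (rule frac_irr)
  qed (use frac_irr[OF x] t0 in simp)
  have pos: "0 < t n" "t n < 1" for n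
  proof -
    have "t n \<noteq> 0" using irr[of n] by auto
    moreover have "t n = frac (if n = 0 then x else 1 / t (n - 1))" by (cases n) (auto simp: t0 tS)
    ultimately show "0 < t n" "t n < 1" by (metis frac_ge_0 less_eq_real_def, metis frac_lt_1)
  qed
  define d where "d n = nat \<lfloor>1 / t n\<rfloor>" for n
  have "1 \<le> 1 / t n" for n using pos[of n] by simp
  then have fl: "1 \<le> \<lfloor>1 / t n\<rfloor>" for n by (simp add: le_floor_iff)
  have "cf_expansion d t"
    unfolding cf_expansion_def
  proof (intro allI conjI)
    fix n
    show "1 \<le> d n" using fl[of n] unfolding d_def by linarith
    have "real (d n) = of_int \<lfloor>1 / t n\<rfloor>" unfolding d_def
      by (rule of_nat_nat) (use fl[of n] in linarith)
    then have "real (d n) + t (Suc n) = 1 / t n" unfolding tS frac_def by simp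
    then show "t n = 1 / (real (d n) + t (Suc n))" by simp
  qed (rule pos)+
  moreover have "x = of_int \<lfloor>x\<rfloor> + t 0" by (simp add: t0 frac_def)
  ultimately show ?thesis by blast
qed

text \<open>For \<open>t 0 = a / b\<close> the number \<open>b * |err|\<close> is a nonzero integer,
  but it is below \<open>b / cf_den d (Suc n)\<close>, which is at most 1 at
  \<open>n = b\<close>.\<close>

lemma cf_expansion_irrational:
  assumes cf: "cf_expansion d t"
  shows "t 0 \<notin> \<rat>"
proof
  assume "t 0 \<in> \<rat>"
  then obtain a b :: int where ab: "b > 0" "t 0 = a / b"
    by (metis Rats_cases' of_int_of_nat_eq)
  define n where "n = nat b"
  have Q: "cf_den d (Suc n) \<ge> b" using cf_den_ge[OF cf, of n] ab by (simp add: n_def)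
  have "\<bar>cf_err d t n\<bar> * b = \<bar>cf_den d n * a - cf_num d n * b\<bar>"
  proof -
    have "cf_err d t n * b = of_int (cf_den d n * a - cf_num d n * b)"
      unfolding cf_err_def[OF cf] ab(2) using ab(1) by (simp add: field_simps)
    then show ?thesis using ab(1) by (metis abs_mult abs_of_pos of_int_0_less_iff of_int_abs)
  qed
  moreover have "\<bar>cf_err d t n\<bar> * b \<noteq> 0" using cf_err_nonzero[OF cf, of n] ab(1) by simp
  ultimately have "real_of_int \<bar>cf_den d n * a - cf_num d n * b\<bar> \<noteq> 0" by metis
  then have "\<bar>cf_den d n * a - cf_num d n * b\<bar> \<noteq> 0" by (metis of_int_0)
  then have "\<bar>cf_den d n * a - cf_num d n * b\<bar> \<ge> 1" by linarith
  then have one: "\<bar>cf_err d t n\<bar> * b \<ge> 1"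
    using \<open>\<bar>cf_err d t n\<bar> * b = \<bar>cf_den d n * a - cf_num d n * b\<bar>\<close> by linarith
  have n1: "cf_den d n \<ge> 1"
    using cf_den_pos[OF cf, of "n - 1"] ab(1) by (cases n) (auto simp: n_def)
  have "t n * cf_den d n > 0" using cf_tail_pos[OF cf, of n] n1 by (intro mult_pos_pos) auto
  then have "real_of_int b < cf_den d (Suc n) + t n * cf_den d n" using Q by linarith
  moreover have "real_of_int b > 0" using ab(1) by simp
  ultimately have "\<bar>cf_err d t n\<bar> * b < 1"
    unfolding abs_cf_err[OF cf] by (simp add: field_simps)
  then show False using one by simp
qed

section \<open>Approximation constants in terms of \<open>cf_lambda\<close>\<close>

definition good_approximations :: "real \<Rightarrow> real \<Rightarrow> real set" where
  "good_approximations c x = {r. \<exists>p q :: int. q > 0 \<and> r = of_int p / of_int q \<and>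
     \<bar>x - r\<bar> < 1 / (c * (of_int q)\<^sup>2)}"

lemma approx_constant_eq:
  "approx_constant x = (SUP c \<in> {c. c > 0 \<and> infinite (good_approximations c x)}. ereal c)"
  by (simp add: approx_constant_def good_approximations_def)

context
  fixes d :: "nat \<Rightarrow> nat" and t :: "nat \<Rightarrow> real" and a :: int
  assumes cf: "cf_expansion d t"
begin

lemma shifted_convergent:
  "\<exists>p q :: int. q > 0 \<and> of_int a + convergent_of d n = of_int p / of_int q \<and>
     \<bar>(of_int a + t 0) - (of_int a + convergent_of d n)\<bar> = 1 / (cf_lambda d t n * (of_int q)\<^sup>2)"
proof (intro exI conjI)
  show Q: "cf_den d (Suc n) > 0" using cf_den_pos[OF cf, of n] by simp
  show "of_int a + convergent_of d n = of_int (a * cf_den d (Suc n) + cf_num d (Suc n)) / of_int (cf_den d (Suc n))"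
    using Q unfolding convergent_of_def by (simp add: field_simps)
  show "\<bar>(of_int a + t 0) - (of_int a + convergent_of d n)\<bar> = 1 / (cf_lambda d t n * (of_int (cf_den d (Suc n)))\<^sup>2)"
    using convergent_error[OF cf, of n] by simp
qed

lemma infinite_shifted_convergents:
  assumes "infinite N"
  shows "infinite ((\<lambda>n. of_int a + convergent_of d n) ` N)"
proof -
  have "inj (\<lambda>n. of_int a + convergent_of d n)"
    using convergents_inj[OF cf] by (auto simp: inj_def)
  then show ?thesis using assms by (meson finite_imageD inj_on_subset subset_UNIV)
qed

lemma infinite_good_approximations:
  assumes c: "c > 0" and inf: "infinite {n. cf_lambda d t n > c}"
  shows "infinite (good_approximations c (of_int a + t 0))"
proof -
  have "(\<lambda>n. of_int a + convergent_of d n) ` {n. cf_lambda d t n > c} \<subseteq> good_approximations c (of_int a + t 0)"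
  proof
    fix r assume "r \<in> (\<lambda>n. of_int a + convergent_of d n) ` {n. cf_lambda d t n > c}"
    then obtain n where n: "r = of_int a + convergent_of d n" "cf_lambda d t n > c" by blast
    obtain p q :: int where pq: "q > 0" "r = of_int p / of_int q"
      "\<bar>(of_int a + t 0) - r\<bar> = 1 / (cf_lambda d t n * (of_int q)\<^sup>2)"
      using shifted_convergent[of n] n by blast
    have "1 / (cf_lambda d t n * (of_int q)\<^sup>2) < 1 / (c * (of_int q)\<^sup>2)"
      using c n(2) pq(1) by (intro divide_strict_left_mono mult_strict_right_mono mult_pos_pos) auto
    then show "r \<in> good_approximations c (of_int a + t 0)"
      unfolding good_approximations_def using pq by auto
  qed
  then show ?thesis using infinite_shifted_convergents[OF inf] infinite_super by blast
qed

lemma infinite_attaining: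
  assumes inf: "infinite {n. cf_lambda d t n \<ge> 3}"
  shows "infinite {r. \<exists>p q :: int. q > 0 \<and> r = of_int p / of_int q \<and>
    \<bar>(of_int a + t 0) - r\<bar> \<le> 1 / (3 * (of_int q)\<^sup>2)}" (is "infinite ?S")
proof -
  have "(\<lambda>n. of_int a + convergent_of d n) ` {n. cf_lambda d t n \<ge> 3} \<subseteq> ?S"
  proof
    fix r assume "r \<in> (\<lambda>n. of_int a + convergent_of d n) ` {n. cf_lambda d t n \<ge> 3}"
    then obtain n where n: "r = of_int a + convergent_of d n" "cf_lambda d t n \<ge> 3" by blast
    obtain p q :: int where pq: "q > 0" "r = of_int p / of_int q"
      "\<bar>(of_int a + t 0) - r\<bar> = 1 / (cf_lambda d t n * (of_int q)\<^sup>2)"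
      using shifted_convergent[of n] n by blast
    have "1 / (cf_lambda d t n * (of_int q)\<^sup>2) \<le> 1 / (3 * (of_int q)\<^sup>2)"
      using n(2) pq(1) by (intro divide_left_mono mult_right_mono mult_pos_pos) auto
    then show "r \<in> ?S" using pq by auto
  qed
  then show ?thesis using infinite_shifted_convergents[OF inf] infinite_super by blast
qed

text \<open>\<open>c >= 2\<close> brings every good approximation within reach of
  \<open>legendre\<close>. The denominator \<open>q\<close> may be a multiple of the convergent's;
  the smaller one only weakens the bound.\<close>

lemma infinite_lambda_large:
  assumes c: "c \<ge> 2" and inf: "infinite (good_approximations c (of_int a + t 0))"
  shows "infinite {n. cf_lambda d t n > c}"
proof
  assume fin: "finite {n. cf_lambda d t n > c}"
  have "good_approximations c (of_int a + t 0) \<subseteq> (\<lambda>n. of_int a + convergent_of d n) ` {n. cf_lambda d t n > c}"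
  proof
    fix r assume "r \<in> good_approximations c (of_int a + t 0)"
    then obtain p q :: int where pq: "q > 0" "r = of_int p / of_int q"
      "\<bar>(of_int a + t 0) - r\<bar> < 1 / (c * (of_int q)\<^sup>2)"
      unfolding good_approximations_def by auto
    define p' where "p' = p - a * q"
    have r: "r = of_int a + p' / q" using pq(1,2) by (simp add: p'_def field_simps)
    have "1 / (c * (real_of_int q)\<^sup>2) \<le> 1 / (2 * (real_of_int q)\<^sup>2)"
      using c pq(1) by (intro divide_left_mono mult_right_mono mult_pos_pos) auto
    then have "\<bar>t 0 - p' / q\<bar> < 1 / (2 * (real_of_int q)\<^sup>2)" using pq(3) r by simp
    then obtain n where n: "p' / q = convergent_of d n" "cf_den d (Suc n) \<le> q"
      using legendre[OF cf pq(1), of p'] by auto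
    have Q: "real_of_int (cf_den d (Suc n)) > 0" using cf_den_pos[OF cf, of n] by linarith
    have "1 / (cf_lambda d t n * (cf_den d (Suc n))\<^sup>2) < 1 / (c * (real_of_int q)\<^sup>2)"
      using pq(3) n(1) r convergent_error[OF cf, of n] by simp
    also have "\<dots> \<le> 1 / (c * (cf_den d (Suc n))\<^sup>2)"
      using c Q n(2) pq(1) by (intro divide_left_mono mult_left_mono mult_pos_pos power_mono) auto
    finally have "c * (cf_den d (Suc n))\<^sup>2 < cf_lambda d t n * (cf_den d (Suc n))\<^sup>2"
      using c Q cf_lambda_pos[OF cf, of n] by (simp add: divide_less_cancel frac_less_eq field_simps)
    then have "c < cf_lambda d t n" using Q by simp
    then show "r \<in> (\<lambda>n. of_int a + convergent_of d n) ` {n. cf_lambda d t n > c}"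
      using r n(1) by auto
  qed
  then show False using inf fin finite_subset by blast
qed

end

lemma k_level_3_cf:
  assumes x: "x \<in> k_level_3" and c: "c > 3"
  shows "\<exists>d t. cf_expansion d t \<and> x = of_int \<lfloor>x\<rfloor> + t 0 \<and> (\<exists>N. \<forall>n\<ge>N. cf_lambda d t n \<le> c)"
proof -
  obtain d t where dt: "cf_expansion d t" "x = of_int \<lfloor>x\<rfloor> + t 0"
    using irrational_cf_expansion x unfolding k_level_3_def by blast
  have "\<not> infinite {n. cf_lambda d t n > c}"
  proof
    assume "infinite {n. cf_lambda d t n > c}"
    then have "infinite (good_approximations c x)"
      using infinite_good_approximations[OF dt(1), of c "\<lfloor>x\<rfloor>"] c dt(2) by simp
    then have "ereal c \<le> approx_constant x"
      unfolding approx_constant_eq using c by (intro SUP_upper) auto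
    then show False using x c unfolding k_level_3_def by simp
  qed
  then obtain N where "\<forall>n\<in>{n. cf_lambda d t n > c}. n < N" using finite_nat_set_iff_bounded by auto
  then have "\<forall>n\<ge>N. cf_lambda d t n \<le> c" by (metis mem_Collect_eq not_less)
  then show ?thesis using dt by blast
qed

lemma attainable_3_cf:
  assumes cf: "cf_expansion d t" and inf: "infinite {n. cf_lambda d t n \<ge> 3}"
    and upper: "\<And>c. c > 3 \<Longrightarrow> finite {n. cf_lambda d t n > c}"
  shows "t 0 \<in> attainable_3"
proof -
  have "approx_constant (t 0) = 3"
  proof (rule antisym)
    show "approx_constant (t 0) \<le> 3"
      unfolding approx_constant_eq
    proof (rule SUP_least)
      fix c assume "c \<in> {c. c > 0 \<and> infinite (good_approximations c (t 0))}"
      then have "\<not> c > 3"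
        using infinite_lambda_large[OF cf, of c 0] upper[of c] by auto
      then show "ereal c \<le> 3" by simp
    qed
    show "3 \<le> approx_constant (t 0)"
    proof (rule ccontr)
      assume "\<not> 3 \<le> approx_constant (t 0)"
      then have "approx_constant (t 0) < ereal 3" by simp
      then obtain c where c: "approx_constant (t 0) < ereal c" "c < 3"
        using ereal_dense2 by fastforce
      \<comment> \<open>\<open>c\<close> may fail to be positive, but the supremum runs over
        positive constants.\<close>
      define c' where "c' = max c 1"
      have sub: "{n. cf_lambda d t n \<ge> 3} \<subseteq> {n. cf_lambda d t n > c'}" using c(2) by (auto simp: c'_def)
      have "infinite (good_approximations c' (t 0))"
        using infinite_good_approximations[OF cf, of c' 0] infinite_super[OF sub inf] by (simp add: c'_def)
      then have "ereal c' \<le> approx_constant (t 0)"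
        unfolding approx_constant_eq by (intro SUP_upper) (auto simp: c'_def)
      then have "ereal c' < ereal c" using c(1) by (rule order.strict_trans1)
      then show False by (simp add: c'_def)
    qed
  qed
  then have "t 0 \<in> k_level_3" using cf_expansion_irrational[OF cf] by (simp add: k_level_3_def)
  then show ?thesis
    using infinite_attaining[OF cf inf, of 0] by (simp add: attainable_3_def)
qed

section \<open>Finite continued fractions as functions of the tail behind them\<close>

fun cf_value :: "nat list \<Rightarrow> real \<Rightarrow> real" where
  "cf_value [] z = z"
| "cf_value (c # m) z = 1 / (real c + cf_value m z)"

lemma cf_value_append: "cf_value (l @ m) z = cf_value l (cf_value m z)"
  by (induction l) auto

lemma cf_tail_value:
  assumes "cf_expansion d t"
  shows "t n = cf_value (map d [n..<n + k]) (t (n + k))"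
proof (induction k)
  case (Suc k)
  have "cf_value (map d [n..<n + Suc k]) (t (n + Suc k)) =
      cf_value (map d [n..<n + k]) (1 / (d (n + k) + t (Suc (n + k))))"
    by (simp add: cf_value_append)
  then show ?case using Suc cf_tail_rec[OF assms, of "n + k"] by simp
qed simp

lemma cf_past_value:
  assumes "cf_expansion d t"
  shows "cf_past d (n + k) = cf_value (rev (map d [n..<n + k])) (cf_past d n)"
proof (induction k)
  case (Suc k)
  then show ?case using cf_past_Suc[OF assms, of "n + k"] by simp
qed simp

lemma cf_value_unit:
  assumes "\<forall>c\<in>set m. c \<ge> 1" "0 \<le> z" "z \<le> 1"
  shows "0 \<le> cf_value m z \<and> cf_value m z \<le> 1"
  using assms(1)
proof (induction m)
  case (Cons c m)
  then have "real c \<ge> 1" "0 \<le> cf_value m z" by simp_all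
  then show ?case by simp
qed (use assms in simp)

lemma reciprocal_diff:
  fixes a b c :: real
  assumes "c > 0" "a \<ge> 0" "b \<ge> 0"
  shows "1 / (c + a) - 1 / (c + b) = (b - a) / ((c + a) * (c + b))"
  using assms by (simp add: field_simps)

text \<open>Each digit reverses the order, hence the sign, and divides the gap by
  \<open>(c + u) (c + v) <= 3 * 3\<close>.\<close>

lemma cf_value_gap:
  assumes "\<forall>c\<in>set m. c = 1 \<or> c = 2" "0 \<le> a" "a \<le> 1" "0 \<le> b" "b \<le> 1" "b \<le> a"
  shows "(a - b) / 9 ^ length m \<le> (-1) ^ length m * (cf_value m a - cf_value m b)"
  using assms(1)
proof (induction m)
  case (Cons c m)
  let ?u = "cf_value m a" and ?v = "cf_value m b"
  let ?s = "(-1) ^ length m * (?u - ?v)"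
  have c: "real c = 1 \<or> real c = 2" using Cons.prems by auto
  have "\<forall>c\<in>set m. c \<ge> 1" using Cons.prems by auto
  then have uv: "0 \<le> ?u" "?u \<le> 1" "0 \<le> ?v" "?v \<le> 1" using cf_value_unit assms by blast+
  let ?D = "(real c + ?u) * (real c + ?v)"
  have "0 < real c + ?u" "real c + ?u \<le> 3" "0 < real c + ?v" "real c + ?v \<le> 3"
    using c uv by linarith+
  then have D: "0 < ?D" "?D \<le> 3 * 3"
    by (blast intro: mult_pos_pos, intro mult_mono) linarith+
  have IH: "(a - b) / 9 ^ length m \<le> ?s" using Cons by simp
  moreover have "0 \<le> (a - b) / 9 ^ length m" using assms by simp
  ultimately have s: "0 \<le> ?s" by linarith
  have "(a - b) / 9 ^ length (c # m) = ((a - b) / 9 ^ length m) / 9" by simp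
  also have "\<dots> \<le> ?s / 9" using IH by (rule divide_right_mono) simp
  also have "\<dots> \<le> ?s / ?D" using D s by (intro divide_left_mono) auto
  also have "\<dots> = (-1) ^ length (c # m) * ((?v - ?u) / ?D)"
  proof -
    have "P * (u - v) / D = (-1 * P) * ((v - u) / D)" for P u v D :: real
      by (simp add: algebra_simps diff_divide_distrib)
    then show ?thesis unfolding length_Cons power_Suc .
  qed
  also have "(?v - ?u) / ?D = cf_value (c # m) a - cf_value (c # m) b"
    unfolding cf_value.simps by (rule reciprocal_diff[symmetric]) (use c uv in auto)
  finally show ?case .
qed simp

text \<open>For tails at least \<open>1/3\<close> the same product is at least
  \<open>(4/3)^2\<close>, and digits at most 2 keep the tails above \<open>1/3\<close>.\<close>

lemma cf_value_contract:
  assumes "\<forall>c\<in>set m. c \<ge> 1" "1/3 \<le> a" "a \<le> 1" "1/3 \<le> b" "b \<le> 1" "\<forall>c\<in>set m. c \<le> 2"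
  shows "\<bar>cf_value m a - cf_value m b\<bar> \<le> (9/16) ^ length m * \<bar>a - b\<bar> \<and>
    1/3 \<le> cf_value m a \<and> 1/3 \<le> cf_value m b"
  using assms(1,6)
proof (induction m)
  case (Cons c m)
  let ?u = "cf_value m a" and ?v = "cf_value m b"
  have c: "1 \<le> real c" "real c \<le> 2" using Cons.prems by auto
  have uv: "1/3 \<le> ?u" "?u \<le> 1" "1/3 \<le> ?v" "?v \<le> 1"
    using cf_value_unit[of m a] cf_value_unit[of m b] Cons assms by auto
  let ?D = "(real c + ?u) * (real c + ?v)"
  have "(4/3) * (4/3) \<le> ?D" using c uv by (intro mult_mono) auto
  then have D: "16/9 \<le> ?D" by simp
  have "\<bar>cf_value (c # m) a - cf_value (c # m) b\<bar> = \<bar>?u - ?v\<bar> / ?D"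
    using reciprocal_diff[of c ?u ?v] c uv by (simp add: abs_mult abs_minus_commute)
  also have "\<dots> \<le> \<bar>?u - ?v\<bar> / (16/9)" using D by (intro divide_left_mono) auto
  also have "\<dots> \<le> ((9/16) ^ length m * \<bar>a - b\<bar>) / (16/9)" using Cons by (intro divide_right_mono) auto
  finally have "\<bar>cf_value (c # m) a - cf_value (c # m) b\<bar> \<le> (9/16) ^ length (c # m) * \<bar>a - b\<bar>" by simp
  moreover have "1/3 \<le> cf_value (c # m) a" "1/3 \<le> cf_value (c # m) b"
    using c uv by (simp_all add: field_simps)
  ultimately show ?case by blast
qed (use assms in simp)

text \<open>For the initial digits, which are not bounded by 2.\<close>

lemma cf_value_nonexpanding:
  assumes "\<forall>c\<in>set m. c \<ge> 1" "0 \<le> a" "a \<le> 1" "0 \<le> b" "b \<le> 1"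
  shows "\<bar>cf_value m a - cf_value m b\<bar> \<le> \<bar>a - b\<bar>"
  using assms(1)
proof (induction m)
  case (Cons c m)
  let ?u = "cf_value m a" and ?v = "cf_value m b"
  have c: "1 \<le> real c" using Cons.prems by auto
  have uv: "0 \<le> ?u" "0 \<le> ?v"
    using cf_value_unit[of m a] cf_value_unit[of m b] Cons assms by auto
  let ?D = "(real c + ?u) * (real c + ?v)"
  have D: "1 * 1 \<le> ?D" using c uv by (intro mult_mono) auto
  have "\<bar>cf_value (c # m) a - cf_value (c # m) b\<bar> = \<bar>?u - ?v\<bar> / ?D"
    using reciprocal_diff[of c ?u ?v] c uv by (simp add: abs_mult abs_minus_commute)
  also have "\<dots> \<le> \<bar>?u - ?v\<bar> / 1" using D by (intro divide_left_mono) auto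
  also have "\<dots> \<le> \<bar>a - b\<bar>" using Cons by simp
  finally show ?case .
qed simp

lemma continuous_on_cf_value:
  "\<forall>c\<in>set m. c \<ge> 1 \<Longrightarrow> continuous_on {0..1} (cf_value m)"
proof (induction m)
  case (Cons c m)
  have "real c + cf_value m z \<noteq> 0" if "z \<in> {0..1}" for z
    using cf_value_unit[of m z] Cons.prems that by auto
  then show ?case using Cons by (auto intro!: continuous_intros)
qed (simp add: continuous_on_id)

lemma inj_on_cf_value:
  "\<forall>c\<in>set m. c \<ge> 1 \<Longrightarrow> inj_on (cf_value m) {0..1}"
proof (induction m)
  case (Cons c m)
  show ?case
  proof (rule inj_onI)
    fix y z assume yz: "y \<in> {0..1}" "z \<in> {0..1}" "cf_value (c # m) y = cf_value (c # m) z"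
    have "real c + cf_value m y > 0" "real c + cf_value m z > 0"
      using cf_value_unit[of m z] cf_value_unit[of m y] Cons.prems yz by auto
    then have "cf_value m y = cf_value m z" using yz(3) by (simp add: field_simps)
    then show "y = z" using Cons yz by (auto dest: inj_onD)
  qed
qed (simp add: inj_on_def)

text \<open>The values that begin with \<open>d 0, ..., d (n-1)\<close> form nested compact sets. A
  common point has a tail at every level, and injectivity of \<open>cf_value\<close> yields their
  recursion.\<close>

lemma cf_expansion_exists:
  assumes d: "\<And>n. d n \<ge> 1"
  shows "\<exists>t. cf_expansion d t"
proof -
  let ?v = "\<lambda>n. cf_value (map d [0..<n])"
  let ?I = "\<lambda>n. ?v n ` {0..1}"
  have d': "\<forall>c\<in>set (map d [0..<n]). c \<ge> 1" for n using d by auto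
  have step: "?v (Suc n) z = ?v n (1 / (real (d n) + z))" for n and z :: real
    by (simp add: cf_value_append)
  have unit: "1 / (real (d n) + z) \<in> {0..1}" if "z \<in> {0..1}" for n z
  proof -
    have "real (d n) \<ge> 1" using d[of n] by simp
    then show ?thesis using that by simp
  qed
  have "\<Inter> (range ?I) \<noteq> {}"
  proof (rule compact_nest)
    show "compact (?I n)" for n
      by (intro compact_continuous_image continuous_on_cf_value d') auto
    show "?I n \<noteq> {}" for n by auto
    have "?I (Suc n) \<subseteq> ?I n" for n
    proof (rule image_subsetI)
      fix z :: real assume "z \<in> {0..1}"
      then show "?v (Suc n) z \<in> ?I n" unfolding step using unit by (intro imageI) blast
    qed
    then show "?I n \<subseteq> ?I m" if "m \<le> n" for m n using lift_Suc_antimono_le[of ?I] that by blast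
  qed
  then obtain x where "\<And>n. x \<in> ?I n" by blast
  then have "\<forall>n. \<exists>z\<in>{0..1}. x = ?v n z" by blast
  then obtain t where t: "\<And>n. t n \<in> {0..1}" "\<And>n. x = ?v n (t n)" by metis
  have rec: "t n = 1 / (real (d n) + t (Suc n))" for n
  proof (rule inj_onD[OF inj_on_cf_value[OF d', of n]])
    show "?v n (t n) = ?v n (1 / (real (d n) + t (Suc n)))"
      using t(2)[of n] t(2)[of "Suc n"] step by simp
  qed (use t(1) unit in blast)+
  have "cf_expansion d t"
    unfolding cf_expansion_def
  proof (intro allI conjI)
    fix n
    show "d n \<ge> 1" by (rule d)
    have pos: "0 < t n" for n
    proof -
      have "real (d n) \<ge> 1" "t (Suc n) \<ge> 0" using d[of n] t(1)[of "Suc n"] by auto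
      then show ?thesis unfolding rec[of n] by simp
    qed
    then show "0 < t n" .
    have "real (d n) \<ge> 1" "t (Suc n) > 0" using d[of n] pos[of "Suc n"] by auto
    then show "t n < 1" unfolding rec[of n] by simp
    show "t n = 1 / (real (d n) + t (Suc n))" by (rule rec)
  qed
  then show ?thesis by blast
qed

section \<open>From approximation constants to words\<close>

definition dig :: "bool \<Rightarrow> nat" where
  "dig b = (if b then 1 else 2)"

lemma dig_simps [simp]: "dig True = 1" "dig False = 2"
  by (simp_all add: dig_def)

lemma dig_cases: "dig b = 1 \<or> dig b = 2"
  by (simp add: dig_def)

text \<open>Since \<open>[0; 1, 1 + v] = 1 - 1 / (2 + v)\<close>, the block \<open>11\<close> makes
  the future enter through the same function as the past, with opposite sign.\<close>

lemma lambda_22_11: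
  assumes cf: "cf_expansion d t" and d: "d (b + 1) = 2" "d (b + 2) = 1" "d (b + 3) = 1" "d b = 2"
  shows "cf_lambda d t (b + 1) = 3 + 1 / (2 + cf_past d b) - 1 / (2 + t (b + 4))"
proof -
  let ?v = "t (b + 4)"
  have v: "?v > 0" by (rule cf_tail_pos[OF cf])
  have "t (b + 3) = 1 / (1 + ?v)" using cf_tail_rec[OF cf, of "b + 3"] d by (simp add: numeral_eq_Suc)
  moreover have "t (b + 2) = 1 / (1 + t (b + 3))" using cf_tail_rec[OF cf, of "b + 2"] d by (simp add: numeral_eq_Suc)
  ultimately have "t (b + 2) = 1 / (1 + 1 / (1 + ?v))" by simp
  also have "\<dots> = 1 - 1 / (2 + ?v)" using v by (simp add: field_simps)
  finally have "t (b + 2) = 1 - 1 / (2 + ?v)" .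
  moreover have "cf_past d (b + 1) = 1 / (2 + cf_past d b)" using cf_past_Suc[OF cf, of b] d by simp
  ultimately show ?thesis unfolding cf_lambda_def using d by simp
qed

lemma lambda_11_22:
  assumes cf: "cf_expansion d t" and d: "d b = 1" "d (b + 1) = 1" "d (b + 2) = 2" "d (b + 3) = 2"
  shows "cf_lambda d t (b + 2) = 3 + 1 / (2 + t (b + 4)) - 1 / (2 + cf_past d b)"
proof -
  let ?u = "cf_past d b"
  have u: "?u \<ge> 0" using cf_past_bounds[OF cf] by blast
  have "t (b + 3) = 1 / (2 + t (b + 4))" using cf_tail_rec[OF cf, of "b + 3"] d by (simp add: numeral_eq_Suc)
  moreover have "cf_past d (b + 2) = 1 / (1 + 1 / (1 + ?u))"
    using cf_past_Suc[OF cf, of "b + 1"] cf_past_Suc[OF cf, of b] d by simp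
  moreover have "1 / (1 + 1 / (1 + ?u)) = 1 - 1 / (2 + ?u)" using u by (simp add: field_simps)
  ultimately show ?thesis unfolding cf_lambda_def using d by (simp add: numeral_eq_Suc)
qed

text \<open>The extremes come from \<open>1 / (2 + 1)\<close> and
  \<open>1 / (1 + 1/3)\<close>.\<close>

lemma cf_tail_bounds:
  assumes cf: "cf_expansion d t" and d: "d n = 1 \<or> d n = 2" "d (Suc n) = 1 \<or> d (Suc n) = 2"
  shows "1/3 \<le> t n" "t n \<le> 3/4"
proof -
  have lower: "1/3 \<le> t k" if "d k = 1 \<or> d k = 2" for k
  proof -
    have "real (d k) + t (Suc k) \<le> 3" "real (d k) + t (Suc k) > 0"
      using that cf_tail_less_1[OF cf, of "Suc k"] cf_tail_pos[OF cf, of "Suc k"] by auto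
    then show ?thesis unfolding cf_tail_rec[OF cf, of k] by (simp add: field_simps)
  qed
  show "1/3 \<le> t n" by (rule lower[OF d(1)])
  have "4/3 \<le> real (d n) + t (Suc n)" using lower[OF d(2)] d(1) by auto
  then have "1 / (real (d n) + t (Suc n)) \<le> 1 / (4/3)" by (intro divide_left_mono) auto
  then show "t n \<le> 3/4" unfolding cf_tail_rec[OF cf, of n] by simp
qed

lemma cf_past_bounds_digits:
  assumes cf: "cf_expansion d t" and d: "d n = 1 \<or> d n = 2" "d (Suc n) = 1 \<or> d (Suc n) = 2"
  shows "1/3 \<le> cf_past d (n + 2)" "cf_past d (n + 2) \<le> 3/4"
proof -
  have lower: "1/3 \<le> cf_past d (Suc k)" if "d k = 1 \<or> d k = 2" for k
  proof -
    have "real (d k) + cf_past d k \<le> 3" "real (d k) + cf_past d k > 0"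
      using that cf_past_bounds[OF cf, of k] by auto
    then show ?thesis unfolding cf_past_Suc[OF cf, of k] by (simp add: field_simps)
  qed
  show "1/3 \<le> cf_past d (n + 2)" using lower[OF d(2)] by simp
  have "4/3 \<le> real (d (Suc n)) + cf_past d (Suc n)" using lower[OF d(1)] d(2) by auto
  then have "1 / (real (d (Suc n)) + cf_past d (Suc n)) \<le> 1 / (4/3)" by (intro divide_left_mono) auto
  then show "cf_past d (n + 2) \<le> 3/4" using cf_past_Suc[OF cf, of "Suc n"] by simp
qed

lemma map_upt_split:
  assumes "map s [i..<i + n] = p @ q"
  shows "p = map s [i..<i + length p] \<and> q = map s [i + length p..<i + length p + length q]"
proof -
  have n: "n = length p + length q" using arg_cong[OF assms, of length] by simp
  have "map s [i..<i + length p] @ map s [i + length p..<i + length p + length q] = p @ q"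
    unfolding assms[symmetric] n map_append[symmetric]
    using upt_add_eq_append[of i "i + length p" "length q"] by (simp add: add.assoc)
  then show ?thesis by (simp add: append_eq_append_conv)
qed

lemma sublist_map_upt:
  assumes "sublist w (map s [i..<j])"
  shows "\<exists>k\<ge>i. k + length w \<le> max i j \<and> w = map s [k..<k + length w]"
proof -
  obtain p q where pq: "map s [i..<j] = p @ w @ q" using assms by (auto simp: sublist_def)
  have len: "j - i = length p + length w + length q" using arg_cong[OF pq, of length] by simp
  have "w = map s [i + length p..<i + length p + length w]"
  proof (rule nth_equalityI)
    fix k assume k: "k < length w"
    have "w ! k = (p @ w @ q) ! (length p + k)" using k by (simp add: nth_append)
    also have "\<dots> = s (i + (length p + k))" unfolding pq[symmetric] using k len by simp
    finally show "w ! k = map s [i + length p..<i + length p + length w] ! k" using k by (simp add: add.assoc)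
  qed simp
  then show ?thesis using len by (intro exI[of _ "i + length p"]) auto
qed

section \<open>Windows of the digit sequence avoid the forbidden factors\<close>

context
  fixes d :: "nat \<Rightarrow> nat" and t :: "nat \<Rightarrow> real" and s :: "nat \<Rightarrow> bool" and N L :: nat
  assumes cf: "cf_expansion d t" and s: "\<And>n. n \<ge> N \<Longrightarrow> d n = dig (s n)"
    and lam: "\<And>n. n \<ge> N \<Longrightarrow> cf_lambda d t n \<le> 3 + 1 / 9 ^ (L + 2)"
begin

lemma lambda_le_81: "n \<ge> N \<Longrightarrow> cf_lambda d t n \<le> 3 + 1 / 81"
proof -
  assume n: "n \<ge> N"
  have "1 / (9::real) ^ (L + 2) \<le> 1 / 9 ^ 2" by (intro divide_left_mono power_increasing) auto
  also have "\<dots> = 1 / 81" by simp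
  finally show ?thesis using lam[OF n] by linarith
qed

lemma window_tail_bounds: "n \<ge> N \<Longrightarrow> 1/3 \<le> t n \<and> t n \<le> 3/4"
  using cf_tail_bounds[OF cf, of n] s[of n] s[of "Suc n"] dig_cases by simp

lemma window_past_bounds: "n \<ge> N + 2 \<Longrightarrow> 1/3 \<le> cf_past d n \<and> cf_past d n \<le> 3/4"
proof -
  assume "n \<ge> N + 2"
  then obtain k where "n = k + 2" "k \<ge> N" by (intro that[of "n - 2"]) auto
  then show ?thesis
    using cf_past_bounds_digits[OF cf, of k] s[of k] s[of "Suc k"] dig_cases by simp
qed

text \<open>A factor \<open>121\<close> gives at least \<open>2 + 4/7 + 4/7\<close> at its centre,
  and \<open>212\<close> at least \<open>2 + 7/10 + 1/3\<close> at its first letter.\<close>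

lemma no_isolated_digit:
  assumes jN: "j \<ge> N + 2" and sj: "s j = x" "s (j + 1) = (\<not> x)" "s (j + 2) = x"
  shows False
proof -
  have t1: "t (j + 1) = 1 / (real (d (j + 1)) + t (j + 2))" using cf_tail_rec[OF cf, of "j + 1"] by simp
  have t2: "t (j + 2) = 1 / (real (d (j + 2)) + t (j + 3))"
    using cf_tail_rec[OF cf, of "j + 2"] by (simp add: numeral_eq_Suc)
  have p1: "cf_past d (j + 1) = 1 / (real (d j) + cf_past d j)" using cf_past_Suc[OF cf, of j] by simp
  have p: "1/3 \<le> cf_past d j" "cf_past d j \<le> 3/4" using window_past_bounds[OF jN] by auto
  have t3: "1/3 \<le> t (j + 3)" "t (j + 3) \<le> 3/4" using window_tail_bounds[of "j + 3"] jN by auto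
  show False
  proof (cases x)
    case True
    have d: "d j = 1" "d (j + 1) = 2" "d (j + 2) = 1" using s sj True jN by simp_all
    have "4/7 \<le> t (j + 2)" unfolding t2 d using t3 by (simp add: field_simps)
    moreover have "4/7 \<le> cf_past d (j + 1)" unfolding p1 d using p by (simp add: field_simps)
    ultimately show False
      using lambda_le_81[of "j + 1"] jN d(2) unfolding cf_lambda_def by simp
  next
    case False
    have d: "d j = 2" "d (j + 1) = 1" "d (j + 2) = 2" using s sj False jN by simp_all
    have "t (j + 2) \<le> 3/7" unfolding t2 d using t3 by (simp add: field_simps)
    moreover have "t (j + 2) > 0" by (rule cf_tail_pos[OF cf])
    ultimately have "7/10 \<le> t (j + 1)" unfolding t1 d by (simp add: field_simps)
    then show False
      using lambda_le_81[of j] jN d(1) p(1) unfolding cf_lambda_def by simp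
  qed
qed

text \<open>Origin of the exponent \<open>L + 2\<close>: the mirrored word of length
  \<open>k\<close> costs \<open>9 ^ k\<close>, the denominators \<open>2 + p\<close> and
  \<open>2 + q\<close> another 9, and the gap \<open>1/7\<close> of the first distinct digits
  exceeds \<open>1/9\<close>.\<close>

lemma lambda_excess:
  fixes g p q :: real
  assumes g: "g = (1/7) / 9 ^ k" and kL: "k \<le> L"
    and pq: "0 \<le> p" "p \<le> 1" "0 \<le> q" "q \<le> 1" "g \<le> q - p"
  shows "3 + 1 / 9 ^ (L + 2) < 3 + 1 / (2 + p) - 1 / (2 + q)"
proof -
  have "1 / 9 ^ (L + 2) \<le> 1 / (9::real) ^ (k + 2)"
    using kL by (intro divide_left_mono power_increasing) auto
  also have "\<dots> < g / 9"
  proof -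
    have "(1/81) * (1 / (9::real) ^ k) < (1/63) * (1 / 9 ^ k)" by (rule mult_strict_right_mono) auto
    then show ?thesis by (simp add: g)
  qed
  also have "\<dots> \<le> (q - p) / 9" using pq by simp
  also have "\<dots> \<le> (q - p) / ((2 + p) * (2 + q))"
  proof (rule divide_left_mono)
    have "(2 + p) * (2 + q) \<le> 3 * 3" using pq by (intro mult_mono) auto
    then show "(2 + p) * (2 + q) \<le> 9" by simp
    have "g > 0" by (simp add: g)
    then show "0 \<le> q - p" using pq by simp
    show "0 < 9 * ((2 + p) * (2 + q))" using pq by (intro mult_pos_pos) auto
  qed
  also have "\<dots> = 1 / (2 + p) - 1 / (2 + q)" using reciprocal_diff[of 2 p q] pq by simp
  finally show ?thesis by simp
qed

text \<open>Read outwards from the centre, past and future share \<open>m\<close> and then differ in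
  \<open>e\<close>. There the value is at least \<open>4/7\<close> for digit 1 and at most
  \<open>3/7\<close> for digit 2. Carried back through \<open>m\<close>, the gap gets the sign
  \<open>(-1) ^ length m\<close>, and \<open>e\<close> is such that \<open>cf_lambda\<close> exceeds
  3.\<close>

lemma no_markoff_violation:
  assumes i: "i \<ge> N + 2" and e: "e = (x \<longleftrightarrow> even (length m))"
    and sub: "sublist ([e] @ rev m @ [x, x, \<not> x, \<not> x] @ m @ [\<not> e]) (map s [i..<i + L])"
  shows False
proof -
  define k where "k = length m"
  obtain j where j: "j \<ge> i" "j + (2 * k + 6) \<le> i + L"
    "[e] @ rev m @ [x, x, \<not> x, \<not> x] @ m @ [\<not> e] = map s [j..<j + (2 * k + 6)]"
  proof -
    have len: "length ([e] @ rev m @ [x, x, \<not> x, \<not> x] @ m @ [\<not> e]) = 2 * k + 6" by (simp add: k_def)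
    show ?thesis using sublist_map_upt[OF sub, unfolded len] that by auto
  qed
  have jN: "j \<ge> N + 2" using i j by simp
  define b where "b = j + 1 + k"
  define X2 where "X2 = [x, x, \<not> x, \<not> x] @ m @ [\<not> e]"
  have s1: "map s [j..<j + (2 * k + 6)] = [e] @ (rev m @ X2)" using j(3) by (simp add: X2_def)
  have lX2: "length X2 = k + 5" by (simp add: X2_def k_def)
  have "s j = e" using map_upt_split[OF s1] by simp
  have "rev m @ X2 = map s [j + 1..<j + 1 + (k + (k + 5))]"
    using map_upt_split[OF s1] lX2 by (simp add: k_def)
  note s2 = this[symmetric]
  have rm: "map s [j + 1..<b] = rev m"
    using map_upt_split[OF s2] by (simp add: k_def b_def)
  have "X2 = map s [b..<b + (k + 5)]"
    using map_upt_split[OF s2] lX2 by (simp add: k_def b_def)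
  then have s3: "map s [b..<b + (k + 5)] = [x, x, \<not> x, \<not> x] @ (m @ [\<not> e])" by (simp add: X2_def)
  have len1: "length (m @ [\<not> e]) = k + 1" by (simp add: k_def)
  have len4: "length [x, x, \<not> x, \<not> x] = 4" by simp
  have "map s [b..<b + 4] = [x, x, \<not> x, \<not> x]"
    by (rule map_upt_split[OF s3, unfolded len4, THEN conjunct1, symmetric])
  then have sb: "s b = x" "s (b + 1) = x" "s (b + 2) = (\<not> x)" "s (b + 3) = (\<not> x)"
    by (simp_all add: upt_rec numeral_eq_Suc)
  have s4: "map s [b + 4..<b + 4 + (k + 1)] = m @ [\<not> e]"
    by (rule map_upt_split[OF s3, unfolded len4 len1, THEN conjunct2, symmetric])
  have m4: "map s [b + 4..<b + 4 + k] = m" "s (b + 4 + k) = (\<not> e)"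
    using map_upt_split[OF s4] by (simp_all add: k_def numeral_eq_Suc)
  note eqs = rm sb m4(1) \<open>s j = e\<close> m4(2)
  have map_dig: "map d [p..<q] = map dig (map s [p..<q])" if "p \<ge> N" for p q
    using s that by simp
  have "N \<le> j + 1" "N \<le> b + 4" using jN by (simp_all add: b_def)
  then have md: "map d [j + 1..<j + 1 + k] = map dig (rev m)" "map d [b + 4..<b + 4 + k] = map dig m"
    unfolding map_dig[OF \<open>N \<le> j + 1\<close>] map_dig[OF \<open>N \<le> b + 4\<close>] rm[unfolded b_def] m4(1) by simp_all
  have u: "cf_past d b = cf_value (map dig m) (cf_past d (j + 1))"
    unfolding b_def using cf_past_value[OF cf, of "j + 1" k] unfolding md rev_map rev_rev_ident .
  have v: "t (b + 4) = cf_value (map dig m) (t (b + 4 + k))"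
    using cf_tail_value[OF cf, of "b + 4" k] unfolding md .
  have bN: "b \<ge> N + 2" using jN by (simp add: b_def)
  let ?A = "cf_past d (j + 1)" and ?B = "t (b + 4 + k)"
  have A: "?A = 1 / (dig e + cf_past d j)" using cf_past_Suc[OF cf, of j] s[of j] eqs(7) jN by simp
  have B: "?B = 1 / (dig (\<not> e) + t (b + 5 + k))"
    using cf_tail_rec[OF cf, of "b + 4 + k"] s[of "b + 4 + k"] eqs(8) bN by (simp add: numeral_eq_Suc)
  have pj: "1/3 \<le> cf_past d j" "cf_past d j \<le> 3/4" using window_past_bounds[of j] jN by auto
  have tj: "1/3 \<le> t (b + 5 + k)" "t (b + 5 + k) \<le> 3/4" using window_tail_bounds[of "b + 5 + k"] bN by auto
  have unit: "0 \<le> ?A" "?A \<le> 1" "0 \<le> ?B" "?B \<le> 1"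
    using cf_past_bounds[OF cf, of "j + 1"] cf_tail_pos[OF cf, of "b + 4 + k"] cf_tail_less_1[OF cf, of "b + 4 + k"]
    by auto
  have dm: "\<forall>c\<in>set (map dig m). c = 1 \<or> c = 2" using dig_cases by auto
  define g :: real where "g = (1/7) / 9 ^ k"
  have gap1: "g \<le> (-1) ^ k * (cf_past d b - t (b + 4))" if "e"
  proof -
    have "?A \<ge> 4/7" "?B \<le> 3/7" unfolding A B using that pj tj by (simp_all add: field_simps)
    then have "1/7 \<le> ?A - ?B" by linarith
    then have "g \<le> (?A - ?B) / 9 ^ k" unfolding g_def by (intro divide_right_mono) auto
    also have "\<dots> \<le> (-1) ^ k * (cf_past d b - t (b + 4))"
      using cf_value_gap[OF dm, of ?A ?B] unit \<open>1/7 \<le> ?A - ?B\<close> unfolding u v k_def by simp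
    finally show ?thesis .
  qed
  have gap2: "g \<le> (-1) ^ k * (t (b + 4) - cf_past d b)" if "\<not> e"
  proof -
    have "?B \<ge> 4/7" "?A \<le> 3/7" unfolding A B using that pj tj by (simp_all add: field_simps)
    then have "1/7 \<le> ?B - ?A" by linarith
    then have "g \<le> (?B - ?A) / 9 ^ k" unfolding g_def by (intro divide_right_mono) auto
    also have "\<dots> \<le> (-1) ^ k * (t (b + 4) - cf_past d b)"
      using cf_value_gap[OF dm, of ?B ?A] unit \<open>1/7 \<le> ?B - ?A\<close> unfolding u v k_def by simp
    finally show ?thesis .
  qed
  have gap: "g \<le> (if x then cf_past d b - t (b + 4) else t (b + 4) - cf_past d b)"
    using gap1 gap2 e unfolding k_def[symmetric] by (cases x; cases "even k") auto
  have "k \<le> L" using j by simp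
  note large = lambda_excess[OF g_def this]
  have ub: "0 \<le> cf_past d b" "cf_past d b \<le> 1" "0 \<le> t (b + 4)" "t (b + 4) \<le> 1"
    using window_past_bounds[of b] window_tail_bounds[of "b + 4"] bN by auto
  show False
  proof (cases x)
    case True
    have "cf_lambda d t (b + 2) = 3 + 1 / (2 + t (b + 4)) - 1 / (2 + cf_past d b)"
      by (rule lambda_11_22[OF cf]) (use s bN eqs True in auto)
    then show False using large[of "t (b + 4)" "cf_past d b"] ub gap True lam[of "b + 2"] bN by simp
  next
    case False
    have "cf_lambda d t (b + 1) = 3 + 1 / (2 + cf_past d b) - 1 / (2 + t (b + 4))"
      by (rule lambda_22_11[OF cf]) (use s bN eqs False in auto)
    then show False using large[of "cf_past d b" "t (b + 4)"] ub gap False lam[of "b + 1"] bN by simp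
  qed
qed

lemma digit_word_window:
  assumes i: "i \<ge> N + 2"
  shows "digit_word (map s [i..<i + L])"
  unfolding digit_word_def
proof (intro conjI allI impI notI)
  fix x assume sub: "sublist [x, \<not> x, x] (map s [i..<i + L])"
  have len: "length [x, \<not> x, x] = 3" by simp
  from sublist_map_upt[OF sub, unfolded len] obtain j
    where j: "j \<ge> i" and m: "[x, \<not> x, x] = map s [j..<j + 3]"
    by (elim exE conjE) (rule that)
  have "map s [j..<j + 3] = [s j, s (j + 1), s (j + 2)]" by (simp add: upt_rec numeral_eq_Suc)
  from trans[OF m this] have sj: "s j = x" "s (j + 1) = (\<not> x)" "s (j + 2) = x"
    by (metis list.inject)+
  show False by (rule no_isolated_digit[OF _ sj]) (use i j in simp)
qed (rule no_markoff_violation[OF i])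

end

text \<open>Digits are below 4 since \<open>cf_lambda\<close> is. A 3 would then be followed by a
  tail of at least \<open>1/4\<close>.\<close>

lemma partial_quotients_1_2:
  assumes cf: "cf_expansion d t" and lam: "\<And>n. n \<ge> N \<Longrightarrow> cf_lambda d t n \<le> 3 + 1 / 81" and n: "n \<ge> N"
  shows "d n = 1 \<or> d n = 2"
proof -
  have le: "d n \<le> 3" if "n \<ge> N" for n
  proof -
    have "real (d n) < 4"
      using lam[OF that] cf_tail_pos[OF cf, of "Suc n"] cf_past_bounds[OF cf, of n] unfolding cf_lambda_def by simp
    then show ?thesis by simp
  qed
  have "d n \<noteq> 3"
  proof
    assume "d n = 3"
    have "real (d (Suc n)) + t (Suc (Suc n)) \<le> 4" "real (d (Suc n)) + t (Suc (Suc n)) > 0"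
      using le[of "Suc n"] n cf_tail_less_1[OF cf, of "Suc (Suc n)"] cf_tail_pos[OF cf, of "Suc (Suc n)"] by auto
    then have "t (Suc n) \<ge> 1/4" unfolding cf_tail_rec[OF cf, of "Suc n"] by (simp add: field_simps)
    then show False using lam[OF n] cf_past_bounds[OF cf, of n] \<open>d n = 3\<close> unfolding cf_lambda_def by simp
  qed
  then show ?thesis using le[OF n] cf_digit_pos[OF cf, of n] by linarith
qed

text \<open>Pairs of a digit word and a number with these digits behind the prefix \<open>p\<close>.
  Integer part and prefix range over countable sets; behind them all windows lie in
  \<open>W\<close>.\<close>

definition coded_reals :: "bool list set \<Rightarrow> nat \<Rightarrow> int \<Rightarrow> nat list \<Rightarrow> (bool list \<times> real) set" where
  "coded_reals W l a p = {(v, x). \<exists>d t s. cf_expansion d t \<and> x = of_int a + t 0 \<and> map d [0..<length p] = p \<and>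
     (\<forall>i\<ge>length p. d i = dig (s i) \<and> map s [i..<i + l] \<in> W) \<and>
     (\<exists>k. v = map s [length p..<length p + k])}"

lemma k_level_3_coded:
  assumes W: "\<forall>w. length w = l \<longrightarrow> margin digit_word n w \<longrightarrow> w \<in> W"
  shows "k_level_3 \<subseteq> (\<Union>(a, p). {x. \<forall>k. \<exists>v. length v = k \<and> (v, x) \<in> coded_reals W l a p})"
proof
  fix x assume x: "x \<in> k_level_3"
  \<comment> \<open>A window of length \<open>l\<close> together with its margins on both
    sides.\<close>
  define L where "L = l + 2 * n"
  have "1 / (9::real) ^ (L + 2) > 0" by simp
  then obtain d t N where dt: "cf_expansion d t" "x = of_int \<lfloor>x\<rfloor> + t 0"
    and N: "\<And>n. n \<ge> N \<Longrightarrow> cf_lambda d t n \<le> 3 + 1 / 9 ^ (L + 2)"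
    using k_level_3_cf[OF x, of "3 + 1 / 9 ^ (L + 2)"] by auto
  have lam: "cf_lambda d t n \<le> 3 + 1 / 81" if "n \<ge> N" for n
  proof -
    have "1 / (9::real) ^ (L + 2) \<le> 1 / 9 ^ 2" by (intro divide_left_mono power_increasing) auto
    also have "\<dots> = 1 / 81" by simp
    finally show ?thesis using N[OF that] by linarith
  qed
  define s where "s i = (d i = 1)" for i
  have s: "d i = dig (s i)" if "i \<ge> N" for i
    using partial_quotients_1_2[OF dt(1) lam that] by (auto simp: s_def)
  \<comment> \<open>Here \<open>n\<close> digits are reserved for the left margin.\<close>
  define M where "M = N + 2 + n"
  have win: "map s [i..<i + l] \<in> W" if "i \<ge> M" for i
  proof -
    define j where "j = i - n"
    have j: "i = j + n" "j \<ge> N + 2" using that by (auto simp: j_def M_def)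
    have "digit_word (map s [j..<j + L])" by (rule digit_word_window[OF dt(1) s N j(2)])
    moreover have "map s [j..<j + L] = map s [j..<i] @ map s [i..<i + l] @ map s [i + l..<i + l + n]"
      unfolding map_append[symmetric] j(1) L_def
      using upt_add_eq_append[of j "j + n" "l + n"] upt_add_eq_append[of "j + n" "j + n + l" n]
      by (simp add: add_ac mult_2)
    ultimately have "margin digit_word n (map s [i..<i + l])"
      unfolding margin_def using j(1) by (intro exI[of _ "map s [j..<i]"] exI[of _ "map s [i + l..<i + l + n]"]) auto
    then show ?thesis using W by simp
  qed
  have s': "d i = dig (s i)" if "i \<ge> M" for i using s that by (simp add: M_def)
  have "\<exists>v. length v = k \<and> (v, x) \<in> coded_reals W l \<lfloor>x\<rfloor> (map d [0..<M])" for k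
  proof (intro exI conjI)
    show "length (map s [M..<M + k]) = k" by simp
    show "(map s [M..<M + k], x) \<in> coded_reals W l \<lfloor>x\<rfloor> (map d [0..<M])"
      unfolding coded_reals_def mem_Collect_eq prod.case
      by (rule exI[of _ d], rule exI[of _ t], rule exI[of _ s], intro conjI allI impI dt exI[of _ k])
         (simp_all add: s' win)
  qed
  then show "x \<in> (\<Union>(a, p). {x. \<forall>k. \<exists>v. length v = k \<and> (v, x) \<in> coded_reals W l a p})"
    by (intro UN_I[of "(\<lfloor>x\<rfloor>, map d [0..<M])"]) auto
qed

text \<open>The prefix does not expand, and every letter of \<open>v\<close> contracts by
  \<open>9/16\<close>.\<close>

lemma coded_reals_close:
  assumes "(v, x) \<in> coded_reals W l a p" "(v, y) \<in> coded_reals W l a p"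
  shows "\<bar>x - y\<bar> \<le> (9/16) ^ length v"
proof -
  have rep: "\<exists>z. x = of_int a + cf_value p (cf_value (map dig v) z) \<and> 1/3 \<le> z \<and> z \<le> 1 \<and> (\<forall>c\<in>set p. c \<ge> 1)"
    if x: "(v, x) \<in> coded_reals W l a p" for x
  proof -
    from x[unfolded coded_reals_def mem_Collect_eq prod.case] obtain d t s k
      where dts': "cf_expansion d t" "x = of_int a + t 0" "map d [0..<length p] = p"
        "\<forall>i\<ge>length p. d i = dig (s i) \<and> map s [i..<i + l] \<in> W" "v = map s [length p..<length p + k]"
      by (elim exE conjE) (rule that; assumption)
    have dig': "d i = dig (s i)" if "i \<ge> length p" for i using dts'(4) that by blast
    note dts = dts'(1-3) dig' dts'(5)
    let ?M = "length p" and ?k = k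
    have "map d [?M..<?M + ?k] = map dig (map s [?M..<?M + ?k])" using dts(4) by simp
    also have "\<dots> = map dig v" by (simp only: dts(5)[symmetric])
    finally have v: "map d [?M..<?M + ?k] = map dig v" .
    have "t 0 = cf_value p (t ?M)" using cf_tail_value[OF dts(1), of 0 ?M] dts(3) by simp
    also have "t ?M = cf_value (map dig v) (t (?M + ?k))"
      using cf_tail_value[OF dts(1), of ?M ?k] unfolding v .
    finally have "x = of_int a + cf_value p (cf_value (map dig v) (t (?M + ?k)))" using dts(2) by simp
    moreover have "d (?M + ?k) = 1 \<or> d (?M + ?k) = 2" "d (Suc (?M + ?k)) = 1 \<or> d (Suc (?M + ?k)) = 2"
      using dts(4) dig_cases by simp_all
    then have "1/3 \<le> t (?M + ?k)" "t (?M + ?k) \<le> 1"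
      using cf_tail_bounds[OF dts(1), of "?M + ?k"] by linarith+
    moreover have "\<forall>c\<in>set (map d [0..<?M]). c \<ge> 1" using cf_digit_pos[OF dts(1)] by auto
    then have "\<forall>c\<in>set p. c \<ge> 1" by (simp only: dts(3))
    ultimately show ?thesis using \<open>1/3 \<le> t (?M + ?k)\<close> \<open>t (?M + ?k) \<le> 1\<close> \<open>\<forall>c\<in>set p. c \<ge> 1\<close> by blast
  qed
  obtain z where z: "x = of_int a + cf_value p (cf_value (map dig v) z)" "1/3 \<le> z" "z \<le> 1" "\<forall>c\<in>set p. c \<ge> 1"
    using rep[OF assms(1)] by blast
  obtain z' where z': "y = of_int a + cf_value p (cf_value (map dig v) z')" "1/3 \<le> z'" "z' \<le> 1"
    using rep[OF assms(2)] by blast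
  have dv: "\<forall>c\<in>set (map dig v). c \<ge> 1" "\<forall>c\<in>set (map dig v). c \<le> 2" by (auto simp: dig_def)
  let ?u = "cf_value (map dig v) z" and ?u' = "cf_value (map dig v) z'"
  have unit: "0 \<le> ?u" "?u \<le> 1" "0 \<le> ?u'" "?u' \<le> 1"
    using cf_value_unit[OF dv(1), of z] cf_value_unit[OF dv(1), of z'] z(2,3) z'(2,3) by linarith+
  have "\<bar>x - y\<bar> = \<bar>cf_value p ?u - cf_value p ?u'\<bar>" unfolding z(1) z'(1) by simp
  also have "\<dots> \<le> \<bar>?u - ?u'\<bar>" by (rule cf_value_nonexpanding[OF z(4) unit])
  also have "\<dots> \<le> (9/16) ^ length (map dig v) * \<bar>z - z'\<bar>"
    using cf_value_contract[OF dv(1) z(2,3) z'(2,3) dv(2)] by blast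
  also have "\<dots> \<le> (9/16) ^ length v * 1"
    using z z' by (intro mult_mono) (auto simp: abs_le_iff)
  finally show ?thesis by simp
qed

text \<open>A digit word of length \<open>k * l\<close> is a concatenation of \<open>k\<close>
  windows, which leaves \<open>card W ^ k\<close> codes.\<close>

lemma coded_reals_cover:
  assumes W: "finite W"
  shows "\<exists>F. finite F \<and> card F \<le> card W ^ k \<and>
    {x. \<forall>k. \<exists>v. length v = k \<and> (v, x) \<in> coded_reals W l a p} \<subseteq> \<Union>F \<and>
    (\<forall>U\<in>F. bounded U \<and> diameter U \<le> (9/16) ^ (k * l))"
proof -
  let ?V = "{\<omega>. set \<omega> \<subseteq> W \<and> length \<omega> = k}"
  \<comment> \<open>\<open>W\<close> may contain words of other lengths; the length condition
    removes concatenations of the wrong length.\<close>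
  define G where "G \<omega> = {x. length (concat \<omega>) = k * l \<and> (concat \<omega>, x) \<in> coded_reals W l a p}" for \<omega>
  have fin: "finite ?V" by (rule finite_lists_length_eq[OF W])
  have "card (G ` ?V) \<le> card ?V" by (rule card_image_le[OF fin])
  then have card: "card (G ` ?V) \<le> card W ^ k" using card_lists_length_eq[OF W, of k] by simp
  have cover: "{x. \<forall>k. \<exists>v. length v = k \<and> (v, x) \<in> coded_reals W l a p} \<subseteq> \<Union>(G ` ?V)"
  proof
    fix x assume "x \<in> {x. \<forall>k. \<exists>v. length v = k \<and> (v, x) \<in> coded_reals W l a p}"
    then obtain v where v: "length v = k * l" "(v, x) \<in> coded_reals W l a p" by auto
    from v(2)[unfolded coded_reals_def mem_Collect_eq prod.case] obtain d s k'
      where s': "\<forall>i\<ge>length p. d i = dig (s i) \<and> map s [i..<i + l] \<in> W" "v = map s [length p..<length p + k']"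
      by (elim exE conjE) (rule that)
    then have "k' = k * l" using v(1) by simp
    then have s: "v = map s [length p..<length p + k * l]" "\<And>i. i \<ge> length p \<Longrightarrow> map s [i..<i + l] \<in> W"
      using s' by blast+
    define \<omega> where "\<omega> = map (\<lambda>j. map s [length p + j * l..<length p + j * l + l]) [0..<k]"
    have "concat (map (\<lambda>j. map s [length p + j * l..<length p + j * l + l]) [0..<k]) = map s [length p..<length p + k * l]" for k
    proof (induction k)
      case (Suc k)
      have "[length p..<length p + Suc k * l] = [length p..<length p + k * l] @ [length p + k * l..<length p + k * l + l]"
        using upt_add_eq_append[of "length p" "length p + k * l" l] by (simp add: add_ac)
      then show ?case using Suc by simp
    qed simp
    then have "concat \<omega> = v" unfolding \<omega>_def s(1) .
    then have "x \<in> G \<omega>" using v by (simp add: G_def)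
    moreover have "\<omega> \<in> ?V" using s(2) by (auto simp: \<omega>_def)
    ultimately show "x \<in> \<Union>(G ` ?V)" by blast
  qed
  have diam: "bounded U \<and> diameter U \<le> (9/16) ^ (k * l)" if U: "U \<in> G ` ?V" for U
  proof -
    have close: "dist x y \<le> (9/16) ^ (k * l)" if "x \<in> U" "y \<in> U" for x y
      using U that coded_reals_close unfolding G_def dist_real_def by fastforce
    have "bounded U"
    proof (cases "U = {}")
      case False
      then obtain x where "x \<in> U" by blast
      then show ?thesis unfolding bounded_def using close by blast
    qed simp
    moreover have "diameter U \<le> (9/16) ^ (k * l)"
      by (rule diameter_le) (use close in \<open>auto simp: dist_norm\<close>)
    ultimately show ?thesis by blast
  qed
  show ?thesis by (rule exI[of _ "G ` ?V"]) (use fin card cover diam in blast)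
qed

section \<open>Hausdorff null sets\<close>

text \<open>Nullity in terms of actual covers, which can be merged for countable unions.\<close>

definition hausdorff_null :: "(real \<Rightarrow> real) \<Rightarrow> real set \<Rightarrow> bool" where
  "hausdorff_null h E \<longleftrightarrow> (\<forall>\<delta>>0. \<forall>e>0. \<exists>U\<in>delta_covers \<delta> E. (\<Sum>i. ennreal (h (diameter (U i)))) \<le> ennreal e)"

lemma hausdorff_null_imp_zero:
  assumes "hausdorff_null h E"
  shows "hausdorff_measure h E = 0"
proof -
  have "hausdorff_premeasure h \<delta> E \<le> 0" if "\<delta> > 0" for \<delta>
  proof (rule ennreal_le_epsilon)
    fix e :: real assume "0 < e"
    then obtain U where "U \<in> delta_covers \<delta> E" "(\<Sum>i. ennreal (h (diameter (U i)))) \<le> ennreal e"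
      using assms \<open>\<delta> > 0\<close> unfolding hausdorff_null_def by blast
    then show "hausdorff_premeasure h \<delta> E \<le> 0 + ennreal e"
      unfolding hausdorff_premeasure_def by (simp add: INF_lower2)
  qed
  then have "(SUP \<delta>\<in>{0<..}. hausdorff_premeasure h \<delta> E) \<le> 0" by (intro SUP_least) auto
  then show ?thesis unfolding hausdorff_measure_eq_SUP by simp
qed

lemma hausdorff_null_subset: "hausdorff_null h E \<Longrightarrow> F \<subseteq> E \<Longrightarrow> hausdorff_null h F"
proof -
  assume E: "hausdorff_null h E" "F \<subseteq> E"
  then have "delta_covers \<delta> E \<subseteq> delta_covers \<delta> F" for \<delta> unfolding delta_covers_def by blast
  then show ?thesis using E(1) unfolding hausdorff_null_def by blast
qed

lemma hausdorff_null_UN_nat: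
  assumes "\<And>n::nat. hausdorff_null h (E n)"
  shows "hausdorff_null h (\<Union>n. E n)"
  unfolding hausdorff_null_def
proof (intro allI impI)
  fix \<delta> e :: real assume \<delta>: "\<delta> > 0" and e: "e > 0"
  have "\<exists>U\<in>delta_covers \<delta> (E n). (\<Sum>i. ennreal (h (diameter (U i)))) \<le> ennreal (e * (1/2) ^ Suc n)" for n
    using assms[of n] \<delta> e unfolding hausdorff_null_def by simp
  then obtain U where U: "\<And>n. U n \<in> delta_covers \<delta> (E n)"
    "\<And>n. (\<Sum>i. ennreal (h (diameter (U n i)))) \<le> ennreal (e * (1/2) ^ Suc n)" by metis
  define V where "V k = (case prod_decode k of (n, i) \<Rightarrow> U n i)" for k
  have "V \<in> delta_covers \<delta> (\<Union>n. E n)"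
    unfolding delta_covers_def
  proof (intro CollectI conjI allI)
    show "(\<Union>n. E n) \<subseteq> (\<Union>k. V k)"
    proof
      fix x assume "x \<in> (\<Union>n. E n)"
      then obtain n where "x \<in> E n" by blast
      then obtain i where "x \<in> U n i" using U(1)[of n] unfolding delta_covers_def by blast
      then have "x \<in> V (prod_encode (n, i))" by (simp add: V_def)
      then show "x \<in> (\<Union>k. V k)" by blast
    qed
    show "bounded (V k)" "diameter (V k) < \<delta>" for k
      using U(1) unfolding V_def delta_covers_def by (auto split: prod.splits)
  qed
  moreover have "(\<Sum>k. ennreal (h (diameter (V k)))) \<le> ennreal e"
  proof -
    have "(\<Sum>k. ennreal (h (diameter (V k)))) = (\<Sum>k. (\<lambda>(n, i). ennreal (h (diameter (U n i)))) (prod_decode k))"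
      by (simp add: V_def case_prod_unfold)
    also have "\<dots> = (\<Sum>n. \<Sum>i. ennreal (h (diameter (U n i))))"
      by (rule suminf_ennreal_2dimen) simp
    also have "\<dots> \<le> (\<Sum>n. ennreal (e * (1/2) ^ Suc n))" by (intro suminf_le U(2)) auto
    also have "\<dots> = ennreal e"
    proof (rule sums_unique[symmetric], subst sums_ennreal)
      show "(\<lambda>n. e * (1/2) ^ Suc n) sums e"
        using sums_mult[OF power_half_series, of e] by simp
    qed (use e in auto)
    finally show ?thesis .
  qed
  ultimately show "\<exists>U\<in>delta_covers \<delta> (\<Union>n. E n). (\<Sum>i. ennreal (h (diameter (U i)))) \<le> ennreal e" by blast
qed

lemma hausdorff_null_UN:
  fixes E :: "'a::countable \<Rightarrow> real set"
  assumes "\<And>a. hausdorff_null h (E a)"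
  shows "hausdorff_null h (\<Union>a. E a)"
proof -
  have "(\<Union>a. E a) \<subseteq> (\<Union>n. E (from_nat n))"
  proof
    fix x assume "x \<in> (\<Union>a. E a)"
    then obtain a where "x \<in> E a" by blast
    then have "x \<in> E (from_nat (to_nat a))" by simp
    then show "x \<in> (\<Union>n. E (from_nat n))" by blast
  qed
  then show ?thesis using hausdorff_null_UN_nat[of h "\<lambda>n. E (from_nat n)"] assms hausdorff_null_subset by blast
qed

lemma dimension_function_mono:
  assumes "dimension_function h" "0 \<le> r" "r \<le> s"
  shows "h r \<le> h s"
proof (cases "r = 0")
  case True
  have "h s \<ge> 0" using assms unfolding dimension_function_def by (cases "s = 0") (auto intro: less_imp_le)
  then show ?thesis using assms True unfolding dimension_function_def by simp
next
  case False
  then show ?thesis using assms unfolding dimension_function_def by (auto simp: mono_on_def)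
qed

lemma finite_cover_sum:
  assumes h: "dimension_function h" and F: "finite F" "E \<subseteq> \<Union>F"
    and diam: "\<And>U. U \<in> F \<Longrightarrow> bounded U \<and> diameter U \<le> r" and r: "0 < r" "r < \<delta>"
  shows "\<exists>U\<in>delta_covers \<delta> E. (\<Sum>i. ennreal (h (diameter (U i)))) \<le> ennreal (real (card F) * h r)"
proof -
  obtain f where f: "bij_betw f {..<card F} F" using F(1) by (metis ex_bij_betw_nat_finite atLeast0LessThan)
  define U where "U i = (if i < card F then f i else {})" for i
  have inF: "f i \<in> F" if "i < card F" for i using f that by (auto simp: bij_betw_def)
  have "U \<in> delta_covers \<delta> E"
    unfolding delta_covers_def
  proof (intro CollectI conjI allI)
    show "E \<subseteq> (\<Union>i. U i)"
    proof
      fix x assume "x \<in> E"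
      then obtain V where V: "V \<in> F" "x \<in> V" using F(2) by blast
      then obtain i where "i < card F" "V = f i" using f by (auto simp: bij_betw_def)
      then show "x \<in> (\<Union>i. U i)" using V by (auto simp: U_def)
    qed
    show "bounded (U i)" for i using diam inF by (auto simp: U_def)
    show "diameter (U i) < \<delta>" for i using diam[OF inF, of i] r by (auto simp: U_def)
  qed
  moreover have "(\<Sum>i. ennreal (h (diameter (U i)))) \<le> ennreal (real (card F) * h r)"
  proof -
    have h0: "h 0 = 0" using h by (simp add: dimension_function_def)
    have hr: "0 \<le> h r" using h r(1) by (auto simp: dimension_function_def intro: less_imp_le)
    have "(\<Sum>i. ennreal (h (diameter (U i)))) = (\<Sum>i<card F. ennreal (h (diameter (U i))))"
      by (rule suminf_finite) (auto simp: U_def h0)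
    also have "\<dots> \<le> (\<Sum>i<card F. ennreal (h r))"
    proof (rule sum_mono)
      fix i assume i: "i \<in> {..<card F}"
      then have "bounded (U i)" "diameter (U i) \<le> r" using diam inF by (auto simp: U_def)
      then show "ennreal (h (diameter (U i))) \<le> ennreal (h r)"
        by (intro ennreal_leI dimension_function_mono[OF h] diameter_ge_0)
    qed
    also have "\<dots> = ennreal (real (card F) * h r)"
      using hr by (simp add: ennreal_mult ennreal_of_nat_eq_real_of_nat)
    finally show ?thesis .
  qed
  ultimately show ?thesis by blast
qed

text \<open>\<open>h\<close> is known to be small only at some \<open>\<epsilon>\<close>, so the
  scale \<open>\<kappa> ^ k\<close> is fitted to \<open>\<epsilon>\<close>. With
  \<open>\<kappa> * \<epsilon> \<le> \<kappa> ^ k \<le> \<epsilon>\<close> there are at most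
  \<open>(\<kappa> * \<epsilon>) powr (- c / 2)\<close> sets, each costing at most
  \<open>\<epsilon> powr c\<close>.\<close>

lemma box_count_null:
  fixes c \<kappa> B :: real
  assumes h: "dimension_function h" and c: "c > 0"
    and freq: "frequently (\<lambda>\<epsilon>. h \<epsilon> \<le> \<epsilon> powr c) (at_right 0)"
    and \<kappa>: "0 < \<kappa>" "\<kappa> < 1" and B: "0 \<le> B" "B \<le> \<kappa> powr (- c / 2)"
    and cover: "\<And>k. \<exists>F. finite F \<and> real (card F) \<le> B ^ k \<and> E \<subseteq> \<Union>F \<and>
      (\<forall>U\<in>F. bounded U \<and> diameter U \<le> \<kappa> ^ k)"
  shows "hausdorff_null h E"
  unfolding hausdorff_null_def
proof (intro allI impI)
  fix \<delta> e :: real assume \<delta>: "\<delta> > 0" and e: "e > 0"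
  have "((\<lambda>\<epsilon>. \<kappa> powr (- c / 2) * \<epsilon> powr (c / 2)) \<longlongrightarrow> \<kappa> powr (- c / 2) * 0 powr (c / 2)) (at_right 0)"
    using c by (intro tendsto_intros tendsto_powr2) (auto simp: eventually_at_right_less eventually_at_filter)
  then have "((\<lambda>\<epsilon>. \<kappa> powr (- c / 2) * \<epsilon> powr (c / 2)) \<longlongrightarrow> 0) (at_right 0)" by simp
  then have "eventually (\<lambda>\<epsilon>. \<kappa> powr (- c / 2) * \<epsilon> powr (c / 2) < e) (at_right 0)"
    using e by (rule order_tendstoD(2))
  moreover have "eventually (\<lambda>\<epsilon>. \<epsilon> < min \<delta> 1) (at_right (0::real))"
    using \<delta> by (intro order_tendstoD(2)[OF tendsto_ident_at]) auto
  moreover have "eventually (\<lambda>\<epsilon>. (0::real) < \<epsilon>) (at_right 0)" by (simp add: eventually_at_right_less)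
  ultimately have "frequently (\<lambda>\<epsilon>. h \<epsilon> \<le> \<epsilon> powr c \<and> \<kappa> powr (- c / 2) * \<epsilon> powr (c / 2) < e \<and> \<epsilon> < min \<delta> 1 \<and> 0 < \<epsilon>) (at_right 0)"
    using freq by (intro frequently_eventually_frequently eventually_conj) (auto elim: frequently_mono[rotated])
  then obtain \<epsilon> where \<epsilon>: "h \<epsilon> \<le> \<epsilon> powr c" "\<kappa> powr (- c / 2) * \<epsilon> powr (c / 2) < e" "\<epsilon> < \<delta>" "\<epsilon> < 1" "0 < \<epsilon>"
    using frequently_ex by force
  have "\<exists>k. \<kappa> ^ k \<le> \<epsilon>" using real_arch_pow_inv[OF \<epsilon>(5) \<kappa>(2)] less_imp_le by blast
  define k where "k = (LEAST k. \<kappa> ^ k \<le> \<epsilon>)"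
  have k: "\<kappa> ^ k \<le> \<epsilon>" unfolding k_def using \<open>\<exists>k. \<kappa> ^ k \<le> \<epsilon>\<close> by (rule LeastI_ex)
  have "k \<noteq> 0" using k \<epsilon>(4) by (cases k) auto
  then obtain j where j: "k = Suc j" by (cases k) auto
  then have "\<not> \<kappa> ^ j \<le> \<epsilon>" using not_less_Least[of j "\<lambda>k. \<kappa> ^ k \<le> \<epsilon>"] k_def by simp
  then have lower: "\<kappa> * \<epsilon> \<le> \<kappa> ^ k" using \<kappa> unfolding j by simp
  obtain F where F: "finite F" "real (card F) \<le> B ^ k" "E \<subseteq> \<Union>F" "\<forall>U\<in>F. bounded U \<and> diameter U \<le> \<kappa> ^ k"
    using cover by blast
  have "\<exists>U\<in>delta_covers \<delta> E. (\<Sum>i. ennreal (h (diameter (U i)))) \<le> ennreal (real (card F) * h \<epsilon>)"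
    using F(4) k \<epsilon> by (intro finite_cover_sum[OF h F(1,3)]) (auto intro: order_trans)
  moreover have "real (card F) * h \<epsilon> \<le> e"
  proof -
    have "B ^ k \<le> (\<kappa> powr (- c / 2)) ^ k" using B by (intro power_mono) auto
    also have "\<dots> = (\<kappa> ^ k) powr (- c / 2)"
      using \<kappa>(1) by (simp add: powr_realpow[symmetric] powr_powr mult.commute)
    also have "\<dots> \<le> (\<kappa> * \<epsilon>) powr (- c / 2)"
      using lower \<kappa>(1) \<epsilon>(5) c by (intro powr_mono2') auto
    finally have "real (card F) \<le> (\<kappa> * \<epsilon>) powr (- c / 2)" using F(2) by linarith
    moreover have "0 \<le> h \<epsilon>" using h \<epsilon>(5) by (auto simp: dimension_function_def intro: less_imp_le)
    ultimately have "real (card F) * h \<epsilon> \<le> (\<kappa> * \<epsilon>) powr (- c / 2) * \<epsilon> powr c"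
      using \<epsilon>(1) by (intro mult_mono) auto
    also have "\<dots> = \<kappa> powr (- c / 2) * \<epsilon> powr (c / 2)"
      using \<kappa>(1) \<epsilon>(5) by (simp add: powr_mult powr_add[symmetric])
    finally show ?thesis using \<epsilon>(2) by linarith
  qed
  ultimately show "\<exists>U\<in>delta_covers \<delta> E. (\<Sum>i. ennreal (h (diameter (U i)))) \<le> ennreal e"
    by (meson ennreal_leI order_trans)
qed

section \<open>Meaning of the logarithmic limsup\<close>

lemma eventually_in_unit_interval: "eventually (\<lambda>\<epsilon>. (\<epsilon>::real) < 1 \<and> 0 < \<epsilon>) (at_right 0)"
  by (rule eventually_mono[OF eventually_at_right_real[of 0 1]]) auto

lemma Limsup_log_ratio_pos:
  assumes h: "dimension_function h" and pos: "Limsup (at_right 0) (\<lambda>\<epsilon>. ereal (ln (h \<epsilon>) / ln \<epsilon>)) > 0"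
  shows "\<exists>c>0. frequently (\<lambda>\<epsilon>. h \<epsilon> \<le> \<epsilon> powr c) (at_right 0)"
proof -
  obtain c where c: "0 < ereal c" "ereal c < Limsup (at_right 0) (\<lambda>\<epsilon>. ereal (ln (h \<epsilon>) / ln \<epsilon>))"
    using ereal_dense2[OF pos] by auto
  have "frequently (\<lambda>\<epsilon>. c < ln (h \<epsilon>) / ln \<epsilon>) (at_right 0)"
  proof (rule ccontr)
    assume "\<not> ?thesis"
    then have "eventually (\<lambda>\<epsilon>. ereal (ln (h \<epsilon>) / ln \<epsilon>) \<le> ereal c) (at_right 0)"
      by (simp add: not_frequently not_less)
    then have "Limsup (at_right 0) (\<lambda>\<epsilon>. ereal (ln (h \<epsilon>) / ln \<epsilon>)) \<le> ereal c" by (rule Limsup_bounded)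
    then show False using c(2) by simp
  qed
  moreover have "eventually (\<lambda>\<epsilon>. (\<epsilon>::real) < 1 \<and> 0 < \<epsilon>) (at_right 0)"
    by (rule eventually_in_unit_interval)
  ultimately have "frequently (\<lambda>\<epsilon>. c < ln (h \<epsilon>) / ln \<epsilon> \<and> (\<epsilon> < 1 \<and> 0 < \<epsilon>)) (at_right 0)"
    by (rule frequently_eventually_frequently)
  then have "frequently (\<lambda>\<epsilon>. h \<epsilon> \<le> \<epsilon> powr c) (at_right 0)"
  proof (rule frequently_mono[rotated], intro allI impI)
    fix \<epsilon> :: real assume \<epsilon>: "c < ln (h \<epsilon>) / ln \<epsilon> \<and> (\<epsilon> < 1 \<and> 0 < \<epsilon>)"
    then have "ln \<epsilon> < 0" by simp
    then have "ln (h \<epsilon>) < c * ln \<epsilon>" using \<epsilon> neg_less_divide_eq by blast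
    moreover have "h \<epsilon> > 0" using h \<epsilon> by (simp add: dimension_function_def)
    ultimately have "h \<epsilon> < exp (c * ln \<epsilon>)" by (metis exp_less_cancel_iff exp_ln)
    then show "h \<epsilon> \<le> \<epsilon> powr c" using \<epsilon> by (simp add: powr_def)
  qed
  then show ?thesis using c(1) by auto
qed

lemma Limsup_log_ratio_zero:
  assumes h: "dimension_function h" and zero: "Limsup (at_right 0) (\<lambda>\<epsilon>. ereal (ln (h \<epsilon>) / ln \<epsilon>)) = 0" and s: "s > 0"
  shows "eventually (\<lambda>\<epsilon>. \<epsilon> powr s \<le> h \<epsilon>) (at_right 0)"
proof -
  have "eventually (\<lambda>\<epsilon>. ereal (ln (h \<epsilon>) / ln \<epsilon>) < ereal s) (at_right 0)"
    by (rule Limsup_lessD) (use zero s in simp)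
  moreover have "eventually (\<lambda>\<epsilon>. (\<epsilon>::real) < 1 \<and> 0 < \<epsilon>) (at_right 0)"
    by (rule eventually_in_unit_interval)
  ultimately show ?thesis
  proof eventually_elim
    case (elim \<epsilon>)
    then have "ln \<epsilon> < 0" by simp
    then have "s * ln \<epsilon> < ln (h \<epsilon>)" using elim by (simp add: neg_divide_less_eq)
    moreover have "h \<epsilon> > 0" using h elim by (simp add: dimension_function_def)
    ultimately have "exp (s * ln \<epsilon>) < h \<epsilon>" by (metis exp_less_cancel_iff exp_ln)
    then show ?case using elim by (simp add: powr_def)
  qed
qed

text \<open>Makes the cases of zero and positive limsup exhaustive, as the last claim
  requires.\<close>

lemma Limsup_log_ratio_nonneg:
  assumes h: "dimension_function h"
  shows "Limsup (at_right 0) (\<lambda>\<epsilon>. ereal (ln (h \<epsilon>) / ln \<epsilon>)) \<ge> 0"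
proof -
  have "(h \<longlongrightarrow> 0) (at_right 0)" using h by (simp add: dimension_function_def)
  then have "eventually (\<lambda>\<epsilon>. h \<epsilon> < 1) (at_right 0)" by (rule order_tendstoD(2)) simp
  moreover have "eventually (\<lambda>\<epsilon>. (\<epsilon>::real) < 1 \<and> 0 < \<epsilon>) (at_right 0)"
    by (rule eventually_in_unit_interval)
  ultimately have "eventually (\<lambda>\<epsilon>. 0 \<le> ereal (ln (h \<epsilon>) / ln \<epsilon>)) (at_right 0)"
  proof eventually_elim
    case (elim \<epsilon>)
    moreover have "h \<epsilon> > 0" using h elim by (simp add: dimension_function_def)
    ultimately show ?case by (simp add: divide_nonpos_nonpos)
  qed
  then have "Limsup (at_right (0::real)) (\<lambda>_. 0 :: ereal) \<le> Limsup (at_right 0) (\<lambda>\<epsilon>. ereal (ln (h \<epsilon>) / ln \<epsilon>))"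
    by (rule Limsup_mono)
  then show ?thesis by (simp add: Limsup_const)
qed

section \<open>Lower bounds for Hausdorff measure\<close>

text \<open>The binary digit of weight \<open>2 ^ -(i + 1)\<close>.\<close>

definition bit_of :: "real \<Rightarrow> nat \<Rightarrow> bool" where
  "bit_of y i = odd \<lfloor>2 ^ Suc i * y\<rfloor>"

lemma floor_eq_of_bits_eq:
  assumes "y \<in> {0..<1}" "z \<in> {0..<1}" "\<And>i. i < k \<Longrightarrow> bit_of y i = bit_of z i"
  shows "\<lfloor>2 ^ k * y\<rfloor> = \<lfloor>2 ^ k * z\<rfloor>"
  using assms(3)
proof (induction k)
  case 0
  have "\<lfloor>y\<rfloor> = 0" "\<lfloor>z\<rfloor> = 0" using assms(1,2) by (auto simp: floor_eq_iff)
  then show ?case by simp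
next
  case (Suc k)
  have dbl: "\<lfloor>2 ^ Suc k * x\<rfloor> = 2 * \<lfloor>2 ^ k * x\<rfloor> + (if bit_of x k then 1 else 0)" for x :: real
  proof -
    have "2 * \<lfloor>2 ^ k * x\<rfloor> \<le> \<lfloor>2 ^ Suc k * x\<rfloor>" "\<lfloor>2 ^ Suc k * x\<rfloor> \<le> 2 * \<lfloor>2 ^ k * x\<rfloor> + 1"
      by (simp_all add: mult.assoc) linarith+
    then have "\<lfloor>2 ^ Suc k * x\<rfloor> = 2 * \<lfloor>2 ^ k * x\<rfloor> \<or> \<lfloor>2 ^ Suc k * x\<rfloor> = 2 * \<lfloor>2 ^ k * x\<rfloor> + 1"
      by linarith
    moreover have "m = 2 * n \<or> m = 2 * n + 1 \<Longrightarrow> m = 2 * n + (if odd m then 1 else 0)" for m n :: int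
      by auto
    ultimately show ?thesis unfolding bit_of_def by blast
  qed
  have "\<lfloor>2 ^ k * y\<rfloor> = \<lfloor>2 ^ k * z\<rfloor>" "bit_of y k = bit_of z k" using Suc by simp_all
  then show ?case unfolding dbl by simp
qed

lemma dyadic_interval:
  assumes "y \<in> {0..<1}" "z \<in> {0..<1}" "\<And>i. i < k \<Longrightarrow> bit_of y i = bit_of z i"
  shows "z \<in> {\<lfloor>2 ^ k * y\<rfloor> / 2 ^ k .. \<lfloor>2 ^ k * y\<rfloor> / 2 ^ k + (1/2) ^ k}"
proof -
  have "\<lfloor>2 ^ k * y\<rfloor> = \<lfloor>2 ^ k * z\<rfloor>" by (rule floor_eq_of_bits_eq[OF assms])
  then have "of_int \<lfloor>2 ^ k * y\<rfloor> \<le> 2 ^ k * z" "2 ^ k * z \<le> of_int \<lfloor>2 ^ k * y\<rfloor> + 1" by linarith+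
  then show ?thesis by (simp add: field_simps power_one_over)
qed

text \<open>A mass distribution principle. If the points coded into \<open>U j\<close> first split
  at bit \<open>k\<close>, they lie in a dyadic interval of length \<open>2 ^ -k\<close>, while
  \<open>U j\<close> has diameter at least \<open>\<rho> k\<close>. By \<open>thin\<close> the
  length is at most \<open>\<eta> * h (diameter (U j))\<close>, and these terms sum to at most
  \<open>\<eta> * (H + 1) = e / 2\<close>.\<close>

lemma finite_hausdorff_negligible:
  fixes X :: "real \<Rightarrow> real"
  assumes h: "dimension_function h" and \<rho>: "\<And>k. \<rho> k > 0"
    and sep: "\<And>y z k. y \<in> {0..<1} \<Longrightarrow> z \<in> {0..<1} \<Longrightarrow> (\<And>i. i < k \<Longrightarrow> bit_of y i = bit_of z i) \<Longrightarrow>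
      bit_of y k \<noteq> bit_of z k \<Longrightarrow> \<rho> k \<le> \<bar>X y - X z\<bar>"
    and thin: "\<And>\<eta>. \<eta> > 0 \<Longrightarrow> eventually (\<lambda>k. (1/2) ^ k \<le> \<eta> * h (\<rho> k)) sequentially"
    and A: "hausdorff_measure h A < \<infinity>"
  shows "negligible {y \<in> {0..<1}. X y \<in> A}"
  unfolding negligible_outer_le
proof (intro allI impI)
  fix e :: real assume e: "e > 0"
  obtain H where H: "hausdorff_measure h A = ennreal H" "H \<ge> 0"
    using A by (metis ennreal_cases infinity_ennreal_def less_irrefl)
  define \<eta> where "\<eta> = e / (2 * (H + 1))"
  have \<eta>: "\<eta> > 0" using e H by (simp add: \<eta>_def)
  obtain K where K: "\<And>k. k \<ge> K \<Longrightarrow> (1/2) ^ k \<le> \<eta> * h (\<rho> k)"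
    using thin[OF \<eta>] unfolding eventually_at_top_linorder by blast
  \<comment> \<open>Sets of smaller diameter cannot contain the images of two points that split
    before level \<open>K\<close>.\<close>
  define \<delta> where "\<delta> = Min (insert 1 (\<rho> ` {..<K}))"
  have \<delta>: "\<delta> > 0" "\<And>k. k < K \<Longrightarrow> \<delta> \<le> \<rho> k" unfolding \<delta>_def using \<rho> by auto
  have "hausdorff_premeasure h \<delta> A \<le> ennreal H"
    unfolding H(1)[symmetric] hausdorff_measure_eq_SUP by (rule SUP_upper) (use \<delta> in simp)
  also have "\<dots> < ennreal (H + 1)" using H(2) by (simp add: ennreal_less_iff)
  finally obtain U where U: "U \<in> delta_covers \<delta> A" "(\<Sum>j. ennreal (h (diameter (U j)))) < ennreal (H + 1)"
    unfolding hausdorff_premeasure_def INF_less_iff by blast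
  have h0: "0 \<le> h (diameter (U j))" for j
  proof -
    have "0 \<le> diameter (U j)" using U(1) unfolding delta_covers_def by (intro diameter_ge_0) auto
    then show ?thesis using h unfolding dimension_function_def by (cases "diameter (U j) = 0") (auto intro: less_imp_le)
  qed
  \<comment> \<open>The first summand pays for preimages of at most one point, where
    \<open>h (diameter (U j))\<close> may vanish.\<close>
  define w where "w j = (e/2) * (1/2) ^ Suc j + \<eta> * h (diameter (U j))" for j
  have w0: "0 \<le> w j" for j unfolding w_def using e \<eta> h0[of j] by simp
  have "\<exists>a. {y \<in> {0..<1}. X y \<in> U j} \<subseteq> {a..a + w j}" for j
  proof (cases "\<exists>y\<in>{y \<in> {0..<1}. X y \<in> U j}. \<exists>z\<in>{y \<in> {0..<1}. X y \<in> U j}. \<exists>k. bit_of y k \<noteq> bit_of z k")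
    case False
    show ?thesis
    proof (cases "{y \<in> {0..<1}. X y \<in> U j} = {}")
      case False': False
      then obtain y where y: "y \<in> {0..<1}" "X y \<in> U j" by blast
      have "0 < (e/2) * (1/2) ^ Suc j" using e by simp
      then obtain k where k: "(1/2) ^ k < (e/2) * (1/2) ^ Suc j"
        using real_arch_pow_inv[of _ "1/2"] by (metis half_gt_zero_iff less_numeral_extra(1) one_less_numeral_iff semiring_norm(76) divide_less_eq_1_pos zero_less_numeral)
      also have "\<dots> \<le> w j" unfolding w_def using \<eta> h0[of j] by simp
      finally have "(1/2) ^ k \<le> w j" by simp
      have "z \<in> {\<lfloor>2 ^ k * y\<rfloor> / 2 ^ k .. \<lfloor>2 ^ k * y\<rfloor> / 2 ^ k + (1/2) ^ k}" if "z \<in> {0..<1}" "X z \<in> U j" for z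
        by (rule dyadic_interval[OF y(1) that(1)]) (use False y that in blast)
      then show ?thesis using \<open>(1/2) ^ k \<le> w j\<close>
        by (intro exI[of _ "\<lfloor>2 ^ k * y\<rfloor> / 2 ^ k"]) fastforce
    qed auto
  next
    case True
    define P where "P k \<longleftrightarrow> (\<exists>y\<in>{y \<in> {0..<1}. X y \<in> U j}. \<exists>z\<in>{y \<in> {0..<1}. X y \<in> U j}. bit_of y k \<noteq> bit_of z k)" for k
    define k where "k = (LEAST k. P k)"
    have "\<exists>k. P k" using True unfolding P_def by blast
    then have "P k" unfolding k_def by (rule LeastI_ex)
    then obtain y z where yz: "y \<in> {0..<1}" "X y \<in> U j" "z \<in> {0..<1}" "X z \<in> U j" "bit_of y k \<noteq> bit_of z k"
      unfolding P_def by blast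
    have agree: "bit_of u i = bit_of v i" if "i < k" "u \<in> {0..<1}" "X u \<in> U j" "v \<in> {0..<1}" "X v \<in> U j" for u v i
    proof -
      have "\<not> P i" using not_less_Least[of i P] that(1) by (simp add: k_def)
      then show ?thesis using that unfolding P_def by blast
    qed
    have "\<rho> k \<le> \<bar>X y - X z\<bar>" by (rule sep[OF yz(1,3) agree yz(5)]) (use yz in auto)
    also have "\<dots> \<le> diameter (U j)"
      using diameter_bounded_bound[of "U j" "X y" "X z"] U(1) yz unfolding delta_covers_def by (auto simp: dist_real_def)
    finally have \<rho>d: "\<rho> k \<le> diameter (U j)" .
    have "k \<ge> K"
    proof (rule ccontr)
      assume "\<not> k \<ge> K"
      then have "\<delta> \<le> diameter (U j)" using \<delta>(2)[of k] \<rho>d by linarith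
      moreover have "diameter (U j) < \<delta>" using U(1) unfolding delta_covers_def by blast
      ultimately show False by simp
    qed
    have "mono_on {0<..} h" using h by (simp add: dimension_function_def)
    then have "h (\<rho> k) \<le> h (diameter (U j))" using \<rho>d \<rho>[of k] by (auto simp: mono_on_def)
    then have "(1/2) ^ k \<le> \<eta> * h (diameter (U j))"
      using K[OF \<open>k \<ge> K\<close>] \<eta> mult_left_mono[of "h (\<rho> k)" "h (diameter (U j))" \<eta>] by linarith
    also have "\<dots> \<le> w j" unfolding w_def using e by simp
    finally have kw: "(1/2) ^ k \<le> w j" .
    have "v \<in> {\<lfloor>2 ^ k * y\<rfloor> / 2 ^ k .. \<lfloor>2 ^ k * y\<rfloor> / 2 ^ k + (1/2) ^ k}" if "v \<in> {0..<1}" "X v \<in> U j" for v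
      by (rule dyadic_interval[OF yz(1) that(1)]) (use agree yz that in blast)
    then show ?thesis using kw by (intro exI[of _ "\<lfloor>2 ^ k * y\<rfloor> / 2 ^ k"]) fastforce
  qed
  then obtain a where a: "\<And>j. {y \<in> {0..<1}. X y \<in> U j} \<subseteq> {a j..a j + w j}" by metis
  define T where "T = (\<Union>j. {a j..a j + w j})"
  have "{y \<in> {0..<1}. X y \<in> A} \<subseteq> T"
  proof
    fix y assume y: "y \<in> {y \<in> {0..<1}. X y \<in> A}"
    then obtain j where "X y \<in> U j" using U(1) unfolding delta_covers_def by blast
    then show "y \<in> T" using y a[of j] unfolding T_def by blast
  qed
  moreover have T: "emeasure lebesgue T \<le> ennreal e"
  proof -
    have "emeasure lebesgue T \<le> (\<Sum>j. emeasure lebesgue {a j..a j + w j})"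
      unfolding T_def by (rule emeasure_subadditive_countably) auto
    also have "\<dots> = (\<Sum>j. ennreal ((e/2) * (1/2) ^ Suc j) + ennreal \<eta> * ennreal (h (diameter (U j))))"
      using w0 e \<eta> h0 by (simp add: w_def ennreal_plus ennreal_mult)
    also have "\<dots> = (\<Sum>j. ennreal ((e/2) * (1/2) ^ Suc j)) + (\<Sum>j. ennreal \<eta> * ennreal (h (diameter (U j))))"
      by (rule suminf_add[symmetric]) auto
    also have "(\<Sum>j. ennreal ((e/2) * (1/2) ^ Suc j)) = ennreal (e/2)"
    proof (rule sums_unique[symmetric], subst sums_ennreal)
      show "(\<lambda>n. e / 2 * (1/2) ^ Suc n) sums (e/2)"
        using sums_mult[OF power_half_series, of "e/2"] by simp
    qed (use e in auto)
    also have "(\<Sum>j. ennreal \<eta> * ennreal (h (diameter (U j)))) = ennreal \<eta> * (\<Sum>j. ennreal (h (diameter (U j))))"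
      by (rule ennreal_suminf_cmult)
    also have "ennreal (e/2) + ennreal \<eta> * (\<Sum>j. ennreal (h (diameter (U j)))) \<le> ennreal (e/2) + ennreal \<eta> * ennreal (H + 1)"
      using U(2) by (intro add_left_mono mult_left_mono) auto
    also have "\<dots> = ennreal (e/2 + \<eta> * (H + 1))"
      using e \<eta> H(2) by (simp add: ennreal_plus ennreal_mult)
    also have "e/2 + \<eta> * (H + 1) = e" unfolding \<eta>_def using H(2) by (simp add: field_simps)
    finally show ?thesis .
  qed
  moreover have "T \<in> sets lebesgue" unfolding T_def by (intro sets.countable_UN) auto
  then have "T \<in> lmeasurable"
    using T by (intro fmeasurableI) (auto intro: le_less_trans)
  moreover have "measure lebesgue T \<le> e"
    using T e unfolding measure_def by (metis enn2real_leI less_imp_le)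
  ultimately show "\<exists>T. {y \<in> {0..<1}. X y \<in> A} \<subseteq> T \<and> T \<in> lmeasurable \<and> measure lebesgue T \<le> e" by blast
qed

section \<open>A Cantor set of attainable numbers\<close>

text \<open>\<open>g i\<close> is the distance of consecutive pairs before displacement. Evenness
  makes the runs of 1 even, the limit forces \<open>cf_lambda\<close> down to 3, and the jumps make
  it reach 3 infinitely often. Distances of 8 keep displaced pairs at least 6 apart.\<close>

locale sparse_centers =
  fixes g :: "nat \<Rightarrow> nat"
  assumes g_even: "even (g i)" and g_ge: "g i \<ge> 8" and g_lim: "filterlim g at_top sequentially"
    and g_jump: "infinite {i. g (Suc i) \<ge> g i + 8}"
begin

definition center :: "nat \<Rightarrow> nat" where
  "center k = (\<Sum>i<k. g i)"

text \<open>A displacement by two, not one, preserves the parity of the runs.\<close>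

definition pair_pos :: "(nat \<Rightarrow> bool) \<Rightarrow> nat \<Rightarrow> nat" where
  "pair_pos b i = center i + (if b i then 2 else 0)"

definition digits :: "(nat \<Rightarrow> bool) \<Rightarrow> nat \<Rightarrow> nat" where
  "digits b n = (if \<exists>i. n = pair_pos b i \<or> n = Suc (pair_pos b i) then 2 else 1)"

lemma center_Suc: "center (Suc k) = center k + g k"
  by (simp add: center_def)

lemma center_mono: "i \<le> j \<Longrightarrow> center i \<le> center j"
  unfolding center_def by (rule sum_mono2) auto

lemma pair_pos_Suc: "pair_pos b (Suc i) + (if b i then 2 else 0) = pair_pos b i + g i + (if b (Suc i) then 2 else 0)"
  by (simp add: pair_pos_def center_Suc)

lemma pair_pos_gap: "pair_pos b i + g i \<le> pair_pos b (Suc i) + 2"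
  using pair_pos_Suc[of b i] by (simp split: if_splits)

lemma pair_pos_step: "pair_pos b i + 6 \<le> pair_pos b (Suc i)"
  using pair_pos_gap[of b i] g_ge[of i] by linarith

lemma pair_pos_mono: "i \<le> j \<Longrightarrow> pair_pos b i \<le> pair_pos b j"
proof (rule lift_Suc_mono_le[of "pair_pos b"])
  show "pair_pos b n \<le> pair_pos b (Suc n)" for n using pair_pos_step[of b n] by linarith
qed

lemma digits_pair: "digits b (pair_pos b i) = 2" "digits b (Suc (pair_pos b i)) = 2"
  unfolding digits_def by auto

lemma digits_between:
  assumes "pair_pos b i + 2 \<le> n" "n < pair_pos b (Suc i)"
  shows "digits b n = 1"
proof -
  have "\<not> (n = pair_pos b j \<or> n = Suc (pair_pos b j))" for j
  proof (cases "j \<le> i")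
    case True
    then show ?thesis using pair_pos_mono[OF True, of b] assms by linarith
  next
    case False
    then have "pair_pos b (Suc i) \<le> pair_pos b j" by (intro pair_pos_mono) simp
    then show ?thesis using assms by linarith
  qed
  then show ?thesis unfolding digits_def by simp
qed

lemma digits_1_2: "digits b n = 1 \<or> digits b n = 2"
  by (simp add: digits_def)

lemma digits_pos: "digits b n \<ge> 1"
  by (simp add: digits_def)

text \<open>Pair \<open>i\<close> never lies to the left of \<open>center i\<close>, so later bits
  do not act there.\<close>

lemma digits_agree:
  assumes "\<And>i. i < k \<Longrightarrow> b i = b' i" "n < center k"
  shows "digits b n = digits b' n"
proof -
  have "\<exists>i. n = pair_pos b' i \<or> n = Suc (pair_pos b' i)"
    if ex: "\<exists>i. n = pair_pos b i \<or> n = Suc (pair_pos b i)" and eq: "\<And>i. i < k \<Longrightarrow> b i = b' i" for b b'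
  proof -
    obtain i where i: "n = pair_pos b i \<or> n = Suc (pair_pos b i)" using ex by blast
    have "center i \<le> n" using i by (auto simp: pair_pos_def)
    then have "\<not> k \<le> i" using center_mono[of k i] assms(2) by linarith
    then have "pair_pos b i = pair_pos b' i" using eq[of i] by (simp add: pair_pos_def)
    then show ?thesis using i by metis
  qed
  from this[of b b'] this[of b' b] assms(1) show ?thesis unfolding digits_def by metis
qed

text \<open>The digit at \<open>center k\<close> reveals bit \<open>k\<close>, because a displaced
  pair leaves a 1 there.\<close>

lemma digits_at_center:
  assumes "\<not> b k" "b' k"
  shows "digits b (center k) = 2" "digits b' (center k) = 1"
proof -
  have "pair_pos b k = center k" using assms by (simp add: pair_pos_def)
  then show "digits b (center k) = 2" using digits_pair(1)[of b k] by simp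
  have p: "pair_pos b' k = center k + 2" using assms by (simp add: pair_pos_def)
  have "\<not> (center k = pair_pos b' j \<or> center k = Suc (pair_pos b' j))" for j
  proof (cases "j < k")
    case True
    then have "pair_pos b' (Suc j) \<le> pair_pos b' k" by (intro pair_pos_mono) simp
    then show ?thesis using pair_pos_step[of b' j] p by linarith
  next
    case False
    then have "pair_pos b' k \<le> pair_pos b' j" by (intro pair_pos_mono) simp
    then show ?thesis using p by linarith
  qed
  then show "digits b' (center k) = 1" unfolding digits_def by simp
qed

section \<open>Approximation quality of the coded numbers\<close>

context
  fixes b :: "nat \<Rightarrow> bool" and t :: "nat \<Rightarrow> real"
  assumes cf: "cf_expansion (digits b) t"
begin

abbreviation "d \<equiv> digits b"

lemma tail_bounds: "1/3 \<le> t n" "t n \<le> 3/4"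
  using cf_tail_bounds[OF cf digits_1_2 digits_1_2] by auto

lemma past_bounds: "n \<ge> 2 \<Longrightarrow> 1/3 \<le> cf_past d n \<and> cf_past d n \<le> 3/4"
  using cf_past_bounds_digits[OF cf digits_1_2 digits_1_2, of "n - 2"] by (simp only: le_add_diff_inverse2)

lemma ones_values:
  assumes "\<And>i. n \<le> i \<Longrightarrow> i < n + q \<Longrightarrow> d i = 1"
  shows "t n = cf_value (replicate q 1) (t (n + q))"
    "cf_past d (n + q) = cf_value (replicate q 1) (cf_past d n)"
proof -
  have "map d [n..<n + q] = replicate q 1" using assms by (intro replicate_eqI) auto
  then show "t n = cf_value (replicate q 1) (t (n + q))"
    "cf_past d (n + q) = cf_value (replicate q 1) (cf_past d n)"
    using cf_tail_value[OF cf, of n q] cf_past_value[OF cf, of n q] by simp_all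
qed

lemma past_tail_close:
  assumes past: "\<And>i. m \<le> i \<Longrightarrow> i < m + q \<Longrightarrow> d i = 1" and m: "m \<ge> 2"
    and future: "\<And>i. n \<le> i \<Longrightarrow> i < n + q \<Longrightarrow> d i = 1"
  shows "\<bar>cf_past d (m + q) - t n\<bar> \<le> (9/16) ^ q"
proof -
  have ab: "1/3 \<le> cf_past d m" "cf_past d m \<le> 1" "1/3 \<le> t (n + q)" "t (n + q) \<le> 1"
    using past_bounds[OF m] tail_bounds[of "n + q"] by auto
  have "\<bar>cf_value (replicate q 1) (cf_past d m) - cf_value (replicate q 1) (t (n + q))\<bar>
      \<le> (9/16) ^ length (replicate q (1::nat)) * \<bar>cf_past d m - t (n + q)\<bar>"
    using cf_value_contract[of "replicate q 1" "cf_past d m" "t (n + q)"] ab by auto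
  also have "\<dots> \<le> (9/16) ^ q * 1" using ab by (intro mult_mono) auto
  finally show ?thesis using ones_values(2)[OF past] ones_values(1)[OF future] by simp
qed

lemma reciprocal_close:
  fixes u v :: real
  assumes "0 \<le> u" "0 \<le> v" "\<bar>u - v\<bar> \<le> e"
  shows "1 / (2 + u) - 1 / (2 + v) \<le> e"
proof -
  have "1 / (2 + u) - 1 / (2 + v) = (v - u) / ((2 + u) * (2 + v))"
    using reciprocal_diff[of 2 u v] assms by simp
  also have "\<dots> \<le> \<bar>u - v\<bar> / ((2 + u) * (2 + v))" using assms by (intro divide_right_mono) auto
  also have "\<dots> \<le> \<bar>u - v\<bar> / 1"
  proof (rule divide_left_mono)
    have "1 * 1 \<le> (2 + u) * (2 + v)" using assms by (intro mult_mono) auto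
    then show "1 \<le> (2 + u) * (2 + v)" by simp
  qed (use assms in \<open>auto intro!: mult_pos_pos\<close>)
  finally show ?thesis using assms by simp
qed

lemma lambda_at_ones:
  assumes "n \<ge> 2" "d n = 1" shows "cf_lambda d t n \<le> 3"
  using past_bounds[OF assms(1)] tail_bounds(2)[of "Suc n"] assms(2) unfolding cf_lambda_def by simp

text \<open>At the second 2 the identity for \<open>2211\<close> applies, at the first 2 its mirror
  image. Both sides of the comparison start with \<open>q\<close> ones and so agree up to
  \<open>(9/16) ^ q\<close>. The surplus 10 covers the displacement, the pair and the two ones
  consumed by the identity.\<close>

lemma lambda_at_pair:
  assumes g: "g i \<ge> q + 10" "g (Suc i) \<ge> q + 10"
  shows "cf_lambda d t (pair_pos b (Suc i)) \<le> 3 + (9/16) ^ q"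
    "cf_lambda d t (Suc (pair_pos b (Suc i))) \<le> 3 + (9/16) ^ q"
proof -
  define e where "e = pair_pos b (Suc i)"
  have e: "pair_pos b i + q + 8 \<le> e" "e + q + 8 \<le> pair_pos b (Suc (Suc i))"
    using pair_pos_gap[of b i] pair_pos_gap[of b "Suc i"] g unfolding e_def by linarith+
  have before: "d n = 1" if "pair_pos b i + 2 \<le> n" "n < e" for n
    using digits_between that unfolding e_def by blast
  have after: "d n = 1" if "e + 2 \<le> n" "n < e + q + 8" for n
    using digits_between[of b "Suc i" n] that e(2) unfolding e_def by simp
  have de: "d e = 2" "d (e + 1) = 2" using digits_pair[of b "Suc i"] unfolding e_def by simp_all
  define m where "m = e - q"
  have m: "e = m + q" "pair_pos b i + 8 \<le> m" using e(1) by (auto simp: m_def)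
  have "\<bar>cf_past d (m + q) - t (e + 4)\<bar> \<le> (9/16) ^ q"
    by (rule past_tail_close) (use m before after in auto)
  then have "1 / (2 + cf_past d e) - 1 / (2 + t (e + 4)) \<le> (9/16) ^ q"
    using cf_past_bounds[OF cf, of e] tail_bounds[of "e + 4"] m(1) by (intro reciprocal_close) auto
  moreover have "cf_lambda d t (e + 1) = 3 + 1 / (2 + cf_past d e) - 1 / (2 + t (e + 4))"
    by (rule lambda_22_11[OF cf]) (use de after in auto)
  ultimately show "cf_lambda d t (Suc (pair_pos b (Suc i))) \<le> 3 + (9/16) ^ q" unfolding e_def by simp
  define k where "k = e - 2 - q"
  have k: "e = k + q + 2" "pair_pos b i + 6 \<le> k" using e(1) by (auto simp: k_def)
  have "\<bar>cf_past d (k + q) - t (e + 2)\<bar> \<le> (9/16) ^ q"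
    by (rule past_tail_close) (use k before after in auto)
  then have close: "1 / (2 + t (e + 2)) - 1 / (2 + cf_past d (k + q)) \<le> (9/16) ^ q"
    using cf_past_bounds[OF cf, of "k + q"] tail_bounds[of "e + 2"]
    by (intro reciprocal_close) (auto simp: abs_minus_commute)
  have e2: "e + 2 = k + q + 4" using k(1) by simp
  have "d (k + q + 2) = 2" "d (k + q + 3) = 2" using de unfolding k(1) by (simp_all add: numeral_eq_Suc)
  then have "cf_lambda d t (k + q + 2) = 3 + 1 / (2 + t (k + q + 4)) - 1 / (2 + cf_past d (k + q))"
    by (intro lambda_11_22[OF cf]) (use before k in auto)
  then show "cf_lambda d t (pair_pos b (Suc i)) \<le> 3 + (9/16) ^ q"
    using close unfolding e_def[symmetric] e2 unfolding k(1) by linarith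
qed

lemma lambda_limsup:
  assumes c: "c > 3"
  shows "finite {n. cf_lambda d t n > c}"
proof -
  obtain q where q: "(9/16::real) ^ q < c - 3"
    using real_arch_pow_inv[of "c - 3" "9/16"] c by auto
  obtain I where I: "\<And>i. i \<ge> I \<Longrightarrow> g i \<ge> q + 10"
    using g_lim unfolding filterlim_at_top eventually_at_top_linorder by blast
  have "cf_lambda d t n \<le> c" if n: "n > pair_pos b I + 2" for n
  proof (cases "d n = 1")
    case True
    then show ?thesis using lambda_at_ones[of n] n c by simp
  next
    case False
    then obtain j where j: "n = pair_pos b j \<or> n = Suc (pair_pos b j)" unfolding digits_def by (auto split: if_splits)
    have "\<not> j \<le> I" using pair_pos_mono[of j I b] j n by linarith
    then obtain i where i: "j = Suc i" "i \<ge> I" by (cases j) auto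
    then show ?thesis using lambda_at_pair[of q i] I[of i] I[of "Suc i"] j q by fastforce
  qed
  then have "{n. cf_lambda d t n > c} \<subseteq> {..pair_pos b I + 2}" by (auto simp: not_le[symmetric])
  then show ?thesis using finite_subset by blast
qed

text \<open>After \<open>q\<close> common ones the past meets a 2 and the future still a 1, so the
  past is smaller there. As \<open>q\<close> is even, the order survives the ones, and the identity
  at the second 2 gives at least 3.\<close>

lemma lambda_jump:
  assumes jump: "g (Suc i) \<ge> g i + 8"
  shows "cf_lambda d t (Suc (pair_pos b (Suc i))) \<ge> 3"
proof -
  define e where "e = pair_pos b (Suc i)"
  define m where "m = pair_pos b i + 2"
  define q where "q = e - m"
  have me: "m + 4 \<le> e" using pair_pos_step[of b i] by (simp add: e_def m_def)
  then have e: "e = m + q" by (simp add: q_def)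
  \<comment> \<open>Displacing the three pairs changes the difference of the two distances by at
    most 4, so a jump of 8 leaves the second run at least 4 longer.\<close>
  have long: "e + 2 + q + 4 \<le> pair_pos b (Suc (Suc i))"
    using pair_pos_Suc[of b i] pair_pos_Suc[of b "Suc i"] jump me
    unfolding q_def e_def m_def by (simp split: if_splits)
  have "even q"
  proof -
    have "even (pair_pos b j)" for j
      unfolding pair_pos_def center_def using g_even by (auto intro!: dvd_sum)
    then show ?thesis using me unfolding q_def e_def m_def by simp
  qed
  have before: "d n = 1" if "m \<le> n" "n < m + q" for n
    using digits_between[of b i n] that e unfolding e_def m_def by simp
  have after: "d n = 1" if "e + 2 \<le> n" "n < e + 2 + q + 4" for n
    using digits_between[of b "Suc i" n] that long unfolding e_def by simp
  have de: "d e = 2" "d (e + 1) = 2" using digits_pair[of b "Suc i"] unfolding e_def by simp_all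
  let ?A = "cf_past d m" and ?B = "t (e + 4 + q)"
  have eqA: "?A = 1 / (2 + cf_past d (Suc (pair_pos b i)))"
    using cf_past_Suc[OF cf, of "Suc (pair_pos b i)"] digits_pair(2)[of b i] unfolding m_def by simp
  have A: "0 \<le> ?A" "?A \<le> 1/2"
    unfolding eqA using cf_past_bounds[OF cf, of "Suc (pair_pos b i)"] by (simp_all add: field_simps)
  have "d (e + 4 + q) = 1" using after[of "e + 4 + q"] by simp
  then have eqB: "?B = 1 / (1 + t (Suc (e + 4 + q)))" using cf_tail_rec[OF cf, of "e + 4 + q"] by simp
  have B: "1/2 \<le> ?B" "?B \<le> 1"
    unfolding eqB using cf_tail_pos[OF cf, of "Suc (e + 4 + q)"] cf_tail_less_1[OF cf, of "Suc (e + 4 + q)"]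
    by (simp_all add: field_simps)
  have "0 \<le> (?B - ?A) / 9 ^ length (replicate q (1::nat))" using A B by simp
  also have "\<dots> \<le> (-1) ^ length (replicate q (1::nat)) * (cf_value (replicate q 1) ?B - cf_value (replicate q 1) ?A)"
    by (rule cf_value_gap) (use A B in auto)
  also have "\<dots> = t (e + 4) - cf_past d e"
    using ones_values(1)[of "e + 4" q] ones_values(2)[of m q] before after e \<open>even q\<close> by simp
  finally have "cf_past d e \<le> t (e + 4)" by simp
  then have "1 / (2 + t (e + 4)) \<le> 1 / (2 + cf_past d e)"
    using cf_past_bounds[OF cf, of e] by (intro divide_left_mono) (auto intro!: mult_pos_pos)
  moreover have "cf_lambda d t (e + 1) = 3 + 1 / (2 + cf_past d e) - 1 / (2 + t (e + 4))"
    by (rule lambda_22_11[OF cf]) (use de after in auto)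
  ultimately show ?thesis unfolding e_def by simp
qed

lemma coded_attainable: "t 0 \<in> attainable_3"
proof (rule attainable_3_cf[OF cf])
  have "strict_mono (\<lambda>i. Suc (pair_pos b (Suc i)))"
    unfolding strict_mono_Suc_iff using pair_pos_step[of b] by (metis Suc_less_eq add_leD1 less_add_same_cancel1 linorder_not_less order.strict_trans1 zero_less_numeral)
  then have "inj (\<lambda>i. Suc (pair_pos b (Suc i)))" by (rule strict_mono_imp_inj_on)
  then have "infinite ((\<lambda>i. Suc (pair_pos b (Suc i))) ` {i. g (Suc i) \<ge> g i + 8})"
    using g_jump by (meson finite_imageD inj_on_subset subset_UNIV)
  moreover have "(\<lambda>i. Suc (pair_pos b (Suc i))) ` {i. g (Suc i) \<ge> g i + 8} \<subseteq> {n. cf_lambda d t n \<ge> 3}"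
    using lambda_jump by auto
  ultimately show "infinite {n. cf_lambda d t n \<ge> 3}" using infinite_super by blast
qed (rule lambda_limsup)

end

text \<open>The first different bit shows after \<open>center k\<close> common digits. There the
  tails are at most \<open>3/7\<close> and at least \<open>4/7\<close>, and each common digit
  divides the gap by at most 9.\<close>

lemma coded_separation:
  assumes cf: "cf_expansion (digits b) t" "cf_expansion (digits b') t'"
    and agree: "\<And>i. i < k \<Longrightarrow> b i = b' i" and diff: "b k \<noteq> b' k"
  shows "(1/7) / 9 ^ center k \<le> \<bar>t 0 - t' 0\<bar>"
proof -
  have main: "(1/7) / 9 ^ center k \<le> \<bar>t 0 - t' 0\<bar>"
    if cf: "cf_expansion (digits b) t" "cf_expansion (digits b') t'"
      and agree: "\<And>i. i < k \<Longrightarrow> b i = b' i" and diff: "\<not> b k" "b' k" for b b' t t'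
  proof -
    let ?n = "center k"
    define w where "w = map (digits b) [0..<?n]"
    have w': "map (digits b') [0..<?n] = w"
      unfolding w_def using digits_agree[of k b b'] agree by auto
    have lw: "length w = ?n" by (simp add: w_def)
    have t: "t 0 = cf_value w (t ?n)" using cf_tail_value[OF cf(1), of 0 ?n] by (simp add: w_def)
    have t': "t' 0 = cf_value w (t' ?n)" using cf_tail_value[OF cf(2), of 0 ?n] w' by simp
    have r: "t ?n = 1 / (2 + t (Suc ?n))" "t' ?n = 1 / (1 + t' (Suc ?n))"
      using cf_tail_rec[OF cf(1), of ?n] cf_tail_rec[OF cf(2), of ?n] digits_at_center[of b k b', OF diff] by simp_all
    have "t ?n \<le> 3/7" unfolding r using tail_bounds(1)[OF cf(1), of "Suc ?n"] by (simp add: field_simps)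
    moreover have "4/7 \<le> t' ?n" unfolding r using tail_bounds[OF cf(2), of "Suc ?n"] by (simp add: field_simps)
    ultimately have gap: "1/7 \<le> t' ?n - t ?n" by linarith
    have "(1/7) / 9 ^ ?n \<le> (t' ?n - t ?n) / 9 ^ length w"
      unfolding lw using gap by (intro divide_right_mono) auto
    also have "\<dots> \<le> (-1) ^ length w * (cf_value w (t' ?n) - cf_value w (t ?n))"
    proof (rule cf_value_gap)
      show "\<forall>c\<in>set w. c = 1 \<or> c = 2" using digits_1_2 by (auto simp: w_def)
    qed (use gap cf_tail_pos[OF cf(1)] cf_tail_pos[OF cf(2)] cf_tail_less_1[OF cf(1)] cf_tail_less_1[OF cf(2)]
        in \<open>auto intro: less_imp_le\<close>)
    also have "\<dots> \<le> \<bar>(-1) ^ length w * (cf_value w (t' ?n) - cf_value w (t ?n))\<bar>" by (rule abs_ge_self)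
    also have "\<dots> = \<bar>t 0 - t' 0\<bar>" unfolding t t' by (simp add: abs_mult power_abs abs_minus_commute)
    finally show ?thesis .
  qed
  show ?thesis
  proof (cases "b k")
    case True
    then have "(1/7) / 9 ^ center k \<le> \<bar>t' 0 - t 0\<bar>"
      using diff agree by (intro main[OF cf(2,1)]) auto
    then show ?thesis by (simp add: abs_minus_commute)
  next
    case False
    then show ?thesis using diff agree by (intro main[OF cf]) auto
  qed
qed

end

section \<open>The dichotomy\<close>

text \<open>\<open>M k\<close> is the largest \<open>m <= k\<close> whose property holds from
  \<open>k\<close> onwards, or 0.\<close>

lemma diagonal_sequence:
  assumes P: "\<And>m. eventually (\<lambda>k. P m k) sequentially"
  shows "\<exists>M :: nat \<Rightarrow> nat. mono M \<and> filterlim M at_top sequentially \<and> eventually (\<lambda>k. P (M k) k) sequentially"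
proof -
  define S where "S k = {m. m \<le> k \<and> (m = 0 \<or> (\<forall>k'\<ge>k. P m k'))}" for k
  define M where "M k = Max (S k)" for k
  have fin: "finite (S k)" and ne: "S k \<noteq> {}" for k
  proof -
    show "finite (S k)" by (rule finite_subset[of _ "{..k}"]) (auto simp: S_def)
    have "0 \<in> S k" by (simp add: S_def)
    then show "S k \<noteq> {}" by blast
  qed
  have "S k \<subseteq> S k'" if "k \<le> k'" for k k' using that unfolding S_def by auto
  then have mono: "mono M" unfolding M_def using fin ne by (intro monoI Max_mono) auto
  have large: "M k \<ge> m" if K: "\<And>k'. k' \<ge> K \<Longrightarrow> P m k'" and k: "k \<ge> max m K" for m k K
  proof -
    have "m \<in> S k" using K k by (auto simp: S_def)
    then show ?thesis unfolding M_def by (rule Max_ge[OF fin])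
  qed
  have lim: "filterlim M at_top sequentially"
    unfolding filterlim_at_top
  proof
    fix m
    obtain K where "\<And>k'. k' \<ge> K \<Longrightarrow> P m k'" using P[of m] unfolding eventually_at_top_linorder by blast
    then show "eventually (\<lambda>k. m \<le> M k) sequentially"
      unfolding eventually_at_top_linorder using large[of K m] by blast
  qed
  then have "eventually (\<lambda>k. 1 \<le> M k) sequentially" unfolding filterlim_at_top by blast
  then have "eventually (\<lambda>k. P (M k) k) sequentially"
  proof eventually_elim
    case (elim k)
    have "M k \<in> S k" unfolding M_def by (rule Max_in[OF fin ne])
    then show ?case using elim by (auto simp: S_def)
  qed
  then show ?thesis using mono lim by blast
qed

text \<open>With \<open>s = 1 / (16 (m + 1))\<close> the power is
  \<open>16 ^ (-(k+1)/16) = 2 ^ (-(k+1)/4)\<close>, at least \<open>2 ^ (-k/2)\<close> for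
  \<open>k >= 1\<close>. Base 16 is chosen because \<open>(1/16) ^ (n+1)\<close> lies below
  \<open>(1/7) / 9 ^ n\<close>, the separation of codes.\<close>

lemma slow_dimension_function:
  assumes h: "dimension_function h" and zero: "Limsup (at_right 0) (\<lambda>\<epsilon>. ereal (ln (h \<epsilon>) / ln \<epsilon>)) = 0"
  shows "eventually (\<lambda>k. (1/2) powr (real k / 2) \<le> h ((1/16) ^ ((m + 1) * (k + 1)))) sequentially"
proof -
  define s where "s = 1 / (16 * real (m + 1))"
  define \<epsilon> :: "nat \<Rightarrow> real" where "\<epsilon> k = (1/16) ^ ((m + 1) * (k + 1))" for k
  have s: "s > 0" by (simp add: s_def)
  have "filterlim (\<lambda>k. (m + 1) * (k + 1)) at_top sequentially"
    by (rule filterlim_at_top_mono[OF filterlim_ident]) auto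
  then have "\<epsilon> \<longlonglongrightarrow> 0"
    unfolding \<epsilon>_def by (rule filterlim_compose[OF LIMSEQ_power_zero, rotated]) simp
  then have "filterlim \<epsilon> (at_right 0) sequentially"
    unfolding filterlim_at by (simp add: \<epsilon>_def)
  then have "eventually (\<lambda>k. \<epsilon> k powr s \<le> h (\<epsilon> k)) sequentially"
    using Limsup_log_ratio_zero[OF h zero s] by (rule eventually_compose_filterlim[rotated])
  moreover have "eventually (\<lambda>k. k \<ge> 1) sequentially" by (rule eventually_ge_at_top)
  ultimately show ?thesis
  proof eventually_elim
    case (elim k)
    have "\<epsilon> k powr s = (1/16) powr (real ((m + 1) * (k + 1)) * s)"
    proof -
      have "((1/16 :: real) ^ N) powr s = (1/16) powr (real N * s)" for N
        by (simp add: powr_realpow[symmetric] powr_powr)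
      then show ?thesis unfolding \<epsilon>_def .
    qed
    also have "real ((m + 1) * (k + 1)) * s = (real k + 1) / 16" unfolding s_def by (simp add: field_simps)
    also have "(1/16 :: real) powr ((real k + 1) / 16) = ((1/2) powr 4) powr ((real k + 1) / 16)"
      by (simp add: power_one_over)
    also have "\<dots> = (1/2) powr ((real k + 1) / 4)"
    proof -
      have "4 * ((real k + 1) / 16) = (real k + 1) / 4" by simp
      then show ?thesis unfolding powr_powr by (simp only:)
    qed
    finally have "\<epsilon> k powr s = (1/2) powr ((real k + 1) / 4)" .
    moreover have "(1/2 :: real) powr (real k / 2) \<le> (1/2) powr ((real k + 1) / 4)"
      using elim(2) by (intro powr_mono') auto
    ultimately show ?case using elim(1) unfolding \<epsilon>_def by linarith
  qed
qed

lemma sparse_sequence_exists: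
  assumes h: "dimension_function h" and zero: "Limsup (at_right 0) (\<lambda>\<epsilon>. ereal (ln (h \<epsilon>) / ln \<epsilon>)) = 0"
  shows "\<exists>g. sparse_centers g \<and>
    (\<forall>\<eta>>0. eventually (\<lambda>k. (1/2) ^ k \<le> \<eta> * h ((1/7) / 9 ^ sparse_centers.center g k)) sequentially)"
proof -
  have "\<exists>M :: nat \<Rightarrow> nat. mono M \<and> filterlim M at_top sequentially \<and>
      eventually (\<lambda>k. (1/2) powr (real k / 2) \<le> h ((1/16) ^ ((M k + 1) * (k + 1)))) sequentially"
    by (rule diagonal_sequence[of "\<lambda>m k. (1/2) powr (real k / 2) \<le> h ((1/16) ^ ((m + 1) * (k + 1)))",
        OF slow_dimension_function[OF h zero]])
  then obtain M :: "nat \<Rightarrow> nat" where M: "mono M" "filterlim M at_top sequentially"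
    "eventually (\<lambda>k. (1/2) powr (real k / 2) \<le> h ((1/16) ^ ((M k + 1) * (k + 1)))) sequentially"
    by (elim exE conjE) (rule that)
  \<comment> \<open>The factor 2 makes \<open>g\<close> even, the extra 8 at odd indices creates the
    jumps, and the quarter of \<open>M\<close> keeps \<open>center k\<close> within the scale at
    which \<open>M\<close> controls \<open>h\<close>.\<close>
  define g where "g i = 2 * (M i div 4) + 8 + (if odd i then 8 else 0)" for i
  have Mdiv: "M i div 4 \<le> M j div 4" if "i \<le> j" for i j
    using monoD[OF M(1) that] by (rule div_le_mono)
  interpret sparse_centers g
  proof
    show "even (g i)" "8 \<le> g i" for i by (auto simp: g_def)
    show "filterlim g at_top sequentially"
      unfolding filterlim_at_top
    proof
      fix Z
      have "eventually (\<lambda>i. 4 * Z \<le> M i) sequentially" using M(2) unfolding filterlim_at_top by blast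
      then show "eventually (\<lambda>i. Z \<le> g i) sequentially"
      proof eventually_elim
        case (elim i)
        then have "Z \<le> M i div 4" by simp
        then show ?case by (simp add: g_def)
      qed
    qed
    have "(\<lambda>n. 2 * n) ` UNIV \<subseteq> {i. g i + 8 \<le> g (Suc i)}"
    proof
      fix i :: nat assume "i \<in> (\<lambda>n. 2 * n) ` UNIV"
      then have "even i" by auto
      then show "i \<in> {i. g i + 8 \<le> g (Suc i)}" using Mdiv[of i "Suc i"] by (simp add: g_def)
    qed
    moreover have "infinite ((\<lambda>n. 2 * n) ` (UNIV :: nat set))"
      by (rule range_inj_infinite) (simp add: inj_def)
    ultimately show "infinite {i. g i + 8 \<le> g (Suc i)}" using infinite_super by blast
  qed
  \<comment> \<open>\<open>2 * (M k div 4) + 16 <= M k + 1\<close> holds once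
    \<open>M k >= 30\<close>.\<close>
  have bound: "center k + 1 \<le> (M k + 1) * (k + 1)" if "M k \<ge> 30" for k
  proof -
    have "center k \<le> (\<Sum>i<k. M k + 1)"
      unfolding center_def
    proof (rule sum_mono)
      fix i assume "i \<in> {..<k}"
      then have "g i \<le> 2 * (M k div 4) + 16" using Mdiv[of i k] by (simp add: g_def)
      also have "\<dots> \<le> M k + 1" using that by linarith
      finally show "g i \<le> M k + 1" .
    qed
    then show ?thesis by (simp add: algebra_simps)
  qed
  have "eventually (\<lambda>k. (1/2) ^ k \<le> \<eta> * h ((1/7) / 9 ^ center k)) sequentially" if \<eta>: "\<eta> > 0" for \<eta>
  proof -
    have "(\<lambda>k. (sqrt (1/2)) ^ k) \<longlonglongrightarrow> 0" by (intro LIMSEQ_power_zero) (simp add: real_sqrt_divide)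
    then have "eventually (\<lambda>k. (sqrt (1/2)) ^ k < \<eta>) sequentially" using \<eta> by (rule order_tendstoD(2))
    moreover have "eventually (\<lambda>k. 30 \<le> M k) sequentially" using M(2) unfolding filterlim_at_top by blast
    ultimately show ?thesis using M(3)
    proof eventually_elim
      case (elim k)
      have half: "(1/2 :: real) powr (real k / 2) = (sqrt (1/2)) ^ k"
        by (simp add: powr_half_sqrt[symmetric] powr_realpow[symmetric] powr_powr)
      have "(1/16 :: real) ^ ((M k + 1) * (k + 1)) \<le> (1/16) ^ (center k + 1)"
        using bound[OF elim(2)] by (intro power_decreasing) auto
      also have "\<dots> = (1/16) * (1/16) ^ center k" by simp
      also have "\<dots> \<le> (1/7) * (1/9) ^ center k" by (intro mult_mono power_mono) auto
      also have "\<dots> = (1/7) / 9 ^ center k" by (simp add: power_one_over)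
      finally have le: "(1/16 :: real) ^ ((M k + 1) * (k + 1)) \<le> (1/7) / 9 ^ center k" .
      have "h ((1/16) ^ ((M k + 1) * (k + 1))) \<le> h ((1/7) / 9 ^ center k)"
        by (rule dimension_function_mono[OF h _ le]) simp
      then have hk: "(sqrt (1/2)) ^ k \<le> h ((1/7) / 9 ^ center k)" using elim(3) half by linarith
      \<comment> \<open>Half of the decay is matched by \<open>h\<close>, the other half falls below
        \<open>\<eta>\<close>.\<close>
      have "(1/2 :: real) ^ k = (sqrt (1/2)) ^ k * (sqrt (1/2)) ^ k"
        unfolding power_mult_distrib[symmetric] by simp
      also have "\<dots> \<le> \<eta> * h ((1/7) / 9 ^ center k)"
        using elim(1) hk \<eta> by (intro mult_mono) auto
      finally show ?case .
    qed
  qed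
  then show ?thesis using sparse_centers_axioms by blast
qed

text \<open>As its values are attainable, one family serves both non-sigma-finiteness and the
  equality of measures.\<close>

lemma large_attainable_family:
  assumes h: "dimension_function h" and zero: "Limsup (at_right 0) (\<lambda>\<epsilon>. ereal (ln (h \<epsilon>) / ln \<epsilon>)) = 0"
  shows "\<exists>X :: real \<Rightarrow> real. (\<forall>y. X y \<in> attainable_3) \<and>
    (\<forall>A. hausdorff_measure h A < \<infinity> \<longrightarrow> negligible {y \<in> {0..<1}. X y \<in> A})"
proof -
  obtain g where g: "sparse_centers g" and
    thin: "\<And>\<eta>. \<eta> > 0 \<Longrightarrow> eventually (\<lambda>k. (1/2) ^ k \<le> \<eta> * h ((1/7) / 9 ^ sparse_centers.center g k)) sequentially"
    using sparse_sequence_exists[OF h zero] by blast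
  interpret sparse_centers g by (rule g)
  have "\<forall>b. \<exists>t. cf_expansion (digits b) t" using cf_expansion_exists digits_pos by blast
  then obtain T where T: "\<And>b. cf_expansion (digits b) (T b)" by metis
  define X where "X y = T (bit_of y) 0" for y
  have "X y \<in> attainable_3" for y unfolding X_def by (rule coded_attainable[OF T])
  moreover have "negligible {y \<in> {0..<1}. X y \<in> A}" if "hausdorff_measure h A < \<infinity>" for A
  proof (rule finite_hausdorff_negligible[OF h _ _ thin that])
    show "(1/7) / 9 ^ center k > (0::real)" for k by simp
    show "(1/7) / 9 ^ center k \<le> \<bar>X y - X z\<bar>"
      if "\<And>i. i < k \<Longrightarrow> bit_of y i = bit_of z i" "bit_of y k \<noteq> bit_of z k" for y z k
      unfolding X_def by (rule coded_separation[of "bit_of y" "T (bit_of y)" "bit_of z" "T (bit_of z)", OF T T that])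
  qed
  ultimately show ?thesis by blast
qed

lemma not_negligible_unit_interval: "\<not> negligible {0..<1::real}"
proof
  assume "negligible {0..<1::real}"
  then have "measure lebesgue {0..<1::real} = 0" by (rule negligible_imp_measure0)
  then show False by simp
qed

lemma k_level_3_null:
  assumes h: "dimension_function h" and pos: "Limsup (at_right 0) (\<lambda>\<epsilon>. ereal (ln (h \<epsilon>) / ln \<epsilon>)) > 0"
  shows "hausdorff_null h k_level_3"
proof -
  obtain c where c: "c > 0" "frequently (\<lambda>\<epsilon>. h \<epsilon> \<le> \<epsilon> powr c) (at_right 0)"
    using Limsup_log_ratio_pos[OF h pos] by blast
  \<comment> \<open>Chosen so that \<open>\<beta> ^ l\<close> equals
    \<open>\<kappa> powr (- c / 2)\<close> for the scale \<open>\<kappa>\<close> below, which spends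
    half of the exponent gained from \<open>h\<close>.\<close>
  define \<beta> :: real where "\<beta> = (16/9) powr (c / 2)"
  have "\<beta> > 1" unfolding \<beta>_def using c(1) by simp
  then obtain l n W where l: "l > 0" and W: "finite W" "real (card W) \<le> \<beta> ^ l"
    "\<forall>w. length w = l \<longrightarrow> margin digit_word n w \<longrightarrow> w \<in> W"
    using digit_word_entropy by blast
  define \<kappa> :: real where "\<kappa> = (9/16) ^ l"
  have \<kappa>: "0 < \<kappa>" "\<kappa> < 1" using l by (auto simp: \<kappa>_def power_less_one_iff)
  have B: "real (card W) \<le> \<kappa> powr (- c / 2)"
  proof -
    have "\<beta> = (9/16) powr (- (c / 2))"
      unfolding \<beta>_def powr_minus inverse_eq_divide
      by (simp add: powr_divide)
    then have "\<beta> ^ l = ((9/16) powr (- (c / 2))) ^ l" by simp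
    also have "\<dots> = \<kappa> powr (- (c / 2))"
      unfolding \<kappa>_def by (simp add: powr_realpow[symmetric] powr_powr mult.commute)
    finally show ?thesis using W(2) by simp
  qed
  have "hausdorff_null h {x. \<forall>k. \<exists>v. length v = k \<and> (v, x) \<in> coded_reals W l a p}" for a p
  proof (rule box_count_null[OF h c \<kappa> _ B])
    fix k
    obtain F where F: "finite F" "card F \<le> card W ^ k"
      "{x. \<forall>k. \<exists>v. length v = k \<and> (v, x) \<in> coded_reals W l a p} \<subseteq> \<Union>F"
      "\<forall>U\<in>F. bounded U \<and> diameter U \<le> (9/16) ^ (k * l)"
      using coded_reals_cover[OF W(1), of k l a p] by blast
    have "real (card F) \<le> real (card W ^ k)" using F(2) by (rule of_nat_mono)
    then have "real (card F) \<le> real (card W) ^ k" by simp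
    moreover have "(9/16 :: real) ^ (k * l) = \<kappa> ^ k" unfolding \<kappa>_def power_mult[symmetric] by (simp add: mult.commute)
    ultimately show "\<exists>F. finite F \<and> real (card F) \<le> real (card W) ^ k \<and>
        {x. \<forall>k. \<exists>v. length v = k \<and> (v, x) \<in> coded_reals W l a p} \<subseteq> \<Union>F \<and>
        (\<forall>U\<in>F. bounded U \<and> diameter U \<le> \<kappa> ^ k)"
      using F(1,3,4) by (intro exI[of _ F]) simp
  qed simp
  then have "hausdorff_null h (\<Union>ap. case ap of (a, p) \<Rightarrow> {x. \<forall>k. \<exists>v. length v = k \<and> (v, x) \<in> coded_reals W l a p})"
    by (intro hausdorff_null_UN) (simp split: prod.splits)
  then show ?thesis using k_level_3_coded[OF W(3)] by (rule hausdorff_null_subset)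
qed

theorem theorem1p1:
  fixes h :: "real \<Rightarrow> real"
  assumes "dimension_function h"
  shows "(Limsup (at_right 0) (\<lambda>\<epsilon>. ereal (ln (h \<epsilon>) / ln \<epsilon>)) = 0
            \<longrightarrow> \<not> sigma_finite_hausdorff h k_level_3) \<and>
         (Limsup (at_right 0) (\<lambda>\<epsilon>. ereal (ln (h \<epsilon>) / ln \<epsilon>)) > 0
            \<longrightarrow> hausdorff_measure h k_level_3 = 0) \<and>
         (\<forall>g. dimension_function g
            \<longrightarrow> hausdorff_measure g attainable_3 = hausdorff_measure g k_level_3)"
proof (intro conjI impI allI notI)
  have sub: "attainable_3 \<subseteq> k_level_3" by (auto simp: attainable_3_def)
  show "hausdorff_measure h k_level_3 = 0" if "Limsup (at_right 0) (\<lambda>\<epsilon>. ereal (ln (h \<epsilon>) / ln \<epsilon>)) > 0"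
    by (rule hausdorff_null_imp_zero[OF k_level_3_null[OF assms that]])
  show False if zero: "Limsup (at_right 0) (\<lambda>\<epsilon>. ereal (ln (h \<epsilon>) / ln \<epsilon>)) = 0"
    and fin: "sigma_finite_hausdorff h k_level_3"
  proof -
    obtain X :: "real \<Rightarrow> real" where X: "\<And>y. X y \<in> attainable_3"
      "\<And>A. hausdorff_measure h A < \<infinity> \<Longrightarrow> negligible {y \<in> {0..<1}. X y \<in> A}"
      using large_attainable_family[OF assms zero] by blast
    obtain A :: "nat \<Rightarrow> real set" where A: "k_level_3 = (\<Union>i. A i)" "\<And>i. hausdorff_measure h (A i) < \<infinity>"
      using fin unfolding sigma_finite_hausdorff_def by blast
    \<comment> \<open>A sigma-finite decomposition would cover the whole parameter interval by null
      sets.\<close>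
    have neg: "negligible (\<Union>i. {y \<in> {0..<1}. X y \<in> A i})"
      by (rule negligible_countable_Union) (use X(2)[OF A(2)] in auto)
    have "{0..<1} \<subseteq> (\<Union>i. {y \<in> {0..<1}. X y \<in> A i})" using X(1) sub A(1) by blast
    from negligible_subset[OF neg this] show False using not_negligible_unit_interval by contradiction
  qed
  fix f :: "real \<Rightarrow> real" assume f: "dimension_function f"
  show "hausdorff_measure f attainable_3 = hausdorff_measure f k_level_3"
  proof (cases "Limsup (at_right 0) (\<lambda>\<epsilon>. ereal (ln (f \<epsilon>) / ln \<epsilon>)) = 0")
    case True
    obtain X :: "real \<Rightarrow> real" where X: "\<And>y. X y \<in> attainable_3"
      "\<And>A. hausdorff_measure f A < \<infinity> \<Longrightarrow> negligible {y \<in> {0..<1}. X y \<in> A}"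
      using large_attainable_family[OF f True] by blast
    have inf: "hausdorff_measure f A = \<infinity>" if "attainable_3 \<subseteq> A" for A
    proof (rule ccontr)
      assume "hausdorff_measure f A \<noteq> \<infinity>"
      then have "negligible {y \<in> {0..<1}. X y \<in> A}" by (intro X(2)) (simp add: less_top)
      moreover have "{y \<in> {0..<1}. X y \<in> A} = {0..<1}" using X(1) that by blast
      ultimately have "negligible {0..<1::real}" by (simp only:)
      then show False using not_negligible_unit_interval by contradiction
    qed
    show ?thesis unfolding inf[OF sub] inf[OF subset_refl] by (rule refl)
  next
    case False
    then have "Limsup (at_right 0) (\<lambda>\<epsilon>. ereal (ln (f \<epsilon>) / ln \<epsilon>)) > 0"
      using Limsup_log_ratio_nonneg[OF f] by (simp add: order.not_eq_order_implies_strict)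
    then have null: "hausdorff_null f k_level_3" by (rule k_level_3_null[OF f])
    then show ?thesis
      using hausdorff_null_imp_zero[OF null] hausdorff_null_imp_zero[OF hausdorff_null_subset[OF null sub]] by simp
  qed
qed

end
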